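(* Let $\Gamma=(V,E)$ be a metric graph with total length $L(\Gamma)$ and length of the shortest edge $\ell_{\min}$, and let $p\in[1,\infty]$. Then, for any $q\in L^p(\Gamma)$ and any coupling strengths $\{\alpha_v\in\mathbb R\cup\{\infty\}:v\in V\}$, one has $$\lambda_k(H_q)\le\left(\frac{2k}{\ell_{\min}}\right)^{1/p}\|q_+\|_{L^p(\Gamma)}+\frac{\pi^2}{L(\Gamma)^2}(k-1+|E|)^2\qquad\text{for all integers }k\ge1.$$
   Context: A metric graph $\Gamma=(V,E)$ is a finite graph (not necessarily connected, loops and multiple edges allowed, every vertex is an endpoint of some edge, at least one edge) in which each edge $e\in E$ is identified with an interval $[0,\ell_e]$ of finite length $\ell_e>0$, endpoints of intervals being glued at the vertices. $L(\Gamma)=\sum_{e\in E}\ell_e$, $\ell_{\min}=\min_e\ell_e$. $L^p(\Gamma)$ is taken with respect to the Lebesgue measure on the edges. Convention: $1/p=0$ if $p=\infty$. For a function $q$, $q_+=\max(q,0)$. All functions are real-valued. $W^{1,2}(\Gamma)$ is the space of functions in $\bigoplus_{e\in E}W^{1,2}(e)$ that are continuous on $\Gamma$. Given $q\in L^1(\Gamma)$ and coupling strengths $\alpha_v\in\mathbb R\cup\{\infty\}$ ($v\in V$), the Schrödinger operator $H_qf=-f''+qf$ is considered with the following vertex conditions: $f$ is continuous on $\Gamma$; at each $v$ with $\alpha_v\in\mathbb R$, $\sum_{e\in E_v}f_e'(v)=\alpha_vf(v)$, where $E_v$ is the set of edges attached to $v$ and $f_e'(v)$ is the derivative of $f$ at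 $v$ in the direction pointing out of $v$ into $e$; at each $v$ with $\alpha_v=\infty$, the Dirichlet condition $f(v)=0$. Its eigenvalues $\lambda_1(H_q)\le\lambda_2(H_q)\le\cdots\nearrow\infty$, counted with multiplicity, satisfy $$\lambda_k(H_q)=\min_{\substack{F\subset D\\ \dim F=k}}\ \max_{f\in F\setminus\{0\}}\frac{\int_\Gamma (f')^2\,dx+\sum_{v:\alpha_v<\infty}\alpha_vf(v)^2+\int_\Gamma qf^2\,dx}{\int_\Gamma f^2\,dx},$$ where $D=\{f\in W^{1,2}(\Gamma): f(v)=0 \text{ whenever }\alpha_v=\infty\}$. *)

theory Defs
  imports "HOL-Analysis.Analysis" "Graph_Theory.Digraph"
begin

(* The orientation of an arc e records the identification of the edge with {0..len e}:
   tail e sits at 0 and head e at len e.  Loops and parallel arcs are allowed by fin_digraph. *)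
locale metric_graph = fin_digraph G for G :: "('v, 'e) pre_digraph" (structure) +
  fixes len :: "'e \<Rightarrow> real"
  assumes arcs_nonempty: "arcs G \<noteq> {}"
    and len_pos: "e \<in> arcs G \<Longrightarrow> 0 < len e"
    and no_isolated_vertex: "v \<in> verts G \<Longrightarrow> \<exists>e\<in>arcs G. tail G e = v \<or> head G e = v"

definition total_length :: "('v, 'e) pre_digraph \<Rightarrow> ('e \<Rightarrow> real) \<Rightarrow> real" where
  "total_length G len = (\<Sum>e\<in>arcs G. len e)"

definition min_length :: "('v, 'e) pre_digraph \<Rightarrow> ('e \<Rightarrow> real) \<Rightarrow> real" where
  "min_length G len = Min (len ` arcs G)"

(* A function on the graph is a family f of functions on the edges; only the values f e x
   with e an arc and x in {0..len e} are relevant. *)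
abbreviation edge_measure :: "('e \<Rightarrow> real) \<Rightarrow> 'e \<Rightarrow> real measure" where
  "edge_measure len e \<equiv> lebesgue_on {0..len e}"

definition recip_exponent :: "ennreal \<Rightarrow> real" where
  "recip_exponent p = (if p = \<infinity> then 0 else 1 / enn2real p)"

definition in_Lp ::
  "('v, 'e) pre_digraph \<Rightarrow> ('e \<Rightarrow> real) \<Rightarrow> ennreal \<Rightarrow> ('e \<Rightarrow> real \<Rightarrow> real) \<Rightarrow> bool" where
  "in_Lp G len p g \<longleftrightarrow>
     (\<forall>e\<in>arcs G. g e \<in> borel_measurable (edge_measure len e)) \<and>
     (if p = \<infinity>
      then \<exists>C. \<forall>e\<in>arcs G. AE x in edge_measure len e. \<bar>g e x\<bar> \<le> C
      else \<forall>e\<in>arcs G. integrable (edge_measure len e) (\<lambda>x. \<bar>g e x\<bar> powr enn2real p))"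

definition Lp_norm ::
  "('v, 'e) pre_digraph \<Rightarrow> ('e \<Rightarrow> real) \<Rightarrow> ennreal \<Rightarrow> ('e \<Rightarrow> real \<Rightarrow> real) \<Rightarrow> real" where
  "Lp_norm G len p g =
     (if p = \<infinity>
      then Inf {C. 0 \<le> C \<and> (\<forall>e\<in>arcs G. AE x in edge_measure len e. \<bar>g e x\<bar> \<le> C)}
      else (\<Sum>e\<in>arcs G. LINT x|edge_measure len e. \<bar>g e x\<bar> powr enn2real p)
             powr recip_exponent p)"

(* u is the absolutely continuous representative of a W^{1,1} function on {a..b}
   with weak derivative w. *)
definition has_weak_deriv :: "real \<Rightarrow> real \<Rightarrow> (real \<Rightarrow> real) \<Rightarrow> (real \<Rightarrow> real) \<Rightarrow> bool" where
  "has_weak_deriv a b u w \<longleftrightarrow>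
     integrable (lebesgue_on {a..b}) w \<and>
     (\<forall>x\<in>{a..b}. u x = u a + (LINT t|lebesgue_on {a..x}. w t))"

(* The edgewise function f is continuous across the vertices, with vertex values \<phi>. *)
definition vertex_values ::
  "('v, 'e) pre_digraph \<Rightarrow> ('e \<Rightarrow> real) \<Rightarrow> ('e \<Rightarrow> real \<Rightarrow> real) \<Rightarrow> ('v \<Rightarrow> real) \<Rightarrow> bool" where
  "vertex_values G len f \<phi> \<longleftrightarrow>
     (\<forall>e\<in>arcs G. f e 0 = \<phi> (tail G e) \<and> f e (len e) = \<phi> (head G e))"

(* The sum of the derivatives f1 at v pointing out of v into the edges.  A loop at v has two
   ends at v and contributes both of its outgoing derivatives. *)
definition outgoing_deriv_sum ::
  "('v, 'e) pre_digraph \<Rightarrow> ('e \<Rightarrow> real) \<Rightarrow> ('e \<Rightarrow> real \<Rightarrow> real) \<Rightarrow> 'v \<Rightarrow> real" where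
  "outgoing_deriv_sum G len f1 v =
     (\<Sum>e\<in>out_arcs G v. f1 e 0) + (\<Sum>e\<in>in_arcs G v. - f1 e (len e))"

(* Graph of the operator H_q: f lies in its domain and H_q f = h in L^2.  The function f1 is
   the absolutely continuous (hence pointwise determined) derivative f', and f2 = f''.
   In particular f1 is bounded, so f belongs to W^{1,2}. *)
definition schroedinger ::
  "('v, 'e) pre_digraph \<Rightarrow> ('e \<Rightarrow> real) \<Rightarrow> ('e \<Rightarrow> real \<Rightarrow> real) \<Rightarrow> ('v \<Rightarrow> ereal) \<Rightarrow>
     ('e \<Rightarrow> real \<Rightarrow> real) \<Rightarrow> ('e \<Rightarrow> real \<Rightarrow> real) \<Rightarrow> bool" where
  "schroedinger G len q \<alpha> f h \<longleftrightarrow>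
     (\<exists>f1 f2 \<phi>.
        (\<forall>e\<in>arcs G. has_weak_deriv 0 (len e) (f e) (f1 e) \<and>
                     has_weak_deriv 0 (len e) (f1 e) (f2 e)) \<and>
        in_Lp G len 2 h \<and>
        (\<forall>e\<in>arcs G. AE x in edge_measure len e. h e x = - f2 e x + q e x * f e x) \<and>
        vertex_values G len f \<phi> \<and>
        (\<forall>v\<in>verts G. if \<alpha> v = \<infinity> then \<phi> v = 0
                      else outgoing_deriv_sum G len f1 v = real_of_ereal (\<alpha> v) * \<phi> v))"

(* The eigenspace for \<mu>, zero function included. *)
definition eigenspace ::
  "('v, 'e) pre_digraph \<Rightarrow> ('e \<Rightarrow> real) \<Rightarrow> ('e \<Rightarrow> real \<Rightarrow> real) \<Rightarrow> ('v \<Rightarrow> ereal) \<Rightarrow> real \<Rightarrow>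
     ('e \<Rightarrow> real \<Rightarrow> real) set" where
  "eigenspace G len q \<alpha> \<mu> = {f. schroedinger G len q \<alpha> f (\<lambda>e x. \<mu> * f e x)}"

definition lin_indep_on_graph ::
  "('v, 'e) pre_digraph \<Rightarrow> ('e \<Rightarrow> real) \<Rightarrow> nat \<Rightarrow> (nat \<Rightarrow> 'e \<Rightarrow> real \<Rightarrow> real) \<Rightarrow> bool" where
  "lin_indep_on_graph G len k u \<longleftrightarrow>
     (\<forall>c :: nat \<Rightarrow> real.
        (\<forall>e\<in>arcs G. \<forall>x\<in>{0..len e}. (\<Sum>i<k. c i * u i e x) = 0) \<longrightarrow> (\<forall>i<k. c i = 0))"

(* There are at least k eigenvalues \<le> \<mu>, counted with multiplicity. *)
definition at_least_eigenvalues ::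
  "('v, 'e) pre_digraph \<Rightarrow> ('e \<Rightarrow> real) \<Rightarrow> ('e \<Rightarrow> real \<Rightarrow> real) \<Rightarrow> ('v \<Rightarrow> ereal) \<Rightarrow>
     nat \<Rightarrow> real \<Rightarrow> bool" where
  "at_least_eigenvalues G len q \<alpha> k \<mu> \<longleftrightarrow>
     (\<exists>u \<nu>. lin_indep_on_graph G len k u \<and>
        (\<forall>i<k. \<nu> i \<le> \<mu> \<and> u i \<in> eigenspace G len q \<alpha> (\<nu> i)))"

(* The k-th eigenvalue, k \<ge> 1, in increasing order and counted with multiplicity.  The spectrum
   is discrete, infinite and bounded below, so the infimum is over a nonempty set and attained. *)
definition eigenvalue ::
  "('v, 'e) pre_digraph \<Rightarrow> ('e \<Rightarrow> real) \<Rightarrow> ('e \<Rightarrow> real \<Rightarrow> real) \<Rightarrow> ('v \<Rightarrow> ereal) \<Rightarrow>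
     nat \<Rightarrow> real" where
  "eigenvalue G len q \<alpha> k = Inf {\<mu>. at_least_eigenvalues G len q \<alpha> k \<mu>}"

end

(* Disjointly supported test functions bound the eigenvalue from above.  Intervals of length
   h = L / (k - 1 + |E|) fit into the edges at least k times, since every edge wastes less than h.
   On each interval take a half period of a sine: its kinetic quotient is (pi / h)^2, and Hoelder's
   inequality together with f^2 <= 1, where f^2 has integral h / 2, bounds its potential quotient
   by (2 / h)^(1/p) times the norm of the positive part of q.  Finally 1 / h <= k / l_min.

   Since eigenvalues are defined through the differential operator, the min-max principle has to be
   proved.  Eigenfunctions are obtained one after the other by minimising the quadratic form over
   the mass-orthogonal complement of the previous ones: Arzela-Ascoli makes a minimising sequence
   converge in mass, the parallelogram identity upgrades this to convergence in the form norm, and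
   the du Bois-Reymond argument identifies the minimisers as solutions of the vertex problem. *)

theory Submission
  imports Defs "HOL-Library.Function_Algebras" "HOL-Complex_Analysis.Great_Picard"
begin

section \<open>Quadratic forms and weak eigenvectors\<close>

text \<open>The eigenvalue is an infimum over a set built from solutions of the differential
  equation, so an upper bound must produce genuine eigenfunctions although \<open>q\<close> is
  merely integrable, and the set must be shown to be bounded below. What is proved of min-max is
  this half: k independent test vectors whose span has quotients at most \<mu> yield k orthonormal
  eigenvectors with eigenvalues at most \<mu>. An element of the form domain is a function together
  with one chosen weak derivative, and its values off the edges are arbitrary. Nonzero elements can
  therefore be null for mass and energy alike, so the abstract part works with semidefinite forms
  and lets Cauchy-Schwarz deal with null vectors. The forms live on a subspace because integrals are
  additive only where the products are integrable. One estimate controls point values, vertex terms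
  and \<open>q\<close> together: the squared supremum is at most 2/\<delta> times the mass plus
  2\<delta> times the kinetic energy, with \<delta> free. A small \<delta> absorbs the potential
  into the kinetic energy.\<close>

locale sym_form =
  fixes D :: "'x::real_vector set" and c :: "'x \<Rightarrow> 'x \<Rightarrow> real"
  assumes subspace_D: "subspace D"
    and sym: "\<lbrakk>x \<in> D; y \<in> D\<rbrakk> \<Longrightarrow> c x y = c y x"
    and add_left: "\<lbrakk>x \<in> D; y \<in> D; z \<in> D\<rbrakk> \<Longrightarrow> c (x + y) z = c x z + c y z"
    and scale_left: "\<lbrakk>x \<in> D; y \<in> D\<rbrakk> \<Longrightarrow> c (r *\<^sub>R x) y = r * c x y"
begin

lemma D_add: "\<lbrakk>x \<in> D; y \<in> D\<rbrakk> \<Longrightarrow> x + y \<in> D"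
  and D_scale: "x \<in> D \<Longrightarrow> r *\<^sub>R x \<in> D"
  and D_diff: "\<lbrakk>x \<in> D; y \<in> D\<rbrakk> \<Longrightarrow> x - y \<in> D"
  and D_sum: "(\<And>i. i \<in> I \<Longrightarrow> u i \<in> D) \<Longrightarrow> (\<Sum>i\<in>I. u i) \<in> D"
  and D_zero: "0 \<in> D"
  using subspace_D by (auto simp: subspace_add subspace_scale subspace_diff subspace_sum subspace_0)

lemma add_right: "\<lbrakk>x \<in> D; y \<in> D; z \<in> D\<rbrakk> \<Longrightarrow> c x (y + z) = c x y + c x z"
  using add_left[of y z x] by (simp add: sym D_add)

lemma scale_right: "\<lbrakk>x \<in> D; y \<in> D\<rbrakk> \<Longrightarrow> c x (r *\<^sub>R y) = r * c x y"
  using scale_left[of y x r] by (simp add: sym D_scale)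

lemma diff_left: "\<lbrakk>x \<in> D; y \<in> D; z \<in> D\<rbrakk> \<Longrightarrow> c (x - y) z = c x z - c y z"
  using add_left[of x "(-1) *\<^sub>R y" z] scale_left[of y z "-1"] D_scale[of y "-1"] by simp

lemma diff_right: "\<lbrakk>x \<in> D; y \<in> D; z \<in> D\<rbrakk> \<Longrightarrow> c x (y - z) = c x y - c x z"
  using diff_left[of y z x] by (simp add: sym D_diff)

lemma zero_left: "x \<in> D \<Longrightarrow> c 0 x = 0"
  using scale_left[of x x 0] by simp

lemma sum_left:
  assumes "\<And>i. i \<in> I \<Longrightarrow> u i \<in> D" "y \<in> D"
  shows "c (\<Sum>i\<in>I. r i *\<^sub>R u i) y = (\<Sum>i\<in>I. r i * c (u i) y)"
  using assms
proof (induction I rule: infinite_finite_induct)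
  case (insert i I)
  then show ?case
    by (simp add: add_left scale_left D_scale D_sum)
qed (auto simp: zero_left)

lemma square_add:
  "\<lbrakk>x \<in> D; y \<in> D\<rbrakk> \<Longrightarrow> c (x + y) (x + y) = c x x + 2 * c x y + c y y"
  using add_left[of x y "x + y"] add_right[of x x y] add_right[of y x y] sym[of x y]
  by (simp add: D_add)

lemma square_diff:
  "\<lbrakk>x \<in> D; y \<in> D\<rbrakk> \<Longrightarrow> c (x - y) (x - y) = c x x - 2 * c x y + c y y"
  using diff_left[of x y "x - y"] diff_right[of x x y] diff_right[of y x y] sym[of x y]
  by (simp add: D_diff)

lemma square_scale: "x \<in> D \<Longrightarrow> c (r *\<^sub>R x) (r *\<^sub>R x) = r\<^sup>2 * c x x"
  by (simp add: scale_left scale_right D_scale power2_eq_square)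

lemma subform: "subspace S \<Longrightarrow> S \<subseteq> D \<Longrightarrow> sym_form S c"
  by unfold_locales (auto simp: sym add_left scale_left subsetD)

lemma lincomb:
  assumes "sym_form D d"
  shows "sym_form D (\<lambda>x y. c x y + r * d x y)"
proof -
  interpret d: sym_form D d by fact
  show ?thesis
    by unfold_locales
      (auto simp: subspace_D sym d.sym add_left d.add_left scale_left d.scale_left algebra_simps)
qed

end

locale psd_form = sym_form +
  assumes nonneg: "x \<in> D \<Longrightarrow> 0 \<le> c x x"
begin

lemma Cauchy_Schwarz:
  assumes "x \<in> D" "y \<in> D"
  shows "(c x y)\<^sup>2 \<le> c x x * c y y"
proof -
  have q: "0 \<le> s\<^sup>2 * c x x - 2 * s * t * c x y + t\<^sup>2 * c y y" for s t
    using nonneg[of "s *\<^sub>R x - t *\<^sub>R y"] assms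
    by (simp add: square_diff D_diff D_scale scale_left scale_right power2_eq_square mult_ac)
  show ?thesis
  proof (cases "c y y = 0")
    case False
    then have "c y y > 0" using nonneg[OF assms(2)] by simp
    \<comment> \<open>The vector is the usual \<open>x - (c x y / c y y) *\<^sub>R y\<close> with
      its denominator cleared.\<close>
    moreover have "0 \<le> c y y * (c x x * c y y - (c x y)\<^sup>2)"
      using q[of "c y y" "c x y"] by (simp add: algebra_simps power2_eq_square)
    ultimately show ?thesis by (simp add: zero_le_mult_iff)
  next
    case True
    have "c x y = 0"
    proof (rule ccontr)
      assume nz: "c x y \<noteq> 0"
      \<comment> \<open>For \<open>c y y = 0\<close> and \<open>s = 1\<close> the quadratic is
        affine in \<open>t\<close> with nonzero slope; this \<open>t\<close> gives it the value
        -1.\<close>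
      show False
        using q[of 1 "(c x x + 1) / (2 * c x y)"] nz True by (simp add: field_simps)
    qed
    then show ?thesis using True by simp
  qed
qed

lemma null_left: "\<lbrakk>x \<in> D; y \<in> D; c x x = 0\<rbrakk> \<Longrightarrow> c x y = 0"
  using Cauchy_Schwarz[of x y] by simp

lemma tendsto_left:
  assumes "\<And>n. u n \<in> D" "x \<in> D" "y \<in> D" "(\<lambda>n. c (u n - x) (u n - x)) \<longlonglongrightarrow> 0"
  shows "(\<lambda>n. c (u n) y) \<longlonglongrightarrow> c x y"
proof -
  have "(\<lambda>n. sqrt (c (u n - x) (u n - x) * c y y)) \<longlonglongrightarrow> sqrt (0 * c y y)"
    by (intro tendsto_real_sqrt tendsto_mult_right assms)
  moreover have "\<bar>c (u n - x) y\<bar> \<le> sqrt (c (u n - x) (u n - x) * c y y)" for n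
    by (rule real_le_rsqrt) (simp only: power2_abs Cauchy_Schwarz D_diff assms)
  ultimately have "(\<lambda>n. c (u n - x) y) \<longlonglongrightarrow> 0"
    by (intro Lim_null_comparison[OF always_eventually, of "\<lambda>n. c (u n - x) y"
          "\<lambda>n. sqrt (c (u n - x) (u n - x) * c y y)"])
       (simp_all only: real_norm_def mult_zero_left real_sqrt_zero simp_thms)
  then have "(\<lambda>n. c (u n) y - c x y) \<longlonglongrightarrow> 0"
    using assms by (simp add: diff_left)
  then show ?thesis by (rule LIM_zero_cancel)
qed

lemma tendsto_square:
  assumes "\<And>n. u n \<in> D" "x \<in> D" "(\<lambda>n. c (u n - x) (u n - x)) \<longlonglongrightarrow> 0"
  shows "(\<lambda>n. c (u n) (u n)) \<longlonglongrightarrow> c x x"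
proof -
  have "(\<lambda>n. c (u n - x) (u n - x) + 2 * c (u n) x - c x x) \<longlonglongrightarrow> 0 + 2 * c x x - c x x"
    by (intro tendsto_intros tendsto_left assms)
  moreover have "c (u n - x) (u n - x) + 2 * c (u n) x - c x x = c (u n) (u n)" for n
    using assms by (simp add: square_diff)
  ultimately show ?thesis by simp
qed

end

text \<open>Gaussian elimination, by induction on the number of equations. This is the dimension
  count of min-max: the span of k test vectors contains a nontrivial combination orthogonal to fewer
  than k eigenvectors.\<close>

lemma homogeneous_system_nontrivial:
  fixes A :: "nat \<Rightarrow> 'j \<Rightarrow> real"
  assumes "finite J" "m < card J"
  obtains c where "\<exists>j\<in>J. c j \<noteq> 0" "\<And>i. i < m \<Longrightarrow> (\<Sum>j\<in>J. c j * A i j) = 0"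
proof -
  have "\<exists>c. (\<exists>j\<in>J. c j \<noteq> 0) \<and> (\<forall>i<m. (\<Sum>j\<in>J. c j * A i j) = 0)"
    using assms
  proof (induction m arbitrary: A J)
    case 0
    then show ?case by (intro exI[of _ "\<lambda>_. 1"]) (auto simp: card_gt_0_iff)
  next
    case (Suc m)
    show ?case
    proof (cases "\<forall>j\<in>J. A m j = 0")
      case True
      with Suc.IH[of J A] Suc.prems show ?thesis
        by (auto simp: less_Suc_eq)
    next
      case False
      then obtain k where k: "k \<in> J" "A m k \<noteq> 0" by auto
      define B where "B i j = A i j - A i k * A m j / A m k" for i j
      have "m < card (J - {k})" using Suc.prems k by simp
      from Suc.IH[OF _ this, of B] Suc.prems obtain c where
        c: "\<exists>j\<in>J - {k}. c j \<noteq> 0" "\<And>i. i < m \<Longrightarrow> (\<Sum>j\<in>J - {k}. c j * B i j) = 0"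
        by auto
      \<comment> \<open>The value at \<open>k\<close> is the one that equation \<open>m\<close>
        forces; substituting it into the other equations produces the coefficients
        \<open>B\<close>.\<close>
      define d where "d = c(k := - (\<Sum>j\<in>J - {k}. c j * A m j) / A m k)"
      have "(\<Sum>j\<in>J. d j * A i j) = (\<Sum>j\<in>J - {k}. c j * B i j)" for i
      proof -
        have "(\<Sum>j\<in>J. d j * A i j) = d k * A i k + (\<Sum>j\<in>J - {k}. c j * A i j)"
          using Suc.prems k by (subst sum.remove[of _ k]) (auto simp: d_def intro!: sum.cong)
        also have "\<dots> = (\<Sum>j\<in>J - {k}. c j * B i j)"
          using k by (simp add: d_def B_def algebra_simps sum_subtractf sum_divide_distrib
              sum_distrib_left sum_distrib_right)
        finally show ?thesis .
      qed
      moreover have "(\<Sum>j\<in>J - {k}. c j * B m j) = 0"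
        using k by (simp add: B_def)
      ultimately have "(\<Sum>j\<in>J. d j * A i j) = 0" if "i < Suc m" for i
        using that c(2) by (cases "i = m") auto
      moreover have "\<exists>j\<in>J. d j \<noteq> 0"
        using c(1) by (auto simp: d_def)
      ultimately show ?thesis by blast
    qed
  qed
  with that show thesis by blast
qed

text \<open>\<open>compact\<close> is the compact embedding of the form domain into the mass space,
  \<open>complete\<close> the closedness of the form. Compactness gives only a mass-Cauchy
  subsequence, because a limit in mass alone could leave \<open>D\<close>; a limit inside
  \<open>D\<close> comes from \<open>complete\<close>, once the sequence is Cauchy for
  \<open>a\<close> as well.\<close>

locale compact_form_pair = a: psd_form D a + b: psd_form D b
  for D :: "'x::real_vector set" and a b :: "'x \<Rightarrow> 'x \<Rightarrow> real" +
  assumes compact: "\<And>K u. (\<And>n. u n \<in> D \<and> b (u n) (u n) = 1 \<and> a (u n) (u n) \<le> K) \<Longrightarrow>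
      \<exists>r::nat \<Rightarrow> nat. strict_mono r \<and>
        (\<forall>\<epsilon>>0. \<exists>N. \<forall>m\<ge>N. \<forall>n\<ge>N. b (u (r m) - u (r n)) (u (r m) - u (r n)) < \<epsilon>)"
    and complete: "\<And>u. (\<And>n. u n \<in> D) \<Longrightarrow>
      (\<And>\<epsilon>. \<epsilon> > 0 \<Longrightarrow> \<exists>N. \<forall>m\<ge>N. \<forall>n\<ge>N.
          a (u m - u n) (u m - u n) < \<epsilon> \<and> b (u m - u n) (u m - u n) < \<epsilon>) \<Longrightarrow>
      \<exists>x\<in>D. (\<lambda>n. a (u n - x) (u n - x)) \<longlonglongrightarrow> 0 \<and> (\<lambda>n. b (u n - x) (u n - x)) \<longlonglongrightarrow> 0"
begin

text \<open>The parallelogram identity upgrades b-convergence of a minimising sequence to a-convergence,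
  so that no weak compactness is needed.\<close>

lemma minimiser_exists:
  assumes S: "subspace S" "S \<subseteq> D"
    and closed: "\<And>u x. (\<And>n. u n \<in> S) \<Longrightarrow> x \<in> D \<Longrightarrow>
       (\<lambda>n. b (u n - x) (u n - x)) \<longlonglongrightarrow> 0 \<Longrightarrow> x \<in> S"
    and y: "y \<in> S" "b y y > 0" "a y y \<le> \<mu> * b y y"
  obtains x l where "x \<in> S" "b x x = 1" "a x x = l" "l \<le> \<mu>"
    "\<And>z. z \<in> S \<Longrightarrow> l * b z z \<le> a z z"
proof -
  define R where "R = {a x x |x. x \<in> S \<and> b x x = 1}"
  define l where "l = Inf R"
  have bdd: "bdd_below R"
    unfolding R_def using S(2) a.nonneg by (intro bdd_belowI[of _ 0]) blast
  have normalise: "\<exists>t>0. t *\<^sub>R z \<in> S \<and> b (t *\<^sub>R z) (t *\<^sub>R z) = 1 \<and> t\<^sup>2 * b z z = 1"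
    if "z \<in> S" "b z z > 0" for z
    using that S by (intro exI[of _ "1 / sqrt (b z z)"])
      (auto simp: subspace_scale b.square_scale subsetD power_divide)
  obtain t where t: "t > 0" "t *\<^sub>R y \<in> S" "b (t *\<^sub>R y) (t *\<^sub>R y) = 1" "t\<^sup>2 * b y y = 1"
    using normalise[OF y(1,2)] by blast
  have tR: "t\<^sup>2 * a y y \<in> R"
  proof -
    have "t\<^sup>2 * a y y = a (t *\<^sub>R y) (t *\<^sub>R y)"
      using y S by (simp add: a.square_scale subsetD)
    then show ?thesis unfolding R_def using t by blast
  qed
  have "t\<^sup>2 * a y y \<le> t\<^sup>2 * (\<mu> * b y y)"
    using y by (intro mult_left_mono) auto
  also have "\<dots> = \<mu> * (t\<^sup>2 * b y y)" by (simp only: mult_ac)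
  also have "\<dots> = \<mu>" by (simp only: t mult_1_right)
  finally have "t\<^sup>2 * a y y \<le> \<mu>" .
  moreover have "l \<le> t\<^sup>2 * a y y"
    unfolding l_def by (rule cInf_lower[OF tR bdd])
  ultimately have "l \<le> \<mu>" by linarith
  have lower: "l * b z z \<le> a z z" if z: "z \<in> S" for z
  proof (cases "b z z > 0")
    case True
    obtain s where s: "s > 0" "s *\<^sub>R z \<in> S" "b (s *\<^sub>R z) (s *\<^sub>R z) = 1" "s\<^sup>2 * b z z = 1"
      using normalise[OF z True] by blast
    have "a (s *\<^sub>R z) (s *\<^sub>R z) \<in> R" unfolding R_def using s by blast
    then have "l \<le> a (s *\<^sub>R z) (s *\<^sub>R z)"
      unfolding l_def by (rule cInf_lower[OF _ bdd])
    then have "l \<le> s\<^sup>2 * a z z"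
      using z S by (simp add: a.square_scale subsetD)
    then have "l * b z z \<le> s\<^sup>2 * a z z * b z z" using True by (intro mult_right_mono) auto
    also have "\<dots> = a z z * (s\<^sup>2 * b z z)" by (simp only: mult_ac)
    also have "\<dots> = a z z" by (simp only: s mult_1_right)
    finally show ?thesis .
  next
    case False
    then have "b z z = 0" using b.nonneg[of z] z S by auto
    then show ?thesis using a.nonneg[of z] z S by auto
  qed
  have "\<exists>u. u \<in> S \<and> b u u = 1 \<and> a u u < l + inverse (real (Suc n))" for n
  proof -
    have "\<exists>r\<in>R. r < l + inverse (real (Suc n))"
      using tR bdd by (subst cInf_less_iff[symmetric]) (auto simp: l_def)
    then show ?thesis by (auto simp: R_def)
  qed
  then obtain u where u: "\<And>n. u n \<in> S" "\<And>n. b (u n) (u n) = 1"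
    "\<And>n. a (u n) (u n) < l + inverse (real (Suc n))" by metis
  have uD: "u n \<in> D" for n using u S by auto
  have "a (u n) (u n) \<le> l + 1" for n
  proof -
    have "inverse (real (Suc n)) \<le> 1" by (simp add: inverse_le_1_iff)
    then show ?thesis using u(3)[of n] by linarith
  qed
  then obtain r :: "nat \<Rightarrow> nat" where r: "strict_mono r"
    "\<And>\<epsilon>. \<epsilon> > 0 \<Longrightarrow> \<exists>N. \<forall>m\<ge>N. \<forall>n\<ge>N. b (u (r m) - u (r n)) (u (r m) - u (r n)) < \<epsilon>"
    using compact[of u "l + 1"] u uD by metis
  define v where "v = u \<circ> r"
  have v: "v n \<in> S" "v n \<in> D" "b (v n) (v n) = 1" for n
    using u uD by (auto simp: v_def)
  have l0: "0 \<le> l"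
    unfolding l_def
  proof (rule cInf_greatest)
    show "R \<noteq> {}" using tR by blast
    show "0 \<le> s" if "s \<in> R" for s
      using that S(2) a.nonneg unfolding R_def by blast
  qed
  have av_lim: "(\<lambda>n. a (v n) (v n)) \<longlonglongrightarrow> l"
  proof (rule real_tendsto_sandwich)
    show "\<forall>\<^sub>F n in sequentially. l \<le> a (v n) (v n)"
      using lower[OF v(1)] v(3) by (intro always_eventually) simp
    show "\<forall>\<^sub>F n in sequentially. a (v n) (v n) \<le> l + inverse (real (Suc (r n)))"
      using u(3) by (intro always_eventually) (simp add: v_def less_imp_le)
    have "(\<lambda>n. inverse (real (Suc (r n)))) \<longlonglongrightarrow> 0"
      using LIMSEQ_subseq_LIMSEQ[OF LIMSEQ_inverse_real_of_nat r(1)] by (simp add: comp_def)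
    then show "(\<lambda>n. l + inverse (real (Suc (r n)))) \<longlonglongrightarrow> l"
      using tendsto_add[OF tendsto_const[of l]] by fastforce
  qed auto
  have Cauchy: "\<exists>N. \<forall>m\<ge>N. \<forall>n\<ge>N.
      a (v m - v n) (v m - v n) < \<epsilon> \<and> b (v m - v n) (v m - v n) < \<epsilon>" if "\<epsilon> > 0" for \<epsilon>
  proof -
    \<comment> \<open>The parallelogram identity will give the bound
      \<open>4 * \<delta> + l * \<delta>\<close>: four times the excess of \<open>a\<close> over its
      infimum, and \<open>l\<close> times the mass of the difference. The 5 leaves room for a strict
      inequality and keeps the divisor positive.\<close>
    define \<delta> where "\<delta> = \<epsilon> / (5 + l)"
    have \<delta>: "\<delta> > 0" "\<delta> * (5 + l) = \<epsilon>" using that l0 by (auto simp: \<delta>_def)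
    obtain N1 where N1: "\<And>n. n \<ge> N1 \<Longrightarrow> a (v n) (v n) < l + \<delta>"
      using order_tendstoD(2)[OF av_lim, of "l + \<delta>"] \<delta> by (auto simp: eventually_sequentially)
    obtain N2 where N2: "\<And>m n. m \<ge> N2 \<Longrightarrow> n \<ge> N2 \<Longrightarrow> b (v m - v n) (v m - v n) < \<delta>"
      using r(2)[OF \<delta>(1)] by (auto simp: v_def)
    have "a (v m - v n) (v m - v n) < \<epsilon> \<and> b (v m - v n) (v m - v n) < \<epsilon>"
      if mn: "m \<ge> max N1 N2" "n \<ge> max N1 N2" for m n
    proof
      have bd: "b (v m - v n) (v m - v n) < \<delta>" using N2 mn by simp
      have "\<delta> \<le> \<epsilon>" using mult_left_mono[of 1 "5 + l" \<delta>] \<delta> l0 by simp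
      with bd show "b (v m - v n) (v m - v n) < \<epsilon>" by simp
      have low: "l * b (v m + v n) (v m + v n) \<le> a (v m + v n) (v m + v n)"
        using v S by (intro lower) (auto intro: subspace_add)
      have bplus: "b (v m + v n) (v m + v n) = 4 - b (v m - v n) (v m - v n)"
        using v by (simp add: b.square_add b.square_diff)
      have aplus: "a (v m - v n) (v m - v n) =
          2 * a (v m) (v m) + 2 * a (v n) (v n) - a (v m + v n) (v m + v n)"
        using v by (simp add: a.square_add a.square_diff)
      have "l * b (v m - v n) (v m - v n) \<le> l * \<delta>" using bd l0 by (intro mult_left_mono) auto
      moreover have "a (v m) (v m) < l + \<delta>" "a (v n) (v n) < l + \<delta>" using N1 mn by auto
      ultimately have "a (v m - v n) (v m - v n) < 4 * \<delta> + l * \<delta>"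
        using low unfolding bplus aplus by (simp add: algebra_simps)
      also have "\<dots> < \<epsilon>" using \<delta> by (simp add: algebra_simps)
      finally show "a (v m - v n) (v m - v n) < \<epsilon>" .
    qed
    then show ?thesis by blast
  qed
  obtain x where x: "x \<in> D" "(\<lambda>n. a (v n - x) (v n - x)) \<longlonglongrightarrow> 0"
    "(\<lambda>n. b (v n - x) (v n - x)) \<longlonglongrightarrow> 0"
    using complete[of v, OF v(2) Cauchy] by blast
  have "x \<in> S" by (rule closed[OF v(1) x(1,3)])
  moreover have "b x x = 1"
    using b.tendsto_square[OF v(2) x(1,3)] v(3) by (simp add: LIMSEQ_const_iff)
  moreover have "a x x = l"
    using a.tendsto_square[OF v(2) x(1,2)] av_lim by (rule LIMSEQ_unique)
  ultimately show thesis using \<open>l \<le> \<mu>\<close> lower by (rule that)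
qed

text \<open>The minimum over the complement of m < k eigenvectors is at most \<mu> because this
  complement meets the span of the test vectors in a vector of positive mass, and that vector has
  quotient at most \<mu>.\<close>

theorem weak_eigenvectors:
  fixes F :: "nat \<Rightarrow> 'x"
  assumes F: "\<And>i. i < k \<Longrightarrow> F i \<in> D"
    and indep: "\<And>c. \<exists>i<k. c i \<noteq> 0 \<Longrightarrow>
      b (\<Sum>i<k. c i *\<^sub>R F i) (\<Sum>i<k. c i *\<^sub>R F i) > 0"
    and upper: "\<And>c. a (\<Sum>i<k. c i *\<^sub>R F i) (\<Sum>i<k. c i *\<^sub>R F i)
      \<le> \<mu> * b (\<Sum>i<k. c i *\<^sub>R F i) (\<Sum>i<k. c i *\<^sub>R F i)"
  obtains u :: "nat \<Rightarrow> 'x" and \<nu> :: "nat \<Rightarrow> real"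
  where "\<And>i. i < k \<Longrightarrow> u i \<in> D" "\<And>i. i < k \<Longrightarrow> \<nu> i \<le> \<mu>"
    "\<And>i j. i < k \<Longrightarrow> j < k \<Longrightarrow> b (u i) (u j) = (if i = j then 1 else 0)"
    "\<And>i y. i < k \<Longrightarrow> y \<in> D \<Longrightarrow> a (u i) y = \<nu> i * b (u i) y"
proof -
  define good where "good m u \<nu> \<longleftrightarrow> (\<forall>i<m. u i \<in> D \<and> \<nu> i \<le> \<mu> \<and>
      (\<forall>j<m. b (u i) (u j) = (if i = j then 1 else 0)) \<and>
      (\<forall>y\<in>D. a (u i) y = \<nu> i * b (u i) y))" for m and u :: "nat \<Rightarrow> 'x" and \<nu> :: "nat \<Rightarrow> real"
  have "\<exists>u \<nu>. good m u \<nu>" if "m \<le> k" for m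
    using that
  proof (induction m)
    case 0
    then show ?case by (simp add: good_def)
  next
    case (Suc m)
    then obtain u \<nu> where g: "good m u \<nu>" by auto
    have u: "\<And>i. i < m \<Longrightarrow> u i \<in> D"
      and uo: "\<And>i j. i < m \<Longrightarrow> j < m \<Longrightarrow> b (u i) (u j) = (if i = j then 1 else 0)"
      and ue: "\<And>i y. i < m \<Longrightarrow> y \<in> D \<Longrightarrow> a (u i) y = \<nu> i * b (u i) y"
      using g by (auto simp: good_def)
    define S where "S = {x \<in> D. \<forall>i<m. b x (u i) = 0}"
    have S: "subspace S" "S \<subseteq> D"
      unfolding S_def subspace_def
      by (auto simp: u b.add_left b.scale_left b.D_zero b.D_add b.D_scale b.zero_left)
    have closed: "x \<in> S" if w: "\<And>n. w n \<in> S" "x \<in> D" "(\<lambda>n. b (w n - x) (w n - x)) \<longlonglongrightarrow> 0" for w x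
    proof -
      have "b x (u i) = 0" if i: "i < m" for i
      proof -
        have "(\<lambda>n. b (w n) (u i)) \<longlonglongrightarrow> b x (u i)"
          using w S by (intro b.tendsto_left u i) auto
        moreover have "b (w n) (u i) = 0" for n using w(1)[of n] i by (simp add: S_def)
        ultimately show ?thesis by (simp add: LIMSEQ_const_iff)
      qed
      then show ?thesis using w(2) by (simp add: S_def)
    qed
    \<comment> \<open>There are \<open>k\<close> unknown coefficients and only \<open>m < k\<close>
      orthogonality conditions.\<close>
    obtain c where c: "\<exists>j\<in>{..<k}. c j \<noteq> 0"
      "\<And>i. i < m \<Longrightarrow> (\<Sum>j<k. c j * b (F j) (u i)) = 0"
      using homogeneous_system_nontrivial[of "{..<k}" m "\<lambda>i j. b (F j) (u i)"] Suc.prems by auto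
    define y where "y = (\<Sum>j<k. c j *\<^sub>R F j)"
    have yS: "y \<in> S"
    proof -
      have "y \<in> D" unfolding y_def using F by (intro b.D_sum b.D_scale) auto
      moreover have "b y (u i) = 0" if "i < m" for i
        using b.sum_left[of "{..<k}" F "u i" c] F u[OF that] c(2)[OF that] by (simp add: y_def)
      ultimately show ?thesis by (simp add: S_def)
    qed
    have y0: "b y y > 0" "a y y \<le> \<mu> * b y y"
      using indep[of c] upper[of c] c(1) by (auto simp: y_def)
    obtain x l where x: "x \<in> S" "b x x = 1" "a x x = l" "l \<le> \<mu>"
      "\<And>z. z \<in> S \<Longrightarrow> l * b z z \<le> a z z"
      by (rule minimiser_exists[OF S _ yS y0]) (use closed in metis)+
    have xD: "x \<in> D" and xu: "\<And>i. i < m \<Longrightarrow> b x (u i) = 0" using x(1) by (auto simp: S_def)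
    have ux: "b (u i) x = 0" if "i < m" for i
      using xu[OF that] b.sym[OF xD u[OF that]] by simp
    \<comment> \<open>Minimality says that \<open>a - l * b\<close> is nonnegative on
      \<open>S\<close>, and \<open>x\<close> is a null vector of it. Cauchy-Schwarz then gives the
      Euler-Lagrange equation on \<open>S\<close> without differentiating the quotient.\<close>
    interpret sf: sym_form S "\<lambda>x y. a x y + (- l) * b x y"
      using a.subform[OF S] b.subform[OF S] by (rule sym_form.lincomb)
    interpret c: psd_form S "\<lambda>x y. a x y + (- l) * b x y"
      by unfold_locales (use x(5) in auto)
    have xS: "a x z = l * b x z" if "z \<in> S" for z
      using c.null_left[OF x(1) that] x by simp
    have xe: "a x z = l * b x z" if z: "z \<in> D" for z
    proof -
      \<comment> \<open>The projection of \<open>z\<close> onto the eigenvectors already found.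
        Since these are eigenvectors tested against all of \<open>D\<close>, orthogonality to
        \<open>x\<close> in mass implies it in \<open>a\<close>, so the equation extends from
        \<open>S\<close> to \<open>D\<close>.\<close>
      define z1 where "z1 = (\<Sum>i<m. b z (u i) *\<^sub>R u i)"
      have z1: "z1 \<in> D" unfolding z1_def by (intro b.D_sum b.D_scale u) auto
      have "b z1 (u j) = b z (u j)" if "j < m" for j
      proof -
        have "b z1 (u j) = (\<Sum>i<m. b z (u i) * b (u i) (u j))"
          unfolding z1_def using u that by (intro b.sum_left) auto
        also have "\<dots> = (\<Sum>i<m. if i = j then b z (u i) else 0)"
          using uo that by (intro sum.cong) auto
        finally show ?thesis using that by simp
      qed
      then have "z - z1 \<in> S"
        using z z1 u by (auto simp: S_def b.D_diff b.diff_left)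
      then have "a x (z - z1) = l * b x (z - z1)" by (rule xS)
      moreover have "b z1 x = 0"
        using b.sum_left[of "{..<m}" u x "\<lambda>i. b z (u i)"] u ux xD by (simp add: z1_def)
      moreover have "a z1 x = 0"
        using a.sum_left[of "{..<m}" u x "\<lambda>i. b z (u i)"] u ux ue xD by (simp add: z1_def)
      ultimately show ?thesis
        using xD z z1 a.sym[of x z1] b.sym[of x z1] by (simp add: a.diff_right b.diff_right)
    qed
    have "good (Suc m) (u(m := x)) (\<nu>(m := l))"
      unfolding good_def
    proof (intro allI impI conjI ballI)
      fix i assume "i < Suc m"
      then have i: "i < m \<or> i = m" by auto
      then show "(u(m := x)) i \<in> D" using u xD by auto
      show "(\<nu>(m := l)) i \<le> \<mu>" using i g x(4) by (auto simp: good_def)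
      show "b ((u(m := x)) i) ((u(m := x)) j) = (if i = j then 1 else 0)" if "j < Suc m" for j
        using i that x(2) xu ux uo by (auto simp: less_Suc_eq)
      show "a ((u(m := x)) i) y = (\<nu>(m := l)) i * b ((u(m := x)) i) y" if "y \<in> D" for y
        using i xe[OF that] ue[OF _ that] by auto
    qed
    then show ?case by blast
  qed
  then obtain u \<nu> where "good k u \<nu>" by (metis order_refl)
  then show thesis unfolding good_def by (intro that[of u \<nu>]) blast+
qed

end

section \<open>Square-integrable functions and weak derivatives\<close>

text \<open>With pointwise scalars, pairs of edgewise functions form a real vector space, as the
  abstract locales require.\<close>

instantiation "fun" :: (type, real_vector) real_vector
begin

definition scaleR_fun :: "real \<Rightarrow> ('a \<Rightarrow> 'b) \<Rightarrow> 'a \<Rightarrow> 'b" where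
  "scaleR_fun r f = (\<lambda>x. r *\<^sub>R f x)"

instance
  by standard (auto simp: scaleR_fun_def plus_fun_def fun_eq_iff algebra_simps)

end

lemma scaleR_fun_apply [simp]: "(r *\<^sub>R f) x = r *\<^sub>R f x"
  by (simp add: scaleR_fun_def)

text \<open>Functions rather than classes modulo null sets; the integral of a product is thus only
  semidefinite on this space.\<close>

definition L2_space :: "'a measure \<Rightarrow> ('a \<Rightarrow> real) set" where
  "L2_space M = {f. f \<in> borel_measurable M \<and> integrable M (\<lambda>x. (f x)\<^sup>2)}"

lemma L2_space_mult_integrable:
  assumes "f \<in> L2_space M" "g \<in> L2_space M"
  shows "integrable M (\<lambda>x. f x * g x)"
proof (rule Bochner_Integration.integrable_bound)
  show "integrable M (\<lambda>x. (f x)\<^sup>2 + (g x)\<^sup>2)"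
    using assms by (auto simp: L2_space_def)
  show "(\<lambda>x. f x * g x) \<in> borel_measurable M"
    using assms by (auto simp: L2_space_def)
  have "\<bar>s * t\<bar> \<le> s\<^sup>2 + t\<^sup>2" for s t :: real
    using sum_squares_bound[of "\<bar>s\<bar>" "\<bar>t\<bar>"] mult_nonneg_nonneg[OF abs_ge_zero abs_ge_zero, of s t]
    unfolding power2_abs abs_mult by linarith
  then show "AE x in M. norm (f x * g x) \<le> norm ((f x)\<^sup>2 + (g x)\<^sup>2)"
    by auto
qed

interpretation L2: psd_form "L2_space M" "\<lambda>f g. LINT x|M. f x * g x"
proof
  show "subspace (L2_space M)"
    unfolding subspace_def
  proof (intro conjI ballI allI)
    show "(0::'a \<Rightarrow> real) \<in> L2_space M" by (simp add: L2_space_def zero_fun_def)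
  next
    fix f g assume fg: "f \<in> L2_space M" "g \<in> L2_space M"
    have "integrable M (\<lambda>x. (f x)\<^sup>2 + 2 * (f x * g x) + (g x)\<^sup>2)"
      using fg L2_space_mult_integrable[OF fg] by (auto simp: L2_space_def)
    then show "f + g \<in> L2_space M"
      using fg by (auto simp: L2_space_def plus_fun_def power2_sum algebra_simps)
  next
    fix f and r :: real assume "f \<in> L2_space M"
    then show "r *\<^sub>R f \<in> L2_space M"
      by (auto simp: L2_space_def scaleR_fun_def power_mult_distrib)
  qed
qed (auto simp: algebra_simps L2_space_mult_integrable)

lemma (in finite_measure) const_L2_space: "(\<lambda>x. c) \<in> L2_space M"
  by (simp add: L2_space_def)

lemma (in finite_measure) L2_space_integrable: "f \<in> L2_space M \<Longrightarrow> integrable M f"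
  by (simp add: L2_space_def square_integrable_imp_integrable)

text \<open>Riesz-Fischer. On a finite measure space Cauchy-Schwarz turns an L2-Cauchy sequence into
  an L1-Cauchy one, which has an almost everywhere convergent subsequence. Fatou's lemma along that
  subsequence, with the other index fixed, gives square integrability of the limit and the
  convergence.\<close>

lemma (in finite_measure) L2_complete:
  fixes g :: "nat \<Rightarrow> 'a \<Rightarrow> real"
  assumes g: "\<And>n. g n \<in> L2_space M"
    and Cauchy: "\<And>\<epsilon>. \<epsilon> > 0 \<Longrightarrow> \<exists>N. \<forall>m\<ge>N. \<forall>n\<ge>N. (LINT x|M. (g m x - g n x)\<^sup>2) < \<epsilon>"
  obtains h where "h \<in> L2_space M" "(\<lambda>n. LINT x|M. (g n x - h x)\<^sup>2) \<longlonglongrightarrow> 0"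
proof -
  have diff: "(\<lambda>x. g m x - g n x) \<in> L2_space M" for m n
    using L2.D_diff[OF g[of m] g[of n]] by (simp add: fun_diff_def)
  have [measurable]: "g n \<in> borel_measurable M" for n
    using g by (simp add: L2_space_def)
  have CS: "(LINT x|M. \<bar>g m x - g n x\<bar>)\<^sup>2 \<le> (LINT x|M. (g m x - g n x)\<^sup>2) * measure M (space M)"
    for m n
  proof -
    have "(\<lambda>x. \<bar>g m x - g n x\<bar>) \<in> L2_space M"
      using diff[of m n] by (simp add: L2_space_def)
    from L2.Cauchy_Schwarz[OF this const_L2_space[of 1]]
    show ?thesis by (simp add: power2_eq_square)
  qed
  obtain r where r: "strict_mono r" "AE x in M. Cauchy (\<lambda>i. g (r i) x)"
  proof (rule cauchy_L1_AE_cauchy_subseq[of M g])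
    show "integrable M (g n)" for n by (rule L2_space_integrable[OF g])
    fix e :: real assume e: "e > 0"
    \<comment> \<open>Chosen so that \<delta> times the total mass stays below
      \<open>e\<^sup>2\<close>; adding 1 keeps the divisor positive for a null measure.\<close>
    define \<delta> where "\<delta> = e\<^sup>2 / (measure M (space M) + 1)"
    have \<delta>: "\<delta> > 0" "\<delta> * measure M (space M) \<le> e\<^sup>2"
    proof -
      have pos: "measure M (space M) + 1 > 0" using measure_nonneg[of M "space M"] by linarith
      then show "\<delta> > 0" using e by (simp add: \<delta>_def)
      have "measure M (space M) / (measure M (space M) + 1) \<le> 1" using pos by simp
      from mult_left_mono[OF this, of "e\<^sup>2"] show "\<delta> * measure M (space M) \<le> e\<^sup>2"
        by (simp add: \<delta>_def)
    qed
    obtain N where N: "\<And>m n. m \<ge> N \<Longrightarrow> n \<ge> N \<Longrightarrow> (LINT x|M. (g m x - g n x)\<^sup>2) < \<delta>"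
      using Cauchy[OF \<delta>(1)] by blast
    have "(LINT x|M. norm (g m x - g n x)) < e" if "m \<ge> N" "n \<ge> N" for m n
    proof (cases "measure M (space M) = 0")
      case True
      then have "(LINT x|M. \<bar>g m x - g n x\<bar>)\<^sup>2 \<le> 0" using CS[of m n] by simp
      then show ?thesis using e by simp
    next
      case False
      then have "(LINT x|M. (g m x - g n x)\<^sup>2) * measure M (space M) < \<delta> * measure M (space M)"
        using N[OF that] by (intro mult_strict_right_mono) (auto simp: zero_less_measure_iff)
      then have "(LINT x|M. \<bar>g m x - g n x\<bar>)\<^sup>2 < e\<^sup>2" using CS[of m n] \<delta>(2) by linarith
      then show ?thesis using e power_less_imp_less_base[of _ 2 e] by simp
    qed
    then show "\<exists>N. \<forall>i\<ge>N. \<forall>j\<ge>N. (LINT x|M. norm (g i x - g j x)) < e" by blast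
  qed
  define h where "h x = lim (\<lambda>i. g (r i) x)" for x
  have [measurable]: "h \<in> borel_measurable M" unfolding h_def by measurable
  have lim: "AE x in M. (\<lambda>i. g (r i) x) \<longlonglongrightarrow> h x"
    using r(2) by eventually_elim (simp add: h_def Cauchy_convergent_iff convergent_LIMSEQ_iff)
  have key: "integrable M (\<lambda>x. (g n x - h x)\<^sup>2) \<and> (LINT x|M. (g n x - h x)\<^sup>2) \<le> \<epsilon>"
    if N: "\<And>m n. m \<ge> N \<Longrightarrow> n \<ge> N \<Longrightarrow> (LINT x|M. (g m x - g n x)\<^sup>2) < \<epsilon>"
      and n: "n \<ge> N" and \<epsilon>: "\<epsilon> > 0" for N n \<epsilon>
  proof -
    have "(\<integral>\<^sup>+x. ennreal ((g n x - h x)\<^sup>2) \<partial>M)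
        = (\<integral>\<^sup>+x. liminf (\<lambda>i. ennreal ((g n x - g (r i) x)\<^sup>2)) \<partial>M)"
    proof (rule nn_integral_cong_AE)
      show "AE x in M. ennreal ((g n x - h x)\<^sup>2) = liminf (\<lambda>i. ennreal ((g n x - g (r i) x)\<^sup>2))"
        using lim
      proof eventually_elim
        case (elim x)
        have "(\<lambda>i. ennreal ((g n x - g (r i) x)\<^sup>2)) \<longlonglongrightarrow> ennreal ((g n x - h x)\<^sup>2)"
          by (intro tendsto_intros elim)
        then show ?case by (metis lim_imp_Liminf trivial_limit_sequentially)
      qed
    qed
    also have "\<dots> \<le> liminf (\<lambda>i. \<integral>\<^sup>+x. ennreal ((g n x - g (r i) x)\<^sup>2) \<partial>M)"
      by (rule nn_integral_liminf) simp
    also have "\<dots> \<le> ennreal \<epsilon>"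
    proof (rule Liminf_le)
      have "(\<integral>\<^sup>+x. ennreal ((g n x - g (r i) x)\<^sup>2) \<partial>M) \<le> ennreal \<epsilon>" if i: "i \<ge> N" for i
      proof -
        have "r i \<ge> N" using i seq_suble[OF r(1), of i] by linarith
        then have "(LINT x|M. (g n x - g (r i) x)\<^sup>2) < \<epsilon>" using N n by blast
        moreover have "(\<integral>\<^sup>+x. ennreal ((g n x - g (r i) x)\<^sup>2) \<partial>M)
            = ennreal (LINT x|M. (g n x - g (r i) x)\<^sup>2)"
          using diff by (intro nn_integral_eq_integral) (auto simp: L2_space_def)
        ultimately show ?thesis by (simp add: ennreal_leI)
      qed
      then show "\<forall>\<^sub>F i in sequentially. (\<integral>\<^sup>+x. ennreal ((g n x - g (r i) x)\<^sup>2) \<partial>M) \<le> ennreal \<epsilon>"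
        by (auto simp: eventually_sequentially)
    qed simp
    finally have le: "(\<integral>\<^sup>+x. ennreal ((g n x - h x)\<^sup>2) \<partial>M) \<le> ennreal \<epsilon>" .
    then have int: "integrable M (\<lambda>x. (g n x - h x)\<^sup>2)"
      by (intro integrableI_nonneg) (auto simp: le_less_trans[OF le])
    moreover have "ennreal (LINT x|M. (g n x - h x)\<^sup>2) \<le> ennreal \<epsilon>"
      using le nn_integral_eq_integral[OF int] by simp
    ultimately show ?thesis using \<epsilon> by simp
  qed
  obtain N where N: "\<And>m n. m \<ge> N \<Longrightarrow> n \<ge> N \<Longrightarrow> (LINT x|M. (g m x - g n x)\<^sup>2) < 1"
    using Cauchy[of 1] by auto
  have "(\<lambda>x. g N x - h x) \<in> L2_space M"
    using key[OF N, of N] by (simp add: L2_space_def)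
  from L2.D_diff[OF g[of N] this] have "h \<in> L2_space M"
    by (simp add: fun_diff_def)
  moreover have "(\<lambda>n. LINT x|M. (g n x - h x)\<^sup>2) \<longlonglongrightarrow> 0"
  proof (rule LIMSEQ_I)
    fix e :: real assume e: "e > 0"
    obtain N where N: "\<And>m n. m \<ge> N \<Longrightarrow> n \<ge> N \<Longrightarrow> (LINT x|M. (g m x - g n x)\<^sup>2) < e / 2"
      using Cauchy[of "e / 2"] e by auto
    have "norm ((LINT x|M. (g n x - h x)\<^sup>2) - 0) < e" if "n \<ge> N" for n
      using key[OF N that] e by simp
    then show "\<exists>N. \<forall>n\<ge>N. norm ((LINT x|M. (g n x - h x)\<^sup>2) - 0) < e" by blast
  qed
  ultimately show thesis by (rule that)
qed

lemma finite_measure_lebesgue_on_Icc: "finite_measure (lebesgue_on {a..b::real})"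
  by (rule finite_measure_lebesgue_on) simp

lemma measurable_ident_lebesgue_on [measurable]: "(\<lambda>x. x) \<in> borel_measurable (lebesgue_on S)"
  using id_borel_measurable_lebesgue_on[of S] by (simp add: id_def)

lemma L2_lebesgue_on_integrable:
  "f \<in> L2_space (lebesgue_on {a..b::real}) \<Longrightarrow> integrable (lebesgue_on {a..b}) f"
  by (rule finite_measure.L2_space_integrable[OF finite_measure_lebesgue_on_Icc])

lemma continuous_L2:
  fixes f :: "real \<Rightarrow> real"
  assumes "continuous_on {a..b} f"
  shows "f \<in> L2_space (lebesgue_on {a..b})"
  using assms by (auto simp: L2_space_def intro!: continuous_imp_measurable_on_sets_lebesgue
      continuous_imp_integrable_real continuous_intros)

lemma integrable_mult_continuous:
  fixes f w :: "real \<Rightarrow> real"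
  assumes f: "continuous_on {a..b} f" and w: "integrable (lebesgue_on {a..b}) w"
  shows "integrable (lebesgue_on {a..b}) (\<lambda>x. f x * w x)"
proof -
  have "bounded (f ` {a..b})"
    using f by (intro compact_imp_bounded compact_continuous_image) auto
  then obtain C where C: "\<And>x. x \<in> {a..b} \<Longrightarrow> \<bar>f x\<bar> \<le> C"
    by (fastforce simp: bounded_iff)
  show ?thesis
  proof (rule Bochner_Integration.integrable_bound)
    show "integrable (lebesgue_on {a..b}) (\<lambda>x. C * w x)" using w by simp
    show "(\<lambda>x. f x * w x) \<in> borel_measurable (lebesgue_on {a..b})"
      using w continuous_imp_measurable_on_sets_lebesgue[OF f] by auto
    show "AE x in lebesgue_on {a..b}. norm (f x * w x) \<le> norm (C * w x)"
      by (rule AE_I2) (use C in \<open>fastforce simp: abs_mult intro!: mult_right_mono\<close>)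
  qed
qed

section \<open>Calculus with weak derivatives on an interval\<close>

lemma weak_deriv_diff:
  assumes "has_weak_deriv a b u w" "a \<le> x" "x \<le> y" "y \<le> b"
  shows "u y - u x = (LINT t|lebesgue_on {x..y}. w t)"
proof -
  have "integrable (lebesgue_on {a..y}) w"
    using assms integrable_subinterval[of a b w a y] by (auto simp: has_weak_deriv_def)
  from Equivalence_Measurable_On_Borel.integral_combine[OF this assms(2,3)]
  moreover have "u z = u a + (LINT t|lebesgue_on {a..z}. w t)" if "z \<in> {a..b}" for z
    using assms(1) that unfolding has_weak_deriv_def by blast
  from this[of x] this[of y] have "u x = u a + (LINT t|lebesgue_on {a..x}. w t)"
    "u y = u a + (LINT t|lebesgue_on {a..y}. w t)" using assms(2-4) by auto
  ultimately show ?thesis by linarith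
qed

lemma weak_deriv_continuous:
  assumes "has_weak_deriv a b u w"
  shows "continuous_on {a..b} u"
proof -
  have int: "integrable (lebesgue_on {a..b}) w" using assms by (simp add: has_weak_deriv_def)
  have "continuous_on {a..b} (\<lambda>x. u a + integral {a..x} w)"
    by (intro continuous_intros indefinite_integral_continuous_1 integrable_on_lebesgue_on int) auto
  moreover have "u x = u a + integral {a..x} w" if "x \<in> {a..b}" for x
  proof -
    have "integrable (lebesgue_on {a..x}) w" using integrable_subinterval[OF int, of a x] that by auto
    then have "integral {a..x} w = (LINT t|lebesgue_on {a..x}. w t)"
      by (simp add: lebesgue_integral_eq_integral)
    then show ?thesis
      using assms that unfolding has_weak_deriv_def by metis
  qed
  ultimately show ?thesis by (metis (no_types, lifting) continuous_on_cong)
qed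

text \<open>Cauchy-Schwarz for \<open>w\<close> against the constant 1 on the interval between the
  two points. This is the source of equicontinuity for Arzela-Ascoli.\<close>

lemma weak_deriv_Hoelder:
  assumes u: "has_weak_deriv a b u w" and w: "w \<in> L2_space (lebesgue_on {a..b})"
    and x: "x \<in> {a..b}" and y: "y \<in> {a..b}"
  shows "(u x - u y)\<^sup>2 \<le> \<bar>x - y\<bar> * (LINT t|lebesgue_on {a..b}. (w t)\<^sup>2)"
proof -
  have le: "(u y - u x)\<^sup>2 \<le> (y - x) * (LINT t|lebesgue_on {a..b}. (w t)\<^sup>2)"
    if "a \<le> x" "x \<le> y" "y \<le> b" for x y
  proof -
    have w2: "integrable (lebesgue_on {a..b}) (\<lambda>t. (w t)\<^sup>2)" using w by (simp add: L2_space_def)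
    have sub: "{x..y} \<subseteq> {a..b}" using that by auto
    have "w \<in> L2_space (lebesgue_on {x..y})"
      using w integrable_subinterval[OF w2 sub] measurable_restrict_mono[OF _ sub]
      by (auto simp: L2_space_def)
    from L2.Cauchy_Schwarz[OF this finite_measure.const_L2_space[where c = 1, OF finite_measure_lebesgue_on_Icc]]
    have "(LINT t|lebesgue_on {x..y}. w t)\<^sup>2
        \<le> (LINT t|lebesgue_on {x..y}. (w t)\<^sup>2) * (LINT t|lebesgue_on {x..y}. 1)"
      by (simp add: power2_eq_square)
    also have "(LINT t|lebesgue_on {x..y}. 1) = y - x"
      using that by (simp add: measure_restrict_space)
    also have "(LINT t|lebesgue_on {x..y}. (w t)\<^sup>2) \<le> (LINT t|lebesgue_on {a..b}. (w t)\<^sup>2)"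
      using w2 sub by (intro integral_mono_lebesgue_on_AE) auto
    finally show ?thesis
      using weak_deriv_diff[OF u that] that by (simp add: mult.commute mult_right_mono)
  qed
  show ?thesis
    using le[of x y] le[of y x] x y by (cases x y rule: linorder_cases) (auto simp: power2_commute)
qed

text \<open>Average over an interval of length \<delta> around \<open>x\<close> the comparison of
  \<open>u x\<close> with \<open>u y\<close>. The length stays free so that the coefficient of the
  energy can be made as small as desired.\<close>

lemma weak_deriv_sup_bound:
  assumes u: "has_weak_deriv a b u w" and w: "w \<in> L2_space (lebesgue_on {a..b})"
    and x: "x \<in> {a..b}" and \<delta>: "0 < \<delta>" "\<delta> \<le> b - a"
  shows "(u x)\<^sup>2 \<le> 2 / \<delta> * (LINT t|lebesgue_on {a..b}. (u t)\<^sup>2)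
           + 2 * \<delta> * (LINT t|lebesgue_on {a..b}. (w t)\<^sup>2)"
proof -
  define N where "N = (LINT t|lebesgue_on {a..b}. (w t)\<^sup>2)"
  have N0: "0 \<le> N" unfolding N_def by simp
  \<comment> \<open>The interval of length \<delta> starts at \<open>x\<close> if there is room, and
    otherwise is pushed left until it ends at \<open>b\<close>.\<close>
  define c where "c = min x (b - \<delta>)"
  have c: "a \<le> c" "c \<le> x" "x \<le> c + \<delta>" "c + \<delta> \<le> b" using x \<delta> by (auto simp: c_def)
  have sub: "{c..c + \<delta>} \<subseteq> {a..b}" using c by auto
  have u2: "integrable (lebesgue_on {a..b}) (\<lambda>t. (u t)\<^sup>2)"
    using continuous_L2[OF weak_deriv_continuous[OF u]] by (simp add: L2_space_def)
  have pt: "(u x)\<^sup>2 \<le> 2 * (u y)\<^sup>2 + 2 * \<delta> * N" if y: "y \<in> {c..c + \<delta>}" for y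
  proof -
    have "(u x - u y)\<^sup>2 \<le> \<bar>x - y\<bar> * N"
      unfolding N_def using weak_deriv_Hoelder[OF u w x, of y] y sub by blast
    also have "\<dots> \<le> \<delta> * N" using y c N0 by (intro mult_right_mono) auto
    finally have 1: "(u x - u y)\<^sup>2 \<le> \<delta> * N" .
    \<comment> \<open>The difference of the two sides is the square of
      \<open>u x - 2 * u y\<close>.\<close>
    have "(u x)\<^sup>2 \<le> 2 * (u y)\<^sup>2 + 2 * (u x - u y)\<^sup>2"
      using zero_le_power2[of "u x - 2 * u y"] by (simp add: power2_eq_square algebra_simps)
    then show ?thesis using 1 by linarith
  qed
  have int: "integrable (lebesgue_on {c..c + \<delta>}) (\<lambda>t. (u t)\<^sup>2)"
    by (rule integrable_subinterval[OF u2 sub])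
  have "(LINT t|lebesgue_on {c..c + \<delta>}. (u x)\<^sup>2)
      \<le> (LINT t|lebesgue_on {c..c + \<delta>}. 2 * (u t)\<^sup>2 + 2 * \<delta> * N)"
    using int pt finite_measure_lebesgue_on_Icc[of c "c + \<delta>"]
    by (intro integral_mono) (auto simp: finite_measure.integrable_const)
  also have "\<dots> = 2 * (LINT t|lebesgue_on {c..c + \<delta>}. (u t)\<^sup>2) + 2 * \<delta> * N * \<delta>"
    using int finite_measure_lebesgue_on_Icc[of c "c + \<delta>"] \<delta>
    by (simp add: finite_measure.integrable_const measure_restrict_space)
  also have "(LINT t|lebesgue_on {c..c + \<delta>}. (u t)\<^sup>2) \<le> (LINT t|lebesgue_on {a..b}. (u t)\<^sup>2)"
    using u2 sub by (intro integral_mono_lebesgue_on_AE) auto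
  finally have "\<delta> * (u x)\<^sup>2 \<le> 2 * (LINT t|lebesgue_on {a..b}. (u t)\<^sup>2) + 2 * \<delta> * N * \<delta>"
    using \<delta> by (simp add: measure_restrict_space)
  then have "(u x)\<^sup>2 \<le> (2 * (LINT t|lebesgue_on {a..b}. (u t)\<^sup>2) + 2 * \<delta> * N * \<delta>) / \<delta>"
    using \<delta> by (simp add: field_simps)
  also have "\<dots> = 2 / \<delta> * (LINT t|lebesgue_on {a..b}. (u t)\<^sup>2) + 2 * \<delta> * N"
    using \<delta> by (simp add: field_simps)
  finally show ?thesis by (simp add: N_def)
qed

lemma integral_lebesgue_on_indicator:
  fixes f :: "real \<Rightarrow> real"
  assumes "S \<subseteq> T" "S \<in> sets lebesgue" "T \<in> sets lebesgue"
  shows "(LINT x|lebesgue_on T. indicator S x * f x) = (LINT x|lebesgue_on S. f x)"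
  using assms by (auto simp: integral_restrict_space indicator_def intro!: Bochner_Integration.integral_cong)

text \<open>Both functions are primitives of merely integrable functions, so no product rule is at
  hand. Instead \<open>w s * z t\<close> is integrated over the triangle s \<le> t in both orders:
  one order yields \<open>u - u a\<close> against \<open>z\<close>, the other \<open>v b - v\<close>
  against \<open>w\<close>.\<close>

lemma weak_deriv_by_parts:
  assumes u: "has_weak_deriv a b u w" and v: "has_weak_deriv a b v z" and ab: "a \<le> b"
  shows "(LINT x|lebesgue_on {a..b}. u x * z x) + (LINT x|lebesgue_on {a..b}. w x * v x)
    = u b * v b - u a * v a"
proof -
  let ?M = "lebesgue_on {a..b}"
  interpret finite_measure ?M by (rule finite_measure_lebesgue_on_Icc)
  interpret P: pair_sigma_finite ?M ?M ..
  have wi: "integrable ?M w" and zi: "integrable ?M z"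
    using u v by (auto simp: has_weak_deriv_def)
  have [measurable]: "w \<in> borel_measurable ?M" "z \<in> borel_measurable ?M" using wi zi by auto
  have prod: "integrable (?M \<Otimes>\<^sub>M ?M) (\<lambda>p. w (fst p) * z (snd p))"
  proof (rule P.Fubini_integrable)
    show "integrable ?M (\<lambda>s. LINT t|?M. norm (w (fst (s, t)) * z (snd (s, t))))"
      using wi by (simp add: abs_mult)
    show "AE s in ?M. integrable ?M (\<lambda>t. w (fst (s, t)) * z (snd (s, t)))"
      using zi by simp
  qed measurable
  have "integrable (?M \<Otimes>\<^sub>M ?M) (\<lambda>p. indicator {..snd p} (fst p) * (w (fst p) * z (snd p)))"
  proof (rule Bochner_Integration.integrable_bound[OF prod])
    have "(\<lambda>p. if fst p \<le> snd p then w (fst p) * z (snd p) else 0) \<in> borel_measurable (?M \<Otimes>\<^sub>M ?M)"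
      by measurable
    also have "(\<lambda>p. if fst p \<le> snd p then w (fst p) * z (snd p) else 0) =
        (\<lambda>p. indicator {..snd p} (fst p) * (w (fst p) * z (snd p)))"
      by (auto simp: indicator_def fun_eq_iff)
    finally show "(\<lambda>p. indicator {..snd p} (fst p) * (w (fst p) * z (snd p)))
      \<in> borel_measurable (?M \<Otimes>\<^sub>M ?M)" .
  qed (auto simp: indicator_def)
  then have "integrable (?M \<Otimes>\<^sub>M ?M) (\<lambda>(s, t). indicator {..t} s * (w s * z t))"
    by (simp only: case_prod_beta')
  from P.Fubini_integral[OF this]
  have "(LINT t|?M. LINT s|?M. indicator {..t} s * (w s * z t))
      = (LINT s|?M. LINT t|?M. indicator {..t} s * (w s * z t))" .
  also have "(LINT t|?M. LINT s|?M. indicator {..t} s * (w s * z t)) = (LINT t|?M. u t * z t - u a * z t)"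
  proof (rule Bochner_Integration.integral_cong[OF refl])
    fix t assume "t \<in> space ?M"
    then have t: "a \<le> t" "t \<le> b" by auto
    have "(LINT s|?M. indicator {..t} s * (w s * z t)) = (LINT s|?M. indicator {a..t} s * (w s * z t))"
      by (intro Bochner_Integration.integral_cong) (auto simp: indicator_def)
    also have "\<dots> = (LINT s|lebesgue_on {a..t}. w s) * z t"
      using t by (simp add: integral_lebesgue_on_indicator)
    finally show "(LINT s|?M. indicator {..t} s * (w s * z t)) = u t * z t - u a * z t"
      using weak_deriv_diff[OF u _ t(1) t(2)] by (simp add: algebra_simps)
  qed
  also have "\<dots> = (LINT t|?M. u t * z t) - u a * (v b - v a)"
    using zi integrable_mult_continuous[OF weak_deriv_continuous[OF u] zi] weak_deriv_diff[OF v _ ab]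
    by simp
  also have "(LINT s|?M. LINT t|?M. indicator {..t} s * (w s * z t)) = (LINT s|?M. v b * w s - v s * w s)"
  proof (rule Bochner_Integration.integral_cong[OF refl])
    fix s assume "s \<in> space ?M"
    then have s: "a \<le> s" "s \<le> b" by auto
    have "(LINT t|?M. indicator {..t} s * (w s * z t)) = (LINT t|?M. indicator {s..b} t * (w s * z t))"
      by (intro Bochner_Integration.integral_cong) (auto simp: indicator_def)
    also have "\<dots> = w s * (LINT t|lebesgue_on {s..b}. z t)"
      using s by (simp add: integral_lebesgue_on_indicator)
    finally show "(LINT t|?M. indicator {..t} s * (w s * z t)) = v b * w s - v s * w s"
      using weak_deriv_diff[OF v s] by (simp add: algebra_simps)
  qed
  also have "\<dots> = v b * (u b - u a) - (LINT s|?M. w s * v s)"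
    using wi integrable_mult_continuous[OF weak_deriv_continuous[OF v] wi] weak_deriv_diff[OF u _ ab]
    by (simp add: mult.commute)
  finally show ?thesis by (simp add: algebra_simps)
qed

lemma weak_deriv_value:
  "has_weak_deriv a b u w \<Longrightarrow> x \<in> {a..b} \<Longrightarrow> u x = u a + (LINT t|lebesgue_on {a..x}. w t)"
  unfolding has_weak_deriv_def by blast

lemma weak_deriv_integrable: "has_weak_deriv a b u w \<Longrightarrow> integrable (lebesgue_on {a..b}) w"
  unfolding has_weak_deriv_def by blast

lemma weak_deriv_add:
  assumes "has_weak_deriv a b u w" "has_weak_deriv a b v z"
  shows "has_weak_deriv a b (u + v) (w + z)"
  unfolding has_weak_deriv_def
proof (intro conjI ballI)
  note int = assms[THEN weak_deriv_integrable]
  show "integrable (lebesgue_on {a..b}) (w + z)"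
    using int by (simp add: plus_fun_def)
  fix x assume x: "x \<in> {a..b}"
  have "integrable (lebesgue_on {a..x}) w" "integrable (lebesgue_on {a..x}) z"
    using int[THEN integrable_subinterval, of a x] x by auto
  then show "(u + v) x = (u + v) a + (LINT t|lebesgue_on {a..x}. (w + z) t)"
    using assms[THEN weak_deriv_value, OF x] by simp
qed

lemma weak_deriv_scale:
  assumes "has_weak_deriv a b u w"
  shows "has_weak_deriv a b (r *\<^sub>R u) (r *\<^sub>R w)"
  unfolding has_weak_deriv_def
proof (intro conjI ballI)
  show "integrable (lebesgue_on {a..b}) (r *\<^sub>R w)"
    using weak_deriv_integrable[OF assms] by (simp add: scaleR_fun_def)
  fix x assume x: "x \<in> {a..b}"
  show "(r *\<^sub>R u) x = (r *\<^sub>R u) a + (LINT t|lebesgue_on {a..x}. (r *\<^sub>R w) t)"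
    using weak_deriv_value[OF assms x] by (simp add: algebra_simps)
qed

lemma weak_deriv_zero: "has_weak_deriv a b 0 0"
  by (simp add: has_weak_deriv_def zero_fun_def)

lemma integral_le_const:
  fixes f :: "real \<Rightarrow> real"
  assumes "integrable (lebesgue_on {a..b}) f" "\<And>x. x \<in> {a..b} \<Longrightarrow> f x \<le> B" "a \<le> b"
  shows "(LINT x|lebesgue_on {a..b}. f x) \<le> (b - a) * B"
proof -
  have "(LINT x|lebesgue_on {a..b}. f x) \<le> (LINT x|lebesgue_on {a..b}. B)"
    using assms finite_measure.integrable_const[OF finite_measure_lebesgue_on_Icc]
    by (intro integral_mono) auto
  then show ?thesis using assms by (simp add: measure_restrict_space)
qed

section \<open>The quadratic form of a metric graph\<close>

text \<open>A $W^{1,2}$ function on the graph, paired with a representative of its weak derivative.\<close>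

type_synonym 'e sobolev = "('e \<Rightarrow> real \<Rightarrow> real) \<times> ('e \<Rightarrow> real \<Rightarrow> real)"

locale schroedinger_graph = metric_graph G len
  for G :: "('v, 'e) pre_digraph" and len :: "'e \<Rightarrow> real" +
  fixes q :: "'e \<Rightarrow> real \<Rightarrow> real" and \<alpha> :: "'v \<Rightarrow> ereal"
  assumes q_integrable: "e \<in> arcs G \<Longrightarrow> integrable (edge_measure len e) (q e)"
    and \<alpha>_not_MInf: "v \<in> verts G \<Longrightarrow> \<alpha> v \<noteq> -\<infinity>"
begin

text \<open>The value at a vertex is read off at one fixed edge end; on functions that are discontinuous
  at the vertex it depends on this choice.\<close>

definition some_end :: "'v \<Rightarrow> 'e \<times> real" where
  "some_end v = (SOME p. fst p \<in> arcs G \<and>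
     (tail G (fst p) = v \<and> snd p = 0 \<or> head G (fst p) = v \<and> snd p = len (fst p)))"

definition vertex_value :: "('e \<Rightarrow> real \<Rightarrow> real) \<Rightarrow> 'v \<Rightarrow> real" where
  "vertex_value f v = f (fst (some_end v)) (snd (some_end v))"

text \<open>The vertex values are computed from \<open>fst x\<close> rather than existentially
  quantified. The vertex conditions are thus visibly linear in \<open>x\<close>, and the vertex part
  of the form can be written as a function of \<open>x\<close>.\<close>

definition form_domain :: "'e sobolev set" where
  "form_domain = {x. (\<forall>e\<in>arcs G. snd x e \<in> L2_space (edge_measure len e) \<and>
        has_weak_deriv 0 (len e) (fst x e) (snd x e)) \<and>
      vertex_values G len (fst x) (vertex_value (fst x)) \<and>
      (\<forall>v\<in>verts G. \<alpha> v = \<infinity> \<longrightarrow> vertex_value (fst x) v = 0)}"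

definition mass :: "'e sobolev \<Rightarrow> 'e sobolev \<Rightarrow> real" where
  "mass x y = (\<Sum>e\<in>arcs G. LINT t|edge_measure len e. fst x e t * fst y e t)"

definition kinetic :: "'e sobolev \<Rightarrow> 'e sobolev \<Rightarrow> real" where
  "kinetic x y = (\<Sum>e\<in>arcs G. LINT t|edge_measure len e. snd x e t * snd y e t)"

text \<open>Dirichlet vertices do not contribute, since \<^term>\<open>real_of_ereal \<infinity> = 0\<close>.\<close>

definition potential :: "'e sobolev \<Rightarrow> 'e sobolev \<Rightarrow> real" where
  "potential x y = (\<Sum>e\<in>arcs G. LINT t|edge_measure len e. fst x e t * fst y e t * q e t) +
     (\<Sum>v\<in>verts G. real_of_ereal (\<alpha> v) * (vertex_value (fst x) v * vertex_value (fst y) v))"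

definition form :: "'e sobolev \<Rightarrow> 'e sobolev \<Rightarrow> real" where
  "form x y = kinetic x y + potential x y"

lemma some_end:
  assumes "v \<in> verts G"
  shows "fst (some_end v) \<in> arcs G"
    and "tail G (fst (some_end v)) = v \<and> snd (some_end v) = 0 \<or>
         head G (fst (some_end v)) = v \<and> snd (some_end v) = len (fst (some_end v))"
proof -
  let ?P = "\<lambda>p. fst p \<in> arcs G \<and>
     (tail G (fst p) = v \<and> snd p = 0 \<or> head G (fst p) = v \<and> snd p = len (fst p))"
  obtain e where e: "e \<in> arcs G" "tail G e = v \<or> head G e = v"
    using no_isolated_vertex[OF assms] by blast
  then have "?P (e, 0) \<or> ?P (e, len e)" by auto
  then have "\<exists>p. ?P p" by blast
  then have "?P (some_end v)" unfolding some_end_def by (rule someI_ex)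
  then show "fst (some_end v) \<in> arcs G"
    and "tail G (fst (some_end v)) = v \<and> snd (some_end v) = 0 \<or>
         head G (fst (some_end v)) = v \<and> snd (some_end v) = len (fst (some_end v))"
    by blast+
qed

lemma some_end_in_edge:
  "v \<in> verts G \<Longrightarrow> snd (some_end v) \<in> {0..len (fst (some_end v))}"
  using some_end[of v] len_pos[of "fst (some_end v)"] by auto

lemma vertex_values_unique:
  assumes "vertex_values G len f \<phi>" "v \<in> verts G"
  shows "vertex_value f v = \<phi> v"
  using some_end[OF assms(2)] assms(1) by (auto simp: vertex_values_def vertex_value_def)

lemma vertex_value_linear [simp]:
  "vertex_value (f + g) v = vertex_value f v + vertex_value g v"
  "vertex_value (f - g) v = vertex_value f v - vertex_value g v"
  "vertex_value (r *\<^sub>R f) v = r * vertex_value f v"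
  "vertex_value 0 v = 0"
  by (auto simp: vertex_value_def)

lemma
  assumes "x \<in> form_domain" "e \<in> arcs G"
  shows form_domain_L2: "snd x e \<in> L2_space (edge_measure len e)"
    and form_domain_weak_deriv: "has_weak_deriv 0 (len e) (fst x e) (snd x e)"
    and form_domain_continuous: "continuous_on {0..len e} (fst x e)"
    and form_domain_fst_L2: "fst x e \<in> L2_space (edge_measure len e)"
    and form_domain_ends: "fst x e 0 = vertex_value (fst x) (tail G e)"
      "fst x e (len e) = vertex_value (fst x) (head G e)"
proof -
  show "snd x e \<in> L2_space (edge_measure len e)" and *: "has_weak_deriv 0 (len e) (fst x e) (snd x e)"
    and "fst x e 0 = vertex_value (fst x) (tail G e)"
      "fst x e (len e) = vertex_value (fst x) (head G e)"
    using assms by (auto simp: form_domain_def vertex_values_def)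
  show "continuous_on {0..len e} (fst x e)" by (rule weak_deriv_continuous[OF *])
  then show "fst x e \<in> L2_space (edge_measure len e)" by (rule continuous_L2)
qed

lemma form_domain_potential_integrable:
  assumes "x \<in> form_domain" "y \<in> form_domain" "e \<in> arcs G"
  shows "integrable (edge_measure len e) (\<lambda>t. fst x e t * fst y e t * q e t)"
  using assms by (intro integrable_mult_continuous continuous_intros q_integrable)
    (auto intro: form_domain_continuous)

lemma subspace_form_domain: "subspace form_domain"
  unfolding subspace_def
proof (intro conjI ballI allI)
  show "0 \<in> form_domain"
    by (auto simp: form_domain_def vertex_values_def weak_deriv_zero L2.D_zero)
next
  fix x y assume "x \<in> form_domain" "y \<in> form_domain"
  then show "x + y \<in> form_domain"
    by (auto simp: form_domain_def vertex_values_def weak_deriv_add L2.D_add)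
next
  fix x and r :: real assume "x \<in> form_domain"
  then show "r *\<^sub>R x \<in> form_domain"
    by (auto simp: form_domain_def vertex_values_def weak_deriv_scale L2.D_scale)
qed

sublocale mass: psd_form form_domain mass
proof
  show "subspace form_domain" by (rule subspace_form_domain)
  note int = L2_space_mult_integrable[OF form_domain_fst_L2 form_domain_fst_L2]
  show "mass (x + y) z = mass x z + mass y z"
    if "x \<in> form_domain" "y \<in> form_domain" "z \<in> form_domain" for x y z
    using that int by (simp add: mass_def sum.distrib[symmetric] algebra_simps)
  show "mass (r *\<^sub>R x) y = r * mass x y" for x y r
    by (simp add: mass_def sum_distrib_left algebra_simps)
qed (auto simp: mass_def mult.commute intro!: sum_nonneg)

sublocale kinetic: psd_form form_domain kinetic
proof
  show "subspace form_domain" by (rule subspace_form_domain)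
  note int = L2_space_mult_integrable[OF form_domain_L2 form_domain_L2]
  show "kinetic (x + y) z = kinetic x z + kinetic y z"
    if "x \<in> form_domain" "y \<in> form_domain" "z \<in> form_domain" for x y z
    using that int by (simp add: kinetic_def sum.distrib[symmetric] algebra_simps)
  show "kinetic (r *\<^sub>R x) y = r * kinetic x y" for x y r
    by (simp add: kinetic_def sum_distrib_left algebra_simps)
qed (auto simp: kinetic_def mult.commute intro!: sum_nonneg)

sublocale potential: sym_form form_domain potential
proof
  show "subspace form_domain" by (rule subspace_form_domain)
  note int = form_domain_potential_integrable
  show "potential (x + y) z = potential x z + potential y z"
    if "x \<in> form_domain" "y \<in> form_domain" "z \<in> form_domain" for x y z
    using that int by (simp add: potential_def sum.distrib[symmetric] algebra_simps)
  show "potential (r *\<^sub>R x) y = r * potential x y" for x y r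
    by (simp add: potential_def sum_distrib_left algebra_simps)
qed (auto simp: potential_def mult_ac)

sublocale form: sym_form form_domain form
  using kinetic.lincomb[OF potential.sym_form_axioms, of 1] by (simp add: form_def[abs_def])

section \<open>Point values and the potential, bounded by mass and kinetic energy\<close>

lemma edge_kinetic_le:
  assumes "e \<in> arcs G"
  shows "(LINT t|edge_measure len e. (snd x e t)\<^sup>2) \<le> kinetic x x"
  unfolding kinetic_def power2_eq_square
  by (rule member_le_sum[OF assms]) auto

lemma edge_mass_le:
  assumes "e \<in> arcs G"
  shows "(LINT t|edge_measure len e. (fst x e t)\<^sup>2) \<le> mass x x"
  unfolding mass_def power2_eq_square
  by (rule member_le_sum[OF assms]) auto

lemma sup_bound:
  assumes x: "x \<in> form_domain" and e: "e \<in> arcs G" and t: "t \<in> {0..len e}"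
    and \<delta>: "0 < \<delta>" "\<delta> \<le> len e"
  shows "(fst x e t)\<^sup>2 \<le> 2 / \<delta> * mass x x + 2 * \<delta> * kinetic x x"
proof -
  have "(fst x e t)\<^sup>2 \<le> 2 / \<delta> * (LINT s|edge_measure len e. (fst x e s)\<^sup>2)
      + 2 * \<delta> * (LINT s|edge_measure len e. (snd x e s)\<^sup>2)"
    using weak_deriv_sup_bound[OF form_domain_weak_deriv[OF x e] form_domain_L2[OF x e] t \<delta>(1)] \<delta>
    by simp
  also have "\<dots> \<le> 2 / \<delta> * mass x x + 2 * \<delta> * kinetic x x"
    using \<delta> by (intro add_mono mult_left_mono edge_mass_le edge_kinetic_le e) auto
  finally show ?thesis .
qed

text \<open>The total variation of the potential seen as a measure on the graph, with density
  \<open>q\<close> on the edges and point masses at the vertices.\<close>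

definition potential_bound :: real where
  "potential_bound = (\<Sum>e\<in>arcs G. LINT t|edge_measure len e. \<bar>q e t\<bar>)
     + (\<Sum>v\<in>verts G. \<bar>real_of_ereal (\<alpha> v)\<bar>)"

lemma potential_bound_nonneg: "0 \<le> potential_bound"
  unfolding potential_bound_def by (intro add_nonneg_nonneg sum_nonneg abs_ge_zero) auto

lemma potential_le:
  assumes x: "x \<in> form_domain"
    and S: "\<And>e t. e \<in> arcs G \<Longrightarrow> t \<in> {0..len e} \<Longrightarrow> (fst x e t)\<^sup>2 \<le> S"
  shows "\<bar>potential x x\<bar> \<le> potential_bound * S"
proof -
  have "\<bar>LINT t|edge_measure len e. fst x e t * fst x e t * q e t\<bar>
      \<le> (LINT t|edge_measure len e. \<bar>q e t\<bar>) * S" if e: "e \<in> arcs G" for e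
  proof -
    have "\<bar>LINT t|edge_measure len e. fst x e t * fst x e t * q e t\<bar>
        \<le> (LINT t|edge_measure len e. \<bar>fst x e t * fst x e t * q e t\<bar>)"
      by (rule integral_abs_bound)
    also have "\<dots> \<le> (LINT t|edge_measure len e. \<bar>q e t\<bar> * S)"
    proof (rule integral_mono)
      show "integrable (edge_measure len e) (\<lambda>t. \<bar>fst x e t * fst x e t * q e t\<bar>)"
        by (intro integrable_abs form_domain_potential_integrable x e)
      show "integrable (edge_measure len e) (\<lambda>t. \<bar>q e t\<bar> * S)"
        using q_integrable[OF e] by auto
      show "\<bar>fst x e t * fst x e t * q e t\<bar> \<le> \<bar>q e t\<bar> * S" if "t \<in> space (edge_measure len e)" for t
        using S[OF e, of t] that
        by (simp add: abs_mult power2_eq_square[symmetric] mult.commute[of _ "\<bar>q e t\<bar>"] mult_left_mono)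
    qed
    finally show ?thesis by simp
  qed
  then have "\<bar>\<Sum>e\<in>arcs G. LINT t|edge_measure len e. fst x e t * fst x e t * q e t\<bar>
      \<le> (\<Sum>e\<in>arcs G. (LINT t|edge_measure len e. \<bar>q e t\<bar>) * S)"
    by (intro order_trans[OF sum_abs sum_mono])
  moreover have "\<bar>real_of_ereal (\<alpha> v) * (vertex_value (fst x) v * vertex_value (fst x) v)\<bar>
      \<le> \<bar>real_of_ereal (\<alpha> v)\<bar> * S" if v: "v \<in> verts G" for v
    using S[OF some_end(1)[OF v] some_end_in_edge[OF v]]
    by (simp add: abs_mult vertex_value_def power2_eq_square[symmetric] mult_left_mono
        del: abs_real_of_ereal)
  then have "\<bar>\<Sum>v\<in>verts G. real_of_ereal (\<alpha> v) * (vertex_value (fst x) v * vertex_value (fst x) v)\<bar>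
      \<le> (\<Sum>v\<in>verts G. \<bar>real_of_ereal (\<alpha> v)\<bar> * S)"
    by (intro order_trans[OF sum_abs sum_mono])
  ultimately show ?thesis
    by (simp add: potential_def potential_bound_def sum_distrib_right distrib_right)
qed

lemma min_length_pos: "0 < min_length G len"
  and min_length_le: "e \<in> arcs G \<Longrightarrow> min_length G len \<le> len e"
  using arcs_nonempty len_pos by (auto simp: min_length_def)

text \<open>The potential is a form perturbation with relative bound zero: \<open>sup_bound\<close>
  with a small \<delta> charges at most half of the kinetic energy for it and puts the rest on the
  mass.\<close>

lemma form_lower_bound:
  obtains C where "0 \<le> C" "\<And>x. x \<in> form_domain \<Longrightarrow> kinetic x x / 2 \<le> form x x + C * mass x x"
proof -
  \<comment> \<open>At most the shortest edge, so that \<open>sup_bound\<close> applies on every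
    edge, and small enough that \<open>2 * \<delta> * potential_bound\<close> is at most 1/2. Adding
    1 covers a vanishing potential.\<close>
  define \<delta> where "\<delta> = min (min_length G len) (1 / (4 * (potential_bound + 1)))"
  define C where "C = potential_bound * (2 / \<delta>)"
  have \<delta>: "0 < \<delta>" "\<delta> \<le> min_length G len" "\<delta> \<le> 1 / (4 * (potential_bound + 1))"
    using min_length_pos potential_bound_nonneg by (auto simp: \<delta>_def)
  have "potential_bound * \<delta> \<le> potential_bound * (1 / (4 * (potential_bound + 1)))"
    by (intro mult_left_mono \<delta> potential_bound_nonneg)
  also have "\<dots> \<le> 1 / 4"
    using potential_bound_nonneg by (simp add: field_simps)
  finally have small: "potential_bound * \<delta> \<le> 1 / 4" .
  show thesis
  proof
    show "0 \<le> C" unfolding C_def using \<delta> potential_bound_nonneg by simp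
    fix x assume x: "x \<in> form_domain"
    have "\<bar>potential x x\<bar> \<le> potential_bound * (2 / \<delta> * mass x x + 2 * \<delta> * kinetic x x)"
      using \<delta> min_length_le by (intro potential_le[OF x] sup_bound[OF x]) force+
    also have "\<dots> = C * mass x x + 2 * (potential_bound * \<delta>) * kinetic x x"
      by (simp add: C_def algebra_simps)
    also have "\<dots> \<le> C * mass x x + 2 * (1 / 4) * kinetic x x"
      using small kinetic.nonneg[OF x] by (intro add_left_mono mult_right_mono) auto
    finally show "kinetic x x / 2 \<le> form x x + C * mass x x"
      by (simp add: form_def)
  qed
qed

text \<open>Continuity of the form: convergence in kinetic energy and mass implies convergence in
  the form. Smallness is no concern here, so \<open>sup_bound\<close> is used with the length of the
  shortest edge.\<close>

lemma form_upper_bound: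
  obtains C where "0 \<le> C" "\<And>x. x \<in> form_domain \<Longrightarrow> form x x \<le> C * (kinetic x x + mass x x)"
proof -
  define l where "l = min_length G len"
  have l: "0 < l" "\<And>e. e \<in> arcs G \<Longrightarrow> l \<le> len e"
    using min_length_pos min_length_le by (auto simp: l_def)
  define C where "C = 1 + potential_bound * (2 / l + 2 * l)"
  show thesis
  proof
    show "0 \<le> C" unfolding C_def using l potential_bound_nonneg by simp
    fix x assume x: "x \<in> form_domain"
    have "\<bar>potential x x\<bar> \<le> potential_bound * (2 / l * mass x x + 2 * l * kinetic x x)"
      using l by (intro potential_le[OF x] sup_bound[OF x]) auto
    also have "\<dots> \<le> potential_bound * ((2 / l + 2 * l) * mass x x + (2 / l + 2 * l) * kinetic x x)"
      using l kinetic.nonneg[OF x] mass.nonneg[OF x] potential_bound_nonneg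
      by (intro mult_left_mono add_mono mult_right_mono) auto
    also have "\<dots> = (C - 1) * (kinetic x x + mass x x)"
      by (simp add: C_def algebra_simps add_divide_distrib)
    finally have "\<bar>potential x x\<bar> \<le> (C - 1) * (kinetic x x + mass x x)" .
    then show "form x x \<le> C * (kinetic x x + mass x x)"
      using mass.nonneg[OF x] by (simp add: form_def left_diff_distrib)
  qed
qed

end

text \<open>The subsequence is refined for one index after the other; \<open>mono\<close> preserves
  what the earlier refinements achieved.\<close>

lemma common_subsequence:
  fixes P :: "'a \<Rightarrow> (nat \<Rightarrow> nat) \<Rightarrow> bool"
  assumes "finite A"
    and ex: "\<And>e s. e \<in> A \<Longrightarrow> strict_mono s \<Longrightarrow> \<exists>r::nat \<Rightarrow> nat. strict_mono r \<and> P e (s \<circ> r)"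
    and mono: "\<And>e s r. P e s \<Longrightarrow> strict_mono (r::nat \<Rightarrow> nat) \<Longrightarrow> P e (s \<circ> r)"
  obtains r where "strict_mono r" "\<And>e. e \<in> A \<Longrightarrow> P e r"
proof -
  have "\<exists>r::nat \<Rightarrow> nat. strict_mono r \<and> (\<forall>e\<in>A. P e r)"
    using assms(1) ex
  proof (induction A rule: finite_induct)
    case empty
    show ?case using strict_mono_id by auto
  next
    case (insert a A)
    then obtain r :: "nat \<Rightarrow> nat" where r: "strict_mono r" "\<forall>e\<in>A. P e r" by auto
    obtain s :: "nat \<Rightarrow> nat" where s: "strict_mono s" "P a (r \<circ> s)"
      using insert.prems[of a r] r(1) by blast
    have "strict_mono (r \<circ> s)" by (rule strict_mono_o[OF r(1) s(1)])
    moreover have "\<forall>e\<in>insert a A. P e (r \<circ> s)" using r s mono by auto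
    ultimately show ?case by blast
  qed
  then show thesis using that by blast
qed

lemma integral_lebesgue_on_singleton: "(LINT t|lebesgue_on {a::real}. f t) = (0::real)"
  by (rule has_bochner_integral_integral_eq[OF has_bochner_integral_null]) simp

lemma indefinite_integral_weak_deriv:
  assumes "integrable (lebesgue_on {a..b}) w"
  shows "has_weak_deriv a b (\<lambda>x. c + (LINT t|lebesgue_on {a..x}. w t)) w"
  using assms unfolding has_weak_deriv_def by (simp add: integral_lebesgue_on_singleton)

lemma (in metric_graph) total_length_pos: "0 < total_length G len"
  unfolding total_length_def using arcs_nonempty len_pos by (intro sum_pos) auto

section \<open>Compactness and completeness of the form domain\<close>

context schroedinger_graph
begin

lemma mass_le_sup:
  assumes x: "x \<in> form_domain"
    and R: "\<And>e t. e \<in> arcs G \<Longrightarrow> t \<in> {0..len e} \<Longrightarrow> (fst x e t)\<^sup>2 \<le> R e"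
  shows "mass x x \<le> (\<Sum>e\<in>arcs G. len e * R e)"
  unfolding mass_def
proof (rule sum_mono)
  fix e assume e: "e \<in> arcs G"
  have "(LINT t|edge_measure len e. (fst x e t)\<^sup>2) \<le> (len e - 0) * R e"
    using form_domain_fst_L2[OF x e] R[OF e] len_pos[OF e]
    by (intro integral_le_const) (auto simp: L2_space_def)
  then show "(LINT t|edge_measure len e. fst x e t * fst x e t) \<le> len e * R e"
    by (simp add: power2_eq_square)
qed

text \<open>On each edge \<open>sup_bound\<close> makes the functions uniformly bounded and
  \<open>weak_deriv_Hoelder\<close> makes them equicontinuous. Finitely many edges share a uniformly
  Cauchy subsequence, and the finite total length turns this into smallness in mass.\<close>

lemma bounded_sequence_compact:
  assumes u: "\<And>n. u n \<in> form_domain" "\<And>n. mass (u n) (u n) \<le> A" "\<And>n. kinetic (u n) (u n) \<le> K"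
  obtains r :: "nat \<Rightarrow> nat" where "strict_mono r"
    "\<And>\<epsilon>. \<epsilon> > 0 \<Longrightarrow> \<exists>N. \<forall>m\<ge>N. \<forall>n\<ge>N. mass (u (r m) - u (r n)) (u (r m) - u (r n)) < \<epsilon>"
proof -
  define l where "l = min_length G len"
  have l: "0 < l" "\<And>e. e \<in> arcs G \<Longrightarrow> l \<le> len e"
    using min_length_pos min_length_le by (auto simp: l_def)
  have K0: "0 \<le> K" using kinetic.nonneg[OF u(1)] u(3) by (rule order_trans)
  define B where "B = 2 / l * A + 2 * l * K"
  have B: "(fst (u n) e t)\<^sup>2 \<le> B" if "e \<in> arcs G" "t \<in> {0..len e}" for n e t
  proof -
    have "(fst (u n) e t)\<^sup>2 \<le> 2 / l * mass (u n) (u n) + 2 * l * kinetic (u n) (u n)"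
      using that l by (intro sup_bound u) auto
    also have "\<dots> \<le> B"
      unfolding B_def using l u by (intro add_mono mult_left_mono) auto
    finally show ?thesis .
  qed
  define P where "P e s \<longleftrightarrow> (\<forall>\<epsilon>>0. \<exists>N. \<forall>m\<ge>N. \<forall>n\<ge>N. \<forall>t\<in>{0..len e}.
      \<bar>fst (u (s m)) e t - fst (u (s n)) e t\<bar> < \<epsilon>)" for e and s :: "nat \<Rightarrow> nat"
  obtain r where r: "strict_mono r" "\<And>e. e \<in> arcs G \<Longrightarrow> P e r"
  proof (rule common_subsequence[of "arcs G" P])
    show "finite (arcs G)" by (rule finite_arcs)
  next
    fix e and s :: "nat \<Rightarrow> nat" assume e: "e \<in> arcs G"
    obtain g :: "real \<Rightarrow> real" and k :: "nat \<Rightarrow> nat" where k: "strict_mono k"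
      "\<And>\<epsilon>. 0 < \<epsilon> \<Longrightarrow> \<exists>N. \<forall>n t. n \<ge> N \<and> t \<in> {0..len e} \<longrightarrow> norm (fst (u (s (k n))) e t - g t) < \<epsilon>"
    proof (rule Arzela_Ascoli[of "{0..len e}" "\<lambda>n. fst (u (s n)) e" "sqrt B"])
      show "norm (fst (u (s n)) e t) \<le> sqrt B" if "t \<in> {0..len e}" for n t
        using real_sqrt_le_mono[OF B[OF e that, of "s n"]] by simp
      fix t \<epsilon> :: real assume t: "t \<in> {0..len e}" and \<epsilon>: "0 < \<epsilon>"
      \<comment> \<open>The squared difference is at most \<open>K\<close> times the distance, which
        explains the radius; \<open>K + 1\<close> avoids division by zero.\<close>
      have "norm (fst (u (s n)) e t - fst (u (s n)) e y) < \<epsilon>"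
        if y: "y \<in> {0..len e}" "norm (t - y) < \<epsilon>\<^sup>2 / (K + 1)" for n y
      proof -
        have "(fst (u (s n)) e t - fst (u (s n)) e y)\<^sup>2
            \<le> \<bar>t - y\<bar> * (LINT t|edge_measure len e. (snd (u (s n)) e t)\<^sup>2)"
          by (intro weak_deriv_Hoelder form_domain_weak_deriv form_domain_L2 u e t y)
        also have "\<dots> \<le> \<bar>t - y\<bar> * K"
          using order_trans[OF edge_kinetic_le[OF e] u(3)] by (intro mult_left_mono) auto
        also have "\<dots> \<le> \<epsilon>\<^sup>2 / (K + 1) * K"
          using y K0 by (intro mult_right_mono) auto
        also have "\<dots> < \<epsilon>\<^sup>2" using K0 \<epsilon> by (simp add: field_simps)
        finally show ?thesis
          using \<epsilon> by (metis abs_le_square_iff abs_of_pos linorder_not_le real_norm_def)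
      qed
      moreover have "0 < \<epsilon>\<^sup>2 / (K + 1)" using K0 \<epsilon> by simp
      ultimately show "\<exists>d>0. \<forall>n y. y \<in> {0..len e} \<and> norm (t - y) < d \<longrightarrow>
          norm (fst (u (s n)) e t - fst (u (s n)) e y) < \<epsilon>" by blast
    qed auto
    have "P e (s \<circ> k)"
      unfolding P_def
    proof (intro allI impI)
      fix \<epsilon> :: real assume "0 < \<epsilon>"
      then obtain N where N: "\<And>n t. n \<ge> N \<Longrightarrow> t \<in> {0..len e} \<Longrightarrow>
          \<bar>fst (u (s (k n))) e t - g t\<bar> < \<epsilon> / 2"
        using k(2)[of "\<epsilon> / 2"] by auto
      have "\<bar>fst (u ((s \<circ> k) m)) e t - fst (u ((s \<circ> k) n)) e t\<bar> < \<epsilon>"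
        if "m \<ge> N" "n \<ge> N" "t \<in> {0..len e}" for m n t
        using N[OF that(1,3)] N[OF that(2,3)] unfolding comp_def by linarith
      then show "\<exists>N. \<forall>m\<ge>N. \<forall>n\<ge>N. \<forall>t\<in>{0..len e}.
          \<bar>fst (u ((s \<circ> k) m)) e t - fst (u ((s \<circ> k) n)) e t\<bar> < \<epsilon>" by blast
    qed
    with k(1) show "\<exists>k. strict_mono k \<and> P e (s \<circ> k)" by blast
  next
    fix e s and k :: "nat \<Rightarrow> nat" assume P: "P e s" and k: "strict_mono k"
    show "P e (s \<circ> k)"
      unfolding P_def comp_def using P k[THEN seq_suble]
      unfolding P_def by (meson order_trans)
  qed blast
  have "\<exists>N. \<forall>m\<ge>N. \<forall>n\<ge>N. mass (u (r m) - u (r n)) (u (r m) - u (r n)) < \<epsilon>" if \<epsilon>: "\<epsilon> > 0" for \<epsilon>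
  proof -
    define L where "L = total_length G len"
    have L: "L > 0" using total_length_pos by (simp add: L_def)
    \<comment> \<open>A uniform gap of this size costs mass
      \<open>len e * (\<epsilon> / (2 * L))\<close> on edge \<open>e\<close>, and \<epsilon>/2 over
      the whole graph.\<close>
    have "\<forall>e\<in>arcs G. \<exists>N. \<forall>m\<ge>N. \<forall>n\<ge>N. \<forall>t\<in>{0..len e}.
        \<bar>fst (u (r m)) e t - fst (u (r n)) e t\<bar> < sqrt (\<epsilon> / (2 * L))"
      using r(2) \<epsilon> L unfolding P_def by simp
    from bchoice[OF this] obtain N where "\<forall>e\<in>arcs G. \<forall>m\<ge>N e. \<forall>n\<ge>N e. \<forall>t\<in>{0..len e}.
        \<bar>fst (u (r m)) e t - fst (u (r n)) e t\<bar> < sqrt (\<epsilon> / (2 * L))" by blast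
    then have N: "\<bar>fst (u (r m)) e t - fst (u (r n)) e t\<bar> < sqrt (\<epsilon> / (2 * L))"
      if "e \<in> arcs G" "m \<ge> N e" "n \<ge> N e" "t \<in> {0..len e}" for e m n t
      using that by blast
    \<comment> \<open>The sum of the edgewise thresholds serves as a common upper bound of
      them.\<close>
    have "mass (u (r m) - u (r n)) (u (r m) - u (r n)) < \<epsilon>"
      if mn: "m \<ge> (\<Sum>e\<in>arcs G. N e)" "n \<ge> (\<Sum>e\<in>arcs G. N e)" for m n
    proof -
      have Ne: "N e \<le> (\<Sum>e\<in>arcs G. N e)" if "e \<in> arcs G" for e
        using that by (intro member_le_sum) auto
      have "mass (u (r m) - u (r n)) (u (r m) - u (r n)) \<le> (\<Sum>e\<in>arcs G. len e * (\<epsilon> / (2 * L)))"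
      proof (rule mass_le_sup)
        show "u (r m) - u (r n) \<in> form_domain" by (intro mass.D_diff u)
        fix e t assume e: "e \<in> arcs G" and t: "t \<in> {0..len e}"
        have "\<bar>fst (u (r m)) e t - fst (u (r n)) e t\<bar> < sqrt (\<epsilon> / (2 * L))"
          using N[OF e _ _ t, of m n] mn Ne[OF e] by linarith
        then have "\<bar>fst (u (r m)) e t - fst (u (r n)) e t\<bar>\<^sup>2 \<le> (sqrt (\<epsilon> / (2 * L)))\<^sup>2"
          by (intro power_mono) auto
        then show "(fst (u (r m) - u (r n)) e t)\<^sup>2 \<le> \<epsilon> / (2 * L)"
          using \<epsilon> L by simp
      qed
      also have "\<dots> = L * (\<epsilon> / (2 * L))" by (simp only: L_def total_length_def sum_distrib_right)
      also have "\<dots> < \<epsilon>" using \<epsilon> L by simp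
      finally show ?thesis .
    qed
    then show ?thesis by blast
  qed
  with r(1) that show thesis by blast
qed

text \<open>On each edge the derivatives converge in L2 and the values at the left end converge;
  integrating the limit derivative from the limit value defines the limit function. Convergence is
  uniform on edges, so continuity at the vertices and the Dirichlet conditions survive.\<close>

lemma form_domain_complete:
  assumes u: "\<And>n. u n \<in> form_domain"
    and Cauchy: "\<And>\<epsilon>. \<epsilon> > 0 \<Longrightarrow> \<exists>N. \<forall>m\<ge>N. \<forall>n\<ge>N.
      kinetic (u m - u n) (u m - u n) < \<epsilon> \<and> mass (u m - u n) (u m - u n) < \<epsilon>"
  obtains x where "x \<in> form_domain" "(\<lambda>n. kinetic (u n - x) (u n - x)) \<longlonglongrightarrow> 0"
    "(\<lambda>n. mass (u n - x) (u n - x)) \<longlonglongrightarrow> 0"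
proof -
  define l where "l = min_length G len"
  have l: "0 < l" "\<And>e. e \<in> arcs G \<Longrightarrow> l \<le> len e"
    using min_length_pos min_length_le by (auto simp: l_def)
  have "\<exists>h. h \<in> L2_space (edge_measure len e) \<and>
      (\<lambda>n. LINT t|edge_measure len e. (snd (u n) e t - h t)\<^sup>2) \<longlonglongrightarrow> 0" if e: "e \<in> arcs G" for e
  proof (rule finite_measure.L2_complete[OF finite_measure_lebesgue_on_Icc, of "\<lambda>n. snd (u n) e" 0 "len e"])
    show "snd (u n) e \<in> L2_space (edge_measure len e)" for n by (rule form_domain_L2[OF u e])
    fix \<epsilon> :: real assume "\<epsilon> > 0"
    then obtain N where N: "\<And>m n. m \<ge> N \<Longrightarrow> n \<ge> N \<Longrightarrow> kinetic (u m - u n) (u m - u n) < \<epsilon>"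
      using Cauchy by blast
    have "(LINT t|edge_measure len e. (snd (u m) e t - snd (u n) e t)\<^sup>2) < \<epsilon>" if "m \<ge> N" "n \<ge> N" for m n
      using edge_kinetic_le[OF e, of "u m - u n"] N[OF that] by simp
    then show "\<exists>N. \<forall>m\<ge>N. \<forall>n\<ge>N. (LINT t|edge_measure len e. (snd (u m) e t - snd (u n) e t)\<^sup>2) < \<epsilon>"
      by blast
  qed blast
  then have "\<forall>e\<in>arcs G. \<exists>h. h \<in> L2_space (edge_measure len e) \<and>
      (\<lambda>n. LINT t|edge_measure len e. (snd (u n) e t - h t)\<^sup>2) \<longlonglongrightarrow> 0" by (rule ballI)
  from bchoice[OF this] obtain h where h: "\<And>e. e \<in> arcs G \<Longrightarrow> h e \<in> L2_space (edge_measure len e)"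
    "\<And>e. e \<in> arcs G \<Longrightarrow> (\<lambda>n. LINT t|edge_measure len e. (snd (u n) e t - h e t)\<^sup>2) \<longlonglongrightarrow> 0"
    by blast
  have "convergent (\<lambda>n. fst (u n) e 0)" if e: "e \<in> arcs G" for e
  proof -
    have "Cauchy (\<lambda>n. fst (u n) e 0)"
    proof (rule CauchyI)
      fix \<epsilon> :: real assume \<epsilon>: "\<epsilon> > 0"
      \<comment> \<open>The divisor is the sum of the two coefficients in \<open>sup_bound\<close>
        for an interval as long as the shortest edge.\<close>
      define \<eta> where "\<eta> = \<epsilon>\<^sup>2 / (2 / l + 2 * l)"
      have pos: "2 / l + 2 * l > 0" using l by (simp add: add_pos_pos)
      then have \<eta>: "\<eta> > 0" "(2 / l + 2 * l) * \<eta> = \<epsilon>\<^sup>2" using \<epsilon> unfolding \<eta>_def by simp_all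
      obtain N where N: "\<And>m n. m \<ge> N \<Longrightarrow> n \<ge> N \<Longrightarrow>
          kinetic (u m - u n) (u m - u n) < \<eta> \<and> mass (u m - u n) (u m - u n) < \<eta>"
        using Cauchy[OF \<eta>(1)] by blast
      have "norm (fst (u m) e 0 - fst (u n) e 0) < \<epsilon>" if "m \<ge> N" "n \<ge> N" for m n
      proof -
        have "(fst (u m - u n) e 0)\<^sup>2
            \<le> 2 / l * mass (u m - u n) (u m - u n) + 2 * l * kinetic (u m - u n) (u m - u n)"
          using l e len_pos[OF e] by (intro sup_bound mass.D_diff u) auto
        also have "\<dots> < 2 / l * \<eta> + 2 * l * \<eta>"
          using N[OF that] l by (intro add_strict_mono mult_strict_left_mono) auto
        also have "\<dots> = \<epsilon>\<^sup>2" using \<eta>(2) by (simp only: distrib_right)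
        finally have "\<bar>fst (u m) e 0 - fst (u n) e 0\<bar>\<^sup>2 < \<epsilon>\<^sup>2" by simp
        then show ?thesis using \<epsilon> power_less_imp_less_base[of _ 2 \<epsilon>] by simp
      qed
      then show "\<exists>N. \<forall>m\<ge>N. \<forall>n\<ge>N. norm (fst (u m) e 0 - fst (u n) e 0) < \<epsilon>" by blast
    qed
    then show ?thesis by (simp add: Cauchy_convergent_iff)
  qed
  then have c: "(\<lambda>n. fst (u n) e 0) \<longlonglongrightarrow> lim (\<lambda>n. fst (u n) e 0)" if "e \<in> arcs G" for e
    using that by (simp add: convergent_LIMSEQ_iff)
  define c where "c e = lim (\<lambda>n. fst (u n) e 0)" for e
  note c = c[folded c_def]
  define f where "f e t = c e + (LINT s|lebesgue_on {0..t}. h e s)" for e t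
  have f: "has_weak_deriv 0 (len e) (f e) (h e)" if "e \<in> arcs G" for e
    unfolding f_def
    by (rule indefinite_integral_weak_deriv[OF L2_lebesgue_on_integrable[OF h(1)[OF that]]])
  \<comment> \<open>Bounds the squared distance to the limit at every point of the edge: an initial
    value plus the Hoelder estimate from 0, the factors 2 coming from splitting the square.\<close>
  define R where "R n e = 2 * (fst (u n) e 0 - c e)\<^sup>2
      + 2 * (len e * (LINT t|edge_measure len e. (snd (u n) e t - h e t)\<^sup>2))" for n e
  have R_lim: "(\<lambda>n. R n e) \<longlonglongrightarrow> 0" if "e \<in> arcs G" for e
  proof -
    have "(\<lambda>n. R n e) \<longlonglongrightarrow> 2 * (c e - c e)\<^sup>2 + 2 * (len e * 0)"
      unfolding R_def by (intro tendsto_intros c h(2) that)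
    then show ?thesis by simp
  qed
  have R: "(fst (u n) e t - f e t)\<^sup>2 \<le> R n e" if e: "e \<in> arcs G" and t: "t \<in> {0..len e}" for n e t
  proof -
    define d where "d = fst (u n) e - f e"
    define w where "w = snd (u n) e - h e"
    have d: "has_weak_deriv 0 (len e) d w"
      using weak_deriv_add[OF form_domain_weak_deriv[OF u e] weak_deriv_scale[OF f[OF e], of "-1"]]
      by (simp add: d_def w_def)
    have w: "w \<in> L2_space (edge_measure len e)"
      unfolding w_def by (intro L2.D_diff form_domain_L2 u h e)
    have "(d t - d 0)\<^sup>2 \<le> \<bar>t - 0\<bar> * (LINT s|edge_measure len e. (w s)\<^sup>2)"
      using t by (intro weak_deriv_Hoelder[OF d w]) auto
    also have "\<dots> \<le> len e * (LINT s|edge_measure len e. (w s)\<^sup>2)"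
      using t by (intro mult_right_mono) auto
    finally have 1: "(d t - d 0)\<^sup>2 \<le> len e * (LINT s|edge_measure len e. (w s)\<^sup>2)" .
    have "(d t)\<^sup>2 \<le> 2 * (d 0)\<^sup>2 + 2 * (d t - d 0)\<^sup>2"
      using zero_le_power2[of "d t - 2 * d 0"] by (simp add: power2_eq_square algebra_simps)
    with 1 have "(d t)\<^sup>2 \<le> 2 * (d 0)\<^sup>2 + 2 * (len e * (LINT s|edge_measure len e. (w s)\<^sup>2))"
      by linarith
    moreover have "f e 0 = c e" by (simp add: f_def integral_lebesgue_on_singleton)
    ultimately show ?thesis by (simp add: R_def d_def w_def)
  qed
  have f_lim: "(\<lambda>n. fst (u n) e t) \<longlonglongrightarrow> f e t" if "e \<in> arcs G" "t \<in> {0..len e}" for e t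
  proof -
    have "(\<lambda>n. sqrt (R n e)) \<longlonglongrightarrow> sqrt 0"
      by (intro tendsto_real_sqrt R_lim that)
    moreover have "\<bar>fst (u n) e t - f e t\<bar> \<le> sqrt (R n e)" for n
      using real_sqrt_le_mono[OF R[OF that, of n]] by simp
    ultimately have "(\<lambda>n. fst (u n) e t - f e t) \<longlonglongrightarrow> 0"
      by (intro Lim_null_comparison[OF always_eventually, of "\<lambda>n. fst (u n) e t - f e t"
            "\<lambda>n. sqrt (R n e)"]) (simp_all only: real_norm_def real_sqrt_zero simp_thms)
    then show ?thesis by (rule LIM_zero_cancel)
  qed
  have vertex_lim: "(\<lambda>n. vertex_value (fst (u n)) v) \<longlonglongrightarrow> vertex_value f v" if "v \<in> verts G" for v
    unfolding vertex_value_def by (intro f_lim some_end some_end_in_edge that)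
  have x: "(f, h) \<in> form_domain"
    unfolding form_domain_def
  proof (intro CollectI conjI ballI impI)
    fix e assume e: "e \<in> arcs G"
    show "snd (f, h) e \<in> L2_space (edge_measure len e)" using h e by simp
    show "has_weak_deriv 0 (len e) (fst (f, h) e) (snd (f, h) e)" using f e by simp
  next
    have "f e 0 = vertex_value f (tail G e)" if e: "e \<in> arcs G" for e
    proof (rule LIMSEQ_unique)
      show "(\<lambda>n. fst (u n) e 0) \<longlonglongrightarrow> f e 0" using f_lim[OF e, of 0] len_pos[OF e] by simp
      show "(\<lambda>n. fst (u n) e 0) \<longlonglongrightarrow> vertex_value f (tail G e)"
        using vertex_lim[OF tail_in_verts[OF e]] form_domain_ends(1)[OF u e] by simp
    qed
    moreover have "f e (len e) = vertex_value f (head G e)" if e: "e \<in> arcs G" for e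
    proof (rule LIMSEQ_unique)
      show "(\<lambda>n. fst (u n) e (len e)) \<longlonglongrightarrow> f e (len e)"
        using f_lim[OF e, of "len e"] len_pos[OF e] by simp
      show "(\<lambda>n. fst (u n) e (len e)) \<longlonglongrightarrow> vertex_value f (head G e)"
        using vertex_lim[OF head_in_verts[OF e]] form_domain_ends(2)[OF u e] by simp
    qed
    ultimately show "vertex_values G len (fst (f, h)) (vertex_value (fst (f, h)))"
      by (simp add: vertex_values_def)
  next
    fix v assume v: "v \<in> verts G" "\<alpha> v = \<infinity>"
    then have "vertex_value (fst (u n)) v = 0" for n using u[of n] by (simp add: form_domain_def)
    then show "vertex_value (fst (f, h)) v = 0"
      using vertex_lim[OF v(1)] by (simp add: LIMSEQ_const_iff)
  qed
  moreover have "(\<lambda>n. kinetic (u n - (f, h)) (u n - (f, h))) \<longlonglongrightarrow> 0"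
  proof -
    have "(\<lambda>n. \<Sum>e\<in>arcs G. LINT t|edge_measure len e. (snd (u n) e t - h e t)\<^sup>2) \<longlonglongrightarrow> 0"
      by (intro tendsto_null_sum h(2))
    then show ?thesis by (simp add: kinetic_def power2_eq_square)
  qed
  moreover have "(\<lambda>n. mass (u n - (f, h)) (u n - (f, h))) \<longlonglongrightarrow> 0"
  proof (rule real_tendsto_sandwich)
    have D: "u n - (f, h) \<in> form_domain" for n by (intro mass.D_diff u x)
    show "\<forall>\<^sub>F n in sequentially. 0 \<le> mass (u n - (f, h)) (u n - (f, h))"
      by (intro always_eventually allI mass.nonneg D)
    show "\<forall>\<^sub>F n in sequentially. mass (u n - (f, h)) (u n - (f, h)) \<le> (\<Sum>e\<in>arcs G. len e * R n e)"
      using R by (intro always_eventually allI mass_le_sup D) simp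
    show "(\<lambda>n. \<Sum>e\<in>arcs G. len e * R n e) \<longlonglongrightarrow> 0"
      by (intro tendsto_null_sum tendsto_mult_right_zero R_lim)
  qed auto
  ultimately show thesis by (rule that)
qed

text \<open>Shifting the form by a multiple of the mass makes it positive.\<close>

lemma weak_eigenfunctions:
  fixes F :: "nat \<Rightarrow> 'e sobolev"
  assumes F: "\<And>i. i < k \<Longrightarrow> F i \<in> form_domain"
    and indep: "\<And>c. \<exists>i<k. c i \<noteq> 0 \<Longrightarrow>
      mass (\<Sum>i<k. c i *\<^sub>R F i) (\<Sum>i<k. c i *\<^sub>R F i) > 0"
    and upper: "\<And>c. form (\<Sum>i<k. c i *\<^sub>R F i) (\<Sum>i<k. c i *\<^sub>R F i)
      \<le> \<mu> * mass (\<Sum>i<k. c i *\<^sub>R F i) (\<Sum>i<k. c i *\<^sub>R F i)"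
  obtains u :: "nat \<Rightarrow> 'e sobolev" and \<nu> :: "nat \<Rightarrow> real"
  where "\<And>i. i < k \<Longrightarrow> u i \<in> form_domain" "\<And>i. i < k \<Longrightarrow> \<nu> i \<le> \<mu>"
    "\<And>i j. i < k \<Longrightarrow> j < k \<Longrightarrow> mass (u i) (u j) = (if i = j then 1 else 0)"
    "\<And>i y. i < k \<Longrightarrow> y \<in> form_domain \<Longrightarrow> form (u i) y = \<nu> i * mass (u i) y"
proof -
  obtain C where C: "0 \<le> C" "\<And>x. x \<in> form_domain \<Longrightarrow> kinetic x x / 2 \<le> form x x + C * mass x x"
    by (rule form_lower_bound) blast
  obtain C' where C': "0 \<le> C'"
    "\<And>x. x \<in> form_domain \<Longrightarrow> form x x \<le> C' * (kinetic x x + mass x x)"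
    by (rule form_upper_bound) blast
  define a where "a x y = form x y + C * mass x y" for x y
  have kin_le: "kinetic x x \<le> 2 * a x x" if "x \<in> form_domain" for x
    using C(2)[OF that] by (simp add: a_def)
  have a_le: "a x x \<le> C' * (kinetic x x + mass x x) + C * mass x x" if "x \<in> form_domain" for x
    using C'(2)[OF that] by (simp add: a_def)
  have sa: "sym_form form_domain a"
    unfolding a_def[abs_def] by (rule form.lincomb[OF mass.sym_form_axioms])
  interpret compact_form_pair form_domain a mass
  proof (intro compact_form_pair.intro psd_form.intro sa psd_form_axioms.intro mass.psd_form_axioms
      compact_form_pair_axioms.intro)
    show "0 \<le> a x x" if "x \<in> form_domain" for x
      using kin_le[OF that] kinetic.nonneg[OF that] by linarith
  next
    fix K and u :: "nat \<Rightarrow> 'e sobolev"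
    assume u: "\<And>n. u n \<in> form_domain \<and> mass (u n) (u n) = 1 \<and> a (u n) (u n) \<le> K"
    have kin: "kinetic (u n) (u n) \<le> 2 * K" for n using kin_le[of "u n"] u[of n] by linarith
    have D: "u n \<in> form_domain" and m: "mass (u n) (u n) \<le> 1" for n using u[of n] by auto
    show "\<exists>r::nat \<Rightarrow> nat. strict_mono r \<and> (\<forall>\<epsilon>>0. \<exists>N. \<forall>m\<ge>N. \<forall>n\<ge>N.
        mass (u (r m) - u (r n)) (u (r m) - u (r n)) < \<epsilon>)"
      by (rule bounded_sequence_compact[of u 1 "2 * K", OF D m kin]) blast
  next
    fix u :: "nat \<Rightarrow> 'e sobolev"
    assume u: "\<And>n. u n \<in> form_domain"
      and Cauchy: "\<And>\<epsilon>. 0 < \<epsilon> \<Longrightarrow> \<exists>N. \<forall>m\<ge>N. \<forall>n\<ge>N.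
        a (u m - u n) (u m - u n) < \<epsilon> \<and> mass (u m - u n) (u m - u n) < \<epsilon>"
    obtain x where x: "x \<in> form_domain" "(\<lambda>n. kinetic (u n - x) (u n - x)) \<longlonglongrightarrow> 0"
      "(\<lambda>n. mass (u n - x) (u n - x)) \<longlonglongrightarrow> 0"
    proof (rule form_domain_complete[OF u])
      fix \<epsilon> :: real assume \<epsilon>: "\<epsilon> > 0"
      then obtain N where N: "\<And>m n. m \<ge> N \<Longrightarrow> n \<ge> N \<Longrightarrow>
          a (u m - u n) (u m - u n) < \<epsilon> / 2 \<and> mass (u m - u n) (u m - u n) < \<epsilon> / 2"
        using Cauchy[of "\<epsilon> / 2"] by auto
      have "kinetic (u m - u n) (u m - u n) < \<epsilon> \<and> mass (u m - u n) (u m - u n) < \<epsilon>"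
        if "m \<ge> N" "n \<ge> N" for m n
        using N[OF that] kin_le[OF mass.D_diff[OF u u], of m n] \<epsilon> by linarith
      then show "\<exists>N. \<forall>m\<ge>N. \<forall>n\<ge>N.
          kinetic (u m - u n) (u m - u n) < \<epsilon> \<and> mass (u m - u n) (u m - u n) < \<epsilon>" by blast
    qed blast
    have D: "u n - x \<in> form_domain" for n by (intro mass.D_diff u x)
    \<comment> \<open>\<open>form_lower_bound\<close> made the sequence Cauchy in kinetic energy;
      \<open>form_upper_bound\<close> carries the resulting limit back to the shifted form.\<close>
    have "(\<lambda>n. a (u n - x) (u n - x)) \<longlonglongrightarrow> 0"
    proof (rule real_tendsto_sandwich)
      show "\<forall>\<^sub>F n in sequentially. 0 \<le> a (u n - x) (u n - x)"
        using kin_le[OF D] kinetic.nonneg[OF D] by (intro always_eventually allI) (smt (verit))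
      show "\<forall>\<^sub>F n in sequentially. a (u n - x) (u n - x)
        \<le> C' * (kinetic (u n - x) (u n - x) + mass (u n - x) (u n - x)) + C * mass (u n - x) (u n - x)"
        by (intro always_eventually allI a_le D)
      have "(\<lambda>n. C' * (kinetic (u n - x) (u n - x) + mass (u n - x) (u n - x))
          + C * mass (u n - x) (u n - x)) \<longlonglongrightarrow> C' * (0 + 0) + C * 0"
        by (intro tendsto_add tendsto_mult_left x)
      then show "(\<lambda>n. C' * (kinetic (u n - x) (u n - x) + mass (u n - x) (u n - x))
          + C * mass (u n - x) (u n - x)) \<longlonglongrightarrow> 0" by simp
    qed auto
    with x show "\<exists>x\<in>form_domain. (\<lambda>n. a (u n - x) (u n - x)) \<longlonglongrightarrow> 0 \<and>
        (\<lambda>n. mass (u n - x) (u n - x)) \<longlonglongrightarrow> 0" by blast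
  qed (simp_all add: mass.sym_form_axioms mass.nonneg)
  have a_upper: "a (\<Sum>i<k. c i *\<^sub>R F i) (\<Sum>i<k. c i *\<^sub>R F i)
      \<le> (\<mu> + C) * mass (\<Sum>i<k. c i *\<^sub>R F i) (\<Sum>i<k. c i *\<^sub>R F i)" for c
    using upper[of c] by (simp add: a_def distrib_right)
  obtain u \<nu> where u: "\<And>i. i < k \<Longrightarrow> u i \<in> form_domain" "\<And>i. i < k \<Longrightarrow> \<nu> i \<le> \<mu> + C"
    "\<And>i j. i < k \<Longrightarrow> j < k \<Longrightarrow> mass (u i) (u j) = (if i = j then 1 else 0)"
    "\<And>i y. i < k \<Longrightarrow> y \<in> form_domain \<Longrightarrow> a (u i) y = \<nu> i * mass (u i) y"
    by (rule weak_eigenvectors[of k F "\<mu> + C"]) ((rule F indep a_upper, assumption?)+, blast)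
  show thesis
  proof (rule that[of u "\<lambda>i. \<nu> i - C"])
    show "\<nu> i - C \<le> \<mu>" if "i < k" for i using u(2)[OF that] by simp
    show "form (u i) y = (\<nu> i - C) * mass (u i) y" if "i < k" "y \<in> form_domain" for i y
      using u(4)[OF that] by (simp add: a_def left_diff_distrib)
  qed (use u in auto)
qed

end

section \<open>Weak eigenfunctions solve the vertex problem\<close>

lemma sum_fun_apply: "(\<Sum>i\<in>I. f i) x = (\<Sum>i\<in>I. f i x)"
  by (induction I rule: infinite_finite_induct) auto

lemma AE_lebesgue_on_subset:
  assumes "AE x in lebesgue_on T. P x" "S \<subseteq> T" "S \<in> sets lebesgue" "T \<in> sets lebesgue"
  shows "AE x in lebesgue_on S. P x"
  using assms by (auto simp: AE_restrict_space_iff)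

text \<open>Lets the square integrable representative of a derivative be exchanged for the
  absolutely continuous one that \<open>schroedinger\<close> asks for.\<close>

lemma weak_deriv_cong_AE:
  assumes u: "has_weak_deriv a b u w" and z: "integrable (lebesgue_on {a..b}) z"
    and eq: "AE x in lebesgue_on {a..b}. w x = z x"
  shows "has_weak_deriv a b u z"
  unfolding has_weak_deriv_def
proof (intro conjI ballI z)
  fix x assume x: "x \<in> {a..b}"
  then have sub: "{a..x} \<subseteq> {a..b}" by auto
  have "(LINT t|lebesgue_on {a..x}. w t) = (LINT t|lebesgue_on {a..x}. z t)"
  proof (rule integral_cong_AE)
    show "w \<in> borel_measurable (lebesgue_on {a..x})" "z \<in> borel_measurable (lebesgue_on {a..x})"
      using integrable_subinterval[OF weak_deriv_integrable[OF u] sub] integrable_subinterval[OF z sub]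
      by auto
    show "AE t in lebesgue_on {a..x}. w t = z t"
      by (rule AE_lebesgue_on_subset[OF eq sub]) auto
  qed
  then show "u x = u a + (LINT t|lebesgue_on {a..x}. z t)"
    using weak_deriv_value[OF u x] by simp
qed

context schroedinger_graph
begin

lemma form_domainI:
  assumes "\<And>e. e \<in> arcs G \<Longrightarrow> w e \<in> L2_space (edge_measure len e)"
    and "\<And>e. e \<in> arcs G \<Longrightarrow> has_weak_deriv 0 (len e) (f e) (w e)"
    and \<phi>: "vertex_values G len f \<phi>" "\<And>v. v \<in> verts G \<Longrightarrow> \<alpha> v = \<infinity> \<Longrightarrow> \<phi> v = 0"
  shows "(f, w) \<in> form_domain"
proof -
  have "vertex_values G len f (vertex_value f)"
    unfolding vertex_values_def
    using \<phi>(1) vertex_values_unique[OF \<phi>(1)] tail_in_verts head_in_verts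
    by (auto simp: vertex_values_def)
  with assms show ?thesis
    by (auto simp: form_domain_def vertex_values_unique)
qed

text \<open>The boundary terms of integration by parts, regrouped by vertex. The outgoing derivative
  at the head of an edge is \<open>- f1 e (len e)\<close>, whence the sign; a loop enters through
  both of its ends.\<close>

lemma sum_over_ends:
  "(\<Sum>e\<in>arcs G. f1 e (len e) * \<phi> (head G e) - f1 e 0 * \<phi> (tail G e)) =
    - (\<Sum>v\<in>verts G. outgoing_deriv_sum G len f1 v * \<phi> v)"
proof -
  have "(\<Sum>e\<in>arcs G. g e * \<phi> (h e)) = (\<Sum>v\<in>verts G. (\<Sum>e\<in>{e \<in> arcs G. h e = v}. g e) * \<phi> v)"
    if "h ` arcs G \<subseteq> verts G" for g :: "'e \<Rightarrow> real" and h
    using sum.group[OF finite_arcs finite_verts that, of "\<lambda>e. g e * \<phi> (h e)"]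
    by (simp add: sum_distrib_right)
  from this[of "head G" "\<lambda>e. f1 e (len e)"] this[of "tail G" "\<lambda>e. f1 e 0"]
  show ?thesis
    by (simp add: outgoing_deriv_sum_def out_arcs_def in_arcs_def sum_subtractf sum_negf
        distrib_right sum.distrib left_diff_distrib image_subset_iff sum_distrib_right)
qed

lemma potential_mass_edge:
  assumes x: "x \<in> form_domain" and y: "y \<in> form_domain" and e: "e \<in> arcs G"
  shows "(LINT t|edge_measure len e. fst x e t * fst y e t * q e t)
      - \<nu> * (LINT t|edge_measure len e. fst x e t * fst y e t) =
    (LINT t|edge_measure len e. (q e t - \<nu>) * fst x e t * fst y e t)"
proof -
  have "(LINT t|edge_measure len e. fst x e t * fst y e t * q e t)
      - (LINT t|edge_measure len e. \<nu> * (fst x e t * fst y e t)) =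
    (LINT t|edge_measure len e. fst x e t * fst y e t * q e t - \<nu> * (fst x e t * fst y e t))"
    using form_domain_potential_integrable[OF x y e]
      L2_space_mult_integrable[OF form_domain_fst_L2[OF x e] form_domain_fst_L2[OF y e]]
    by (subst Bochner_Integration.integral_diff) auto
  also have "\<dots> = (LINT t|edge_measure len e. (q e t - \<nu>) * fst x e t * fst y e t)"
    by (intro Bochner_Integration.integral_cong) (auto simp: algebra_simps)
  finally show ?thesis by simp
qed

lemma form_minus_mass:
  assumes x: "x \<in> form_domain" and y: "y \<in> form_domain"
  shows "form x y - \<nu> * mass x y =
    (\<Sum>e\<in>arcs G. (LINT t|edge_measure len e. snd x e t * snd y e t) +
      (LINT t|edge_measure len e. (q e t - \<nu>) * fst x e t * fst y e t)) +
    (\<Sum>v\<in>verts G. real_of_ereal (\<alpha> v) * (vertex_value (fst x) v * vertex_value (fst y) v))"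
proof -
  have "(\<Sum>e\<in>arcs G. LINT t|edge_measure len e. (q e t - \<nu>) * fst x e t * fst y e t) =
    (\<Sum>e\<in>arcs G. (LINT t|edge_measure len e. fst x e t * fst y e t * q e t)
      - \<nu> * (LINT t|edge_measure len e. fst x e t * fst y e t))"
    using potential_mass_edge[OF x y] by (intro sum.cong) auto
  then show ?thesis
    by (simp add: form_def kinetic_def potential_def mass_def sum.distrib sum_subtractf sum_distrib_left)
qed

text \<open>Integration by parts on every edge; the differential equation cancels the interior terms
  and leaves the defects of the vertex conditions. It serves in both directions: to read off vertex
  conditions from the weak equation, and to turn an eigenfunction into a Rayleigh quotient.\<close>

lemma Green_formula:
  assumes x: "x \<in> form_domain" and y: "y \<in> form_domain"
    and f1: "\<And>e. e \<in> arcs G \<Longrightarrow> has_weak_deriv 0 (len e) (f1 e) (f2 e)"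
    and w: "\<And>e. e \<in> arcs G \<Longrightarrow> AE t in edge_measure len e. snd x e t = f1 e t"
    and f2: "\<And>e. e \<in> arcs G \<Longrightarrow> AE t in edge_measure len e. f2 e t = (q e t - \<nu>) * fst x e t"
  shows "form x y - \<nu> * mass x y = (\<Sum>v\<in>verts G.
    (real_of_ereal (\<alpha> v) * vertex_value (fst x) v - outgoing_deriv_sum G len f1 v) * vertex_value (fst y) v)"
proof -
  have "(LINT t|edge_measure len e. snd x e t * snd y e t) +
      (LINT t|edge_measure len e. (q e t - \<nu>) * fst x e t * fst y e t) =
    f1 e (len e) * vertex_value (fst y) (head G e) - f1 e 0 * vertex_value (fst y) (tail G e)"
    if e: "e \<in> arcs G" for e
  proof -
    have m [measurable]: "snd x e \<in> borel_measurable (edge_measure len e)"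
      "snd y e \<in> borel_measurable (edge_measure len e)"
      "fst x e \<in> borel_measurable (edge_measure len e)"
      "fst y e \<in> borel_measurable (edge_measure len e)"
      "f1 e \<in> borel_measurable (edge_measure len e)"
      "f2 e \<in> borel_measurable (edge_measure len e)"
      "q e \<in> borel_measurable (edge_measure len e)"
      using form_domain_L2[OF x e] form_domain_L2[OF y e] form_domain_fst_L2[OF x e]
        form_domain_fst_L2[OF y e] weak_deriv_integrable[OF f1[OF e]] q_integrable[OF e]
        continuous_L2[OF weak_deriv_continuous[OF f1[OF e]]]
      by (auto simp: L2_space_def)
    have "(LINT t|edge_measure len e. snd x e t * snd y e t) = (LINT t|edge_measure len e. f1 e t * snd y e t)"
      by (rule integral_cong_AE) (use w[OF e] in auto)
    moreover have "(LINT t|edge_measure len e. (q e t - \<nu>) * fst x e t * fst y e t)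
        = (LINT t|edge_measure len e. f2 e t * fst y e t)"
      by (rule integral_cong_AE) (use f2[OF e] in auto)
    ultimately show ?thesis
      using weak_deriv_by_parts[OF f1[OF e] form_domain_weak_deriv[OF y e]] len_pos[OF e]
        form_domain_ends[OF y e] by simp
  qed
  then have "(\<Sum>e\<in>arcs G. (LINT t|edge_measure len e. snd x e t * snd y e t) +
      (LINT t|edge_measure len e. (q e t - \<nu>) * fst x e t * fst y e t)) =
    - (\<Sum>v\<in>verts G. outgoing_deriv_sum G len f1 v * vertex_value (fst y) v)"
    unfolding sum_over_ends[symmetric] by (rule sum.cong[OF refl])
  then show ?thesis
    unfolding form_minus_mass[OF x y]
    by (simp add: left_diff_distrib sum_subtractf mult.assoc)
qed

text \<open>The du Bois-Reymond argument: testing with the primitive of the defect shows that the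
  weak derivative is itself absolutely continuous.\<close>

lemma weak_eigenfunction_regular:
  assumes x: "x \<in> form_domain"
    and weak: "\<And>y. y \<in> form_domain \<Longrightarrow> form x y = \<nu> * mass x y"
    and e: "e \<in> arcs G"
  obtains f1 where "has_weak_deriv 0 (len e) f1 (\<lambda>t. (q e t - \<nu>) * fst x e t)"
    "AE t in edge_measure len e. snd x e t = f1 t"
proof -
  define r where "r t = (q e t - \<nu>) * fst x e t" for t
  have r: "integrable (edge_measure len e) r"
  proof -
    have "integrable (edge_measure len e) (\<lambda>t. fst x e t * q e t - \<nu> * fst x e t)"
      using integrable_mult_continuous[OF form_domain_continuous[OF x e] q_integrable[OF e]]
        L2_lebesgue_on_integrable[OF form_domain_fst_L2[OF x e]] by auto
    then show ?thesis by (simp add: r_def[abs_def] algebra_simps)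
  qed
  define W where "W t = (LINT s|lebesgue_on {0..t}. r s)" for t
  have W: "has_weak_deriv 0 (len e) W r"
    using indefinite_integral_weak_deriv[OF r, of 0] by (simp add: W_def[abs_def])
  have w_int: "integrable (edge_measure len e) (snd x e)"
    by (rule L2_lebesgue_on_integrable[OF form_domain_L2[OF x e]])
  have W_int: "integrable (edge_measure len e) W"
    by (rule continuous_imp_integrable_real[OF weak_deriv_continuous[OF W]])
  \<comment> \<open>The constant of integration for which the defect \<open>z\<close> has mean zero,
    so that its primitive \<open>Z\<close> vanishes at both ends of the edge and is an admissible
    test function.\<close>
  define c where "c = (LINT t|edge_measure len e. snd x e t - W t) / len e"
  define f1 where "f1 t = c + W t" for t
  have f1: "has_weak_deriv 0 (len e) f1 r"
    using indefinite_integral_weak_deriv[OF r, of c] by (simp add: W_def[abs_def] f1_def[abs_def])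
  have f1_L2: "f1 \<in> L2_space (edge_measure len e)"
    by (rule continuous_L2[OF weak_deriv_continuous[OF f1]])
  define z where "z = snd x e - f1"
  have z: "z \<in> L2_space (edge_measure len e)"
    unfolding z_def by (intro L2.D_diff form_domain_L2 x e f1_L2)
  have z_int: "(LINT t|edge_measure len e. z t) = 0"
  proof -
    have "(LINT t|edge_measure len e. z t) = (LINT t|edge_measure len e. (snd x e t - W t) - c)"
      by (intro Bochner_Integration.integral_cong) (auto simp: z_def f1_def)
    also have "\<dots> = (LINT t|edge_measure len e. snd x e t - W t) - c * len e"
      using w_int W_int len_pos[OF e] finite_measure.integrable_const[OF finite_measure_lebesgue_on_Icc]
      by (subst Bochner_Integration.integral_diff) (auto simp: measure_restrict_space)
    finally show ?thesis using len_pos[OF e] by (simp add: c_def)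
  qed
  define Z where "Z t = (LINT s|lebesgue_on {0..t}. z s)" for t
  have Z: "has_weak_deriv 0 (len e) Z z"
    using indefinite_integral_weak_deriv[OF L2_lebesgue_on_integrable[OF z], of 0]
    by (simp add: Z_def[abs_def])
  have Z0: "Z 0 = 0" "Z (len e) = 0"
    using z_int by (simp_all add: Z_def integral_lebesgue_on_singleton)
  define y :: "'e sobolev" where "y = ((\<lambda>e'. if e' = e then Z else 0), (\<lambda>e'. if e' = e then z else 0))"
  have y: "y \<in> form_domain"
    unfolding y_def
  proof (rule form_domainI)
    show "vertex_values G len (\<lambda>e'. if e' = e then Z else 0) (\<lambda>_. 0)"
      using Z0 by (auto simp: vertex_values_def)
  qed (auto simp: z Z weak_deriv_zero L2.D_zero)
  have yv: "vertex_value (fst y) v = 0" if "v \<in> verts G" for v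
    using vertex_values_unique[of "fst y" "\<lambda>_. 0" v] Z0 that by (auto simp: vertex_values_def y_def)
  \<comment> \<open>Since \<open>Z\<close> vanishes at the ends, integration by parts turns the term
    in \<open>r\<close> into \<open>- f1 * z\<close>, and the whole expression becomes the integral
    of \<open>(snd x e - f1) * z\<close>, that is, of the square of \<open>z\<close>.\<close>
  have "0 = form x y - \<nu> * mass x y" using weak[OF y] by simp
  also have "\<dots> = (\<Sum>e'\<in>arcs G. (LINT t|edge_measure len e'. snd x e' t * snd y e' t) +
      (LINT t|edge_measure len e'. (q e' t - \<nu>) * fst x e' t * fst y e' t))"
    unfolding form_minus_mass[OF x y] by (simp add: yv)
  also have "\<dots> = (\<Sum>e'\<in>arcs G. if e' = e then (LINT t|edge_measure len e. snd x e t * z t) +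
      (LINT t|edge_measure len e. r t * Z t) else 0)"
    by (intro sum.cong) (auto simp: y_def r_def)
  also have "\<dots> = (LINT t|edge_measure len e. snd x e t * z t) + (LINT t|edge_measure len e. r t * Z t)"
    using e by simp
  also have "(LINT t|edge_measure len e. r t * Z t) = - (LINT t|edge_measure len e. f1 t * z t)"
    using weak_deriv_by_parts[OF f1 Z] len_pos[OF e] Z0 by simp
  also have "(LINT t|edge_measure len e. snd x e t * z t) + - (LINT t|edge_measure len e. f1 t * z t)
      = (LINT t|edge_measure len e. snd x e t * z t - f1 t * z t)"
    using L2_space_mult_integrable[OF form_domain_L2[OF x e] z] L2_space_mult_integrable[OF f1_L2 z]
    by simp
  also have "\<dots> = (LINT t|edge_measure len e. (z t)\<^sup>2)"
    by (intro Bochner_Integration.integral_cong) (auto simp: z_def power2_eq_square algebra_simps)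
  finally have "AE t in edge_measure len e. (z t)\<^sup>2 = 0"
    using z by (subst integral_nonneg_eq_0_iff_AE[symmetric]) (auto simp: L2_space_def)
  then have "AE t in edge_measure len e. snd x e t = f1 t"
    by eventually_elim (simp add: z_def)
  with f1 that show thesis by (simp add: r_def[abs_def])
qed

text \<open>Affine interpolation of the vertex values on each edge; a loop at \<open>v\<close>
  carries the constant 1. Such a function isolates the coupling condition at \<open>v\<close> in
  Green's formula.\<close>

lemma hat_function:
  assumes v: "v \<in> verts G" "\<alpha> v \<noteq> \<infinity>"
  obtains y where "y \<in> form_domain"
    "\<And>v'. v' \<in> verts G \<Longrightarrow> vertex_value (fst y) v' = (if v' = v then 1 else 0)"
proof -
  define a where "a e = (if tail G e = v then 1 else 0 :: real)" for e
  define b where "b e = (if head G e = v then 1 else 0 :: real)" for e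
  define w :: "'e \<Rightarrow> real \<Rightarrow> real" where "w e t = (b e - a e) / len e" for e t
  define f where "f e t = a e + t * ((b e - a e) / len e)" for e t
  have vv: "vertex_values G len f (\<lambda>v'. if v' = v then 1 else 0)"
    unfolding vertex_values_def
  proof (intro ballI conjI)
    fix e assume e: "e \<in> arcs G"
    show "f e 0 = (if tail G e = v then 1 else 0)" by (simp add: f_def a_def)
    have "f e (len e) = b e" using len_pos[OF e] by (simp add: f_def)
    then show "f e (len e) = (if head G e = v then 1 else 0)" by (simp add: b_def)
  qed
  have "(f, w) \<in> form_domain"
  proof (rule form_domainI[OF _ _ vv])
    fix e assume e: "e \<in> arcs G"
    show "w e \<in> L2_space (edge_measure len e)"
      unfolding w_def by (rule finite_measure.const_L2_space[OF finite_measure_lebesgue_on_Icc])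
    show "has_weak_deriv 0 (len e) (f e) (w e)"
      unfolding has_weak_deriv_def w_def f_def
      using finite_measure.integrable_const[OF finite_measure_lebesgue_on_Icc]
      by (auto simp: measure_restrict_space)
  qed (use v in auto)
  then show thesis using that[of "(f, w)"] vertex_values_unique[OF vv] by simp
qed

text \<open>Once regularity has given the equation on each edge, the weak equation reduces to the
  vertex sum in Green's formula, and hat functions pick out its terms one by one. The Dirichlet
  vertices are settled by membership in the form domain.\<close>

lemma weak_eigenfunction_in_eigenspace:
  assumes x: "x \<in> form_domain"
    and weak: "\<And>y. y \<in> form_domain \<Longrightarrow> form x y = \<nu> * mass x y"
  shows "fst x \<in> eigenspace G len q \<alpha> \<nu>"
proof -
  define f2 where "f2 e t = (q e t - \<nu>) * fst x e t" for e t
  have "\<exists>f1. has_weak_deriv 0 (len e) f1 (f2 e) \<and> (AE t in edge_measure len e. snd x e t = f1 t)"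
    if e: "e \<in> arcs G" for e
    by (rule weak_eigenfunction_regular[OF x weak e]) (auto simp: f2_def[abs_def])
  then have "\<forall>e\<in>arcs G. \<exists>f1. has_weak_deriv 0 (len e) f1 (f2 e) \<and>
      (AE t in edge_measure len e. snd x e t = f1 t)" by (rule ballI)
  from bchoice[OF this] obtain f1 where
    f1: "\<And>e. e \<in> arcs G \<Longrightarrow> has_weak_deriv 0 (len e) (f1 e) (f2 e)"
    and w: "\<And>e. e \<in> arcs G \<Longrightarrow> AE t in edge_measure len e. snd x e t = f1 e t" by blast
  have vertex: "outgoing_deriv_sum G len f1 v = real_of_ereal (\<alpha> v) * vertex_value (fst x) v"
    if v: "v \<in> verts G" "\<alpha> v \<noteq> \<infinity>" for v
  proof -
    obtain y where y: "y \<in> form_domain"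
      "\<And>v'. v' \<in> verts G \<Longrightarrow> vertex_value (fst y) v' = (if v' = v then 1 else 0)"
      by (rule hat_function[OF v]) blast
    have "0 = form x y - \<nu> * mass x y" using weak[OF y(1)] by simp
    also have "\<dots> = (\<Sum>v\<in>verts G. (real_of_ereal (\<alpha> v) * vertex_value (fst x) v
        - outgoing_deriv_sum G len f1 v) * vertex_value (fst y) v)"
      by (rule Green_formula[OF x y(1) f1 w]) (auto simp: f2_def)
    also have "\<dots> = (\<Sum>v'\<in>verts G. if v' = v then real_of_ereal (\<alpha> v) * vertex_value (fst x) v
        - outgoing_deriv_sum G len f1 v else 0)"
      using y(2) by (intro sum.cong) auto
    finally show ?thesis using v by simp
  qed
  have f: "has_weak_deriv 0 (len e) (fst x e) (f1 e)" if e: "e \<in> arcs G" for e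
    using weak_deriv_cong_AE[OF form_domain_weak_deriv[OF x e] _ w[OF e]]
      continuous_imp_integrable_real[OF weak_deriv_continuous[OF f1[OF e]]] by blast
  have Lp: "in_Lp G len 2 (\<lambda>e t. \<nu> * fst x e t)"
  proof -
    have "(\<bar>s\<bar> powr 2 :: real) = s\<^sup>2" for s by simp
    moreover have "(\<lambda>t. \<nu> * fst x e t) \<in> L2_space (edge_measure len e)" if "e \<in> arcs G" for e
      by (intro continuous_L2 continuous_intros form_domain_continuous x that)
    ultimately show ?thesis
      by (simp add: in_Lp_def L2_space_def)
  qed
  show ?thesis
    unfolding eigenspace_def schroedinger_def
  proof (intro CollectI exI conjI ballI)
    show "has_weak_deriv 0 (len e) (fst x e) (f1 e)" if "e \<in> arcs G" for e by (rule f[OF that])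
    show "has_weak_deriv 0 (len e) (f1 e) (f2 e)" if "e \<in> arcs G" for e by (rule f1[OF that])
    show "in_Lp G len 2 (\<lambda>e t. \<nu> * fst x e t)" by (rule Lp)
    show "AE t in edge_measure len e. \<nu> * fst x e t = - f2 e t + q e t * fst x e t"
      if "e \<in> arcs G" for e by (simp add: f2_def algebra_simps)
    show "vertex_values G len (fst x) (vertex_value (fst x))" using x by (simp add: form_domain_def)
    show "if \<alpha> v = \<infinity> then vertex_value (fst x) v = 0
        else outgoing_deriv_sum G len f1 v = real_of_ereal (\<alpha> v) * vertex_value (fst x) v"
      if "v \<in> verts G" for v
      using x vertex that by (auto simp: form_domain_def)
  qed
qed

section \<open>From weak eigenvectors to a bound on \<open>eigenvalue\<close>\<close>

lemma mass_pos:
  assumes x: "x \<in> form_domain" and e: "e \<in> arcs G" "t \<in> {0..len e}" "fst x e t \<noteq> 0"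
  shows "mass x x > 0"
proof (rule ccontr)
  assume "\<not> mass x x > 0"
  then have m: "mass x x = 0" using mass.nonneg[OF x] by simp
  define K where "K = kinetic x x + 1"
  have K: "K > 0" "kinetic x x \<le> K" using kinetic.nonneg[OF x] by (auto simp: K_def)
  \<comment> \<open>With zero mass \<open>sup_bound\<close> leaves only
    \<open>2 * \<delta> * kinetic x x\<close>, and this \<delta> makes it at most half of the value
    it should dominate.\<close>
  define \<delta> where "\<delta> = min (len e) ((fst x e t)\<^sup>2 / (4 * K))"
  have \<delta>: "0 < \<delta>" "\<delta> \<le> len e" "\<delta> \<le> (fst x e t)\<^sup>2 / (4 * K)"
    using K e len_pos by (auto simp: \<delta>_def)
  have "(fst x e t)\<^sup>2 \<le> 2 * \<delta> * kinetic x x"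
    using sup_bound[OF x e(1,2) \<delta>(1,2)] m by simp
  also have "\<dots> \<le> 2 * ((fst x e t)\<^sup>2 / (4 * K)) * K"
    using \<delta> K kinetic.nonneg[OF x] by (intro mult_mono) auto
  also have "\<dots> = (fst x e t)\<^sup>2 / 2" using K by simp
  finally show False using e(3) by simp
qed

text \<open>Needed for the infimum of reals in \<open>eigenvalue\<close> to lie below the members of
  the set. Green's formula identifies an eigenvalue with the quotient of its eigenfunction, which
  \<open>form_lower_bound\<close> keeps above \<open>- C\<close>; \<open>1 \<le> k\<close> provides
  an eigenfunction.\<close>

lemma eigenvalues_bdd_below:
  assumes "1 \<le> k"
  shows "bdd_below {\<mu>. at_least_eigenvalues G len q \<alpha> k \<mu>}"
proof -
  obtain C where C: "0 \<le> C" "\<And>x. x \<in> form_domain \<Longrightarrow> kinetic x x / 2 \<le> form x x + C * mass x x"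
    by (rule form_lower_bound) blast
  show ?thesis
  proof (rule bdd_belowI[of _ "- C"], clarify)
    fix \<mu> assume "at_least_eigenvalues G len q \<alpha> k \<mu>"
    then obtain u \<nu> where ind: "lin_indep_on_graph G len k u"
      and \<nu>: "\<nu> 0 \<le> \<mu>" "u 0 \<in> eigenspace G len q \<alpha> (\<nu> 0)"
      using assms by (auto simp: at_least_eigenvalues_def)
    have "\<exists>e\<in>arcs G. \<exists>t\<in>{0..len e}. u 0 e t \<noteq> 0"
    proof (rule ccontr)
      assume "\<not> ?thesis"
      then have "\<forall>e\<in>arcs G. \<forall>t\<in>{0..len e}. (\<Sum>i<k. (if i = 0 then 1 else 0) * u i e t) = 0"
        by (auto intro!: sum.neutral)
      then have "\<forall>i<k. (if i = 0 then 1 else 0 :: real) = 0"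
        using ind[unfolded lin_indep_on_graph_def, THEN spec, of "\<lambda>i. if i = 0 then 1 else 0"]
        by (rule mp[rotated])
      then show False using assms by auto
    qed
    then obtain e t where e: "e \<in> arcs G" "t \<in> {0..len e}" "u 0 e t \<noteq> 0" by blast
    obtain f1 f2 \<phi> where f: "\<And>e. e \<in> arcs G \<Longrightarrow> has_weak_deriv 0 (len e) (u 0 e) (f1 e)"
      and f1: "\<And>e. e \<in> arcs G \<Longrightarrow> has_weak_deriv 0 (len e) (f1 e) (f2 e)"
      and f2: "\<And>e. e \<in> arcs G \<Longrightarrow> AE t in edge_measure len e.
        \<nu> 0 * u 0 e t = - f2 e t + q e t * u 0 e t"
      and \<phi>: "vertex_values G len (u 0) \<phi>"
      and vert: "\<And>v. v \<in> verts G \<Longrightarrow> if \<alpha> v = \<infinity> then \<phi> v = 0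
        else outgoing_deriv_sum G len f1 v = real_of_ereal (\<alpha> v) * \<phi> v"
      using \<nu>(2) unfolding eigenspace_def schroedinger_def by blast
    define x where "x = (u 0, f1)"
    have x: "x \<in> form_domain"
      unfolding x_def
    proof (rule form_domainI[OF _ f \<phi>])
      show "f1 e \<in> L2_space (edge_measure len e)" if "e \<in> arcs G" for e
        by (rule continuous_L2[OF weak_deriv_continuous[OF f1[OF that]]])
      show "\<phi> v = 0" if "v \<in> verts G" "\<alpha> v = \<infinity>" for v using vert[OF that(1)] that(2) by simp
    qed
    have m: "mass x x > 0" using mass_pos[OF x e(1,2)] e(3) by (simp add: x_def)
    have "form x x - \<nu> 0 * mass x x = (\<Sum>v\<in>verts G. (real_of_ereal (\<alpha> v) * vertex_value (fst x) v
        - outgoing_deriv_sum G len f1 v) * vertex_value (fst x) v)"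
    proof (rule Green_formula[OF x x f1])
      show "AE t in edge_measure len e. f2 e t = (q e t - \<nu> 0) * fst x e t" if "e \<in> arcs G" for e
        using f2[OF that] by eventually_elim (simp add: x_def algebra_simps)
    qed (auto simp: x_def)
    also have "\<dots> = 0"
    proof (intro sum.neutral ballI)
      fix v assume v: "v \<in> verts G"
      have "vertex_value (fst x) v = \<phi> v" using vertex_values_unique[OF \<phi> v] by (simp add: x_def)
      then show "(real_of_ereal (\<alpha> v) * vertex_value (fst x) v
          - outgoing_deriv_sum G len f1 v) * vertex_value (fst x) v = 0"
        using vert[OF v] by (auto split: if_splits)
    qed
    finally have "0 \<le> (\<nu> 0 + C) * mass x x"
      using C(2)[OF x] kinetic.nonneg[OF x] by (simp add: distrib_right)
    then show "- C \<le> \<mu>" using m \<nu>(1) by (simp add: zero_le_mult_iff)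
  qed
qed

text \<open>The weak eigenvectors solve the vertex problem, and pairing a vanishing combination with
  each of them shows by orthonormality that they are independent as functions on the graph. So \<mu>
  belongs to the set whose infimum is \<open>eigenvalue\<close>.\<close>

theorem eigenvalue_le:
  fixes F :: "nat \<Rightarrow> 'e sobolev"
  assumes k: "1 \<le> k"
    and F: "\<And>i. i < k \<Longrightarrow> F i \<in> form_domain"
    and indep: "\<And>c. \<exists>i<k. c i \<noteq> 0 \<Longrightarrow>
      mass (\<Sum>i<k. c i *\<^sub>R F i) (\<Sum>i<k. c i *\<^sub>R F i) > 0"
    and upper: "\<And>c. form (\<Sum>i<k. c i *\<^sub>R F i) (\<Sum>i<k. c i *\<^sub>R F i)
      \<le> \<mu> * mass (\<Sum>i<k. c i *\<^sub>R F i) (\<Sum>i<k. c i *\<^sub>R F i)"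
  shows "eigenvalue G len q \<alpha> k \<le> \<mu>"
proof -
  obtain u \<nu> where u: "\<And>i. i < k \<Longrightarrow> u i \<in> form_domain" "\<And>i. i < k \<Longrightarrow> \<nu> i \<le> \<mu>"
    "\<And>i j. i < k \<Longrightarrow> j < k \<Longrightarrow> mass (u i) (u j) = (if i = j then 1 else 0)"
    "\<And>i y. i < k \<Longrightarrow> y \<in> form_domain \<Longrightarrow> form (u i) y = \<nu> i * mass (u i) y"
    by (rule weak_eigenfunctions[of k F "\<mu>"]) ((rule F indep upper, assumption?)+, blast)
  have "lin_indep_on_graph G len k (\<lambda>i. fst (u i))"
    unfolding lin_indep_on_graph_def
  proof (intro allI impI)
    fix c :: "nat \<Rightarrow> real" and j
    assume zero: "\<forall>e\<in>arcs G. \<forall>x\<in>{0..len e}. (\<Sum>i<k. c i * fst (u i) e x) = 0" and j: "j < k"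
    have "mass (\<Sum>i<k. c i *\<^sub>R u i) (u j) = (\<Sum>i<k. c i * mass (u i) (u j))"
      by (intro mass.sum_left u j) auto
    also have "\<dots> = (\<Sum>i<k. if i = j then c i else 0)"
      using u(3) j by (intro sum.cong) auto
    also have "\<dots> = c j" using j by simp
    finally have "c j = mass (\<Sum>i<k. c i *\<^sub>R u i) (u j)" by simp
    also have "\<dots> = 0"
      unfolding mass_def
    proof (intro sum.neutral ballI)
      fix e assume "e \<in> arcs G"
      then have "(LINT t|edge_measure len e. fst (\<Sum>i<k. c i *\<^sub>R u i) e t * fst (u j) e t)
          = (LINT t|edge_measure len e. 0)"
        using zero by (intro Bochner_Integration.integral_cong) (auto simp: fst_sum sum_fun_apply)
      then show "(LINT t|edge_measure len e. fst (\<Sum>i<k. c i *\<^sub>R u i) e t * fst (u j) e t) = 0"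
        by simp
    qed
    finally show "c j = 0" .
  qed
  then have "at_least_eigenvalues G len q \<alpha> k \<mu>"
    unfolding at_least_eigenvalues_def
  proof (intro exI[of _ "\<lambda>i. fst (u i)"] exI[of _ \<nu>] conjI allI impI)
    fix i assume i: "i < k"
    show "\<nu> i \<le> \<mu>" by (rule u(2)[OF i])
    show "fst (u i) \<in> eigenspace G len q \<alpha> (\<nu> i)"
      by (rule weak_eigenfunction_in_eigenspace[OF u(1)[OF i] u(4)[OF i]])
  qed
  then show ?thesis
    unfolding eigenvalue_def by (intro cInf_lower eigenvalues_bdd_below[OF k] CollectI)
qed

end

section \<open>Sine test functions and the eigenvalue bound\<close>

text \<open>Strict inequalities, here and in the derivative, so that for intervals sharing an
  endpoint the products vanish at every point.\<close>

definition sine_bump :: "real \<Rightarrow> real \<Rightarrow> real \<Rightarrow> real" where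
  "sine_bump a h t = (if a < t \<and> t < a + h then sin (pi * (t - a) / h) else 0)"

definition sine_bump_deriv :: "real \<Rightarrow> real \<Rightarrow> real \<Rightarrow> real" where
  "sine_bump_deriv a h t = (if a < t \<and> t < a + h then pi / h * cos (pi * (t - a) / h) else 0)"

lemma sine_bump_disjoint:
  assumes "a + h \<le> b \<or> b + h \<le> a"
  shows "sine_bump a h t * sine_bump b h t = 0" "sine_bump_deriv a h t * sine_bump_deriv b h t = 0"
  using assms by (auto simp: sine_bump_def sine_bump_deriv_def)

lemma sine_bump_square_le: "0 \<le> (sine_bump a h t)\<^sup>2" "(sine_bump a h t)\<^sup>2 \<le> 1"
  by (auto simp: sine_bump_def abs_square_le_1)

lemma sine_bump_continuous:
  assumes "0 < h"
  shows "continuous_on S (sine_bump a h)"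
proof -
  \<comment> \<open>Clamping \<open>t\<close> to the interval exhibits a composition of continuous
    maps: outside, the argument of the sine is 0 or \<open>pi\<close>.\<close>
  have "sine_bump a h t = sin (pi * (min (max t a) (a + h) - a) / h)" for t
    using assms by (auto simp: sine_bump_def min_def max_def)
  then have "sine_bump a h = (\<lambda>t. sin (pi * (min (max t a) (a + h) - a) / h))" by blast
  then show ?thesis
    using assms by (simp add: continuous_intros)
qed

lemma sine_bump_deriv_L2: "sine_bump_deriv a h \<in> L2_space (lebesgue_on {c..d})"
proof -
  have [measurable]: "sine_bump_deriv a h \<in> borel_measurable (lebesgue_on {c..d})"
    unfolding sine_bump_deriv_def by measurable
  have "(sine_bump_deriv a h t)\<^sup>2 \<le> (pi / h)\<^sup>2" for t
  proof -
    have "(pi / h)\<^sup>2 * (cos (pi * (t - a) / h))\<^sup>2 \<le> (pi / h)\<^sup>2 * 1"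
      by (intro mult_left_mono) (auto simp: abs_square_le_1)
    then show ?thesis by (simp add: sine_bump_deriv_def power_mult_distrib power_divide)
  qed
  then have "integrable (lebesgue_on {c..d}) (\<lambda>t. (sine_bump_deriv a h t)\<^sup>2)"
    by (intro finite_measure.integrable_const_bound[OF finite_measure_lebesgue_on_Icc,
          where B = "(pi / h)\<^sup>2"]) auto
  then show ?thesis by (simp add: L2_space_def)
qed

lemma sine_bump_weak_deriv:
  assumes h: "0 < h"
  shows "has_weak_deriv c d (sine_bump a h) (sine_bump_deriv a h)"
  unfolding has_weak_deriv_def
proof (intro conjI ballI)
  show "integrable (lebesgue_on {c..d}) (sine_bump_deriv a h)"
    by (rule L2_lebesgue_on_integrable[OF sine_bump_deriv_L2])
  fix x assume x: "x \<in> {c..d}"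
  have "(sine_bump_deriv a h has_integral (sine_bump a h x - sine_bump a h c)) {c..x}"
  \<comment> \<open>The two corners of the bump are the finite exceptional set.\<close>
  proof (rule fundamental_theorem_of_calculus_interior_strong[of "{a, a + h}"])
    fix t assume t: "t \<in> {c<..<x} - {a, a + h}"
    show "(sine_bump a h has_vector_derivative sine_bump_deriv a h t) (at t)"
    proof (cases "a < t \<and> t < a + h")
      case True
      have "((\<lambda>t. sin (pi * (t - a) / h)) has_vector_derivative sine_bump_deriv a h t) (at t)"
        using True h unfolding has_real_derivative_iff_has_vector_derivative[symmetric]
        by (auto intro!: derivative_eq_intros simp: sine_bump_deriv_def)
      then show ?thesis
        by (rule has_vector_derivative_transform_within_open[of _ _ _ "{a<..<a + h}"])
          (use True in \<open>auto simp: sine_bump_def\<close>)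
    next
      case False
      have "((\<lambda>t. 0) has_vector_derivative sine_bump_deriv a h t) (at t)"
        using False by (auto simp: sine_bump_deriv_def)
      moreover have "open (- {a..a + h})" "t \<in> - {a..a + h}" using False t by auto
      ultimately show ?thesis
        by (rule has_vector_derivative_transform_within_open) (auto simp: sine_bump_def)
    qed
  qed (use x h sine_bump_continuous in auto)
  then have "(LINT t|lebesgue_on {c..x}. sine_bump_deriv a h t) = sine_bump a h x - sine_bump a h c"
    using L2_lebesgue_on_integrable[OF sine_bump_deriv_L2[of a h c x]]
    by (simp add: lebesgue_integral_eq_integral integral_unique)
  then show "sine_bump a h x = sine_bump a h c + (LINT t|lebesgue_on {c..x}. sine_bump_deriv a h t)"
    by simp
qed

lemma integral_sin_square:
  assumes h: "0 < h"
  shows "(LINT t|lebesgue_on {a..a + h}. (sin (pi * (t - a) / h))\<^sup>2) = h / 2"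
    and "(LINT t|lebesgue_on {a..a + h}. (cos (pi * (t - a) / h))\<^sup>2) = h / 2"
proof -
  let ?M = "lebesgue_on {a..a + h}"
  have int: "integrable ?M (\<lambda>t. (sin (pi * (t - a) / h))\<^sup>2)" "integrable ?M (\<lambda>t. (cos (pi * (t - a) / h))\<^sup>2)"
    using h by (auto intro!: continuous_imp_integrable_real continuous_intros)
  define P where "P t = t / 2 - h / (4 * pi) * sin (2 * (pi * (t - a) / h))" for t
  have "((\<lambda>t. (sin (pi * (t - a) / h))\<^sup>2) has_integral (P (a + h) - P a)) {a..a + h}"
  proof (rule fundamental_theorem_of_calculus)
    fix t
    have "(P has_real_derivative (1 / 2 - 1 / 2 * cos (2 * (pi * (t - a) / h)))) (at t within {a..a + h})"
      unfolding P_def using h by (auto intro!: derivative_eq_intros simp: field_simps)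
    also have "1 / 2 - 1 / 2 * cos (2 * (pi * (t - a) / h)) = (sin (pi * (t - a) / h))\<^sup>2"
      unfolding cos_double_sin by (simp add: field_simps)
    finally show "(P has_vector_derivative (sin (pi * (t - a) / h))\<^sup>2) (at t within {a..a + h})"
      by (simp add: has_real_derivative_iff_has_vector_derivative)
  qed (use h in auto)
  moreover have "P (a + h) - P a = h / 2"
    using h by (simp add: P_def field_simps)
  ultimately show s: "(LINT t|?M. (sin (pi * (t - a) / h))\<^sup>2) = h / 2"
    using int by (simp add: lebesgue_integral_eq_integral integral_unique)
  have "(LINT t|?M. (cos (pi * (t - a) / h))\<^sup>2) = (LINT t|?M. 1 - (sin (pi * (t - a) / h))\<^sup>2)"
    by (simp add: cos_squared_eq)
  also have "\<dots> = h - h / 2"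
    using int h s finite_measure.integrable_const[OF finite_measure_lebesgue_on_Icc]
    by (subst Bochner_Integration.integral_diff) (auto simp: measure_restrict_space)
  finally show "(LINT t|?M. (cos (pi * (t - a) / h))\<^sup>2) = h / 2" by simp
qed

lemma integral_sine_bump_square:
  assumes h: "0 < h" and a: "0 \<le> a" "a + h \<le> l"
  shows "(LINT t|lebesgue_on {0..l}. (sine_bump a h t)\<^sup>2) = h / 2"
    and "(LINT t|lebesgue_on {0..l}. (sine_bump_deriv a h t)\<^sup>2) = (pi / h)\<^sup>2 * (h / 2)"
proof -
  have sub: "{a..a + h} \<subseteq> {0..l}" using a by auto
  \<comment> \<open>At the two endpoints \<open>sine_bump_deriv\<close> is 0 while the cosine is 1
    or -1, so the closed interval represents its square only almost everywhere.\<close>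
  have null: "AE t in lebesgue_on {0..l}. t \<notin> {a, a + h}"
  proof -
    have "{a, a + h} \<in> null_sets lebesgue"
      by (intro null_sets_completionI finite_imp_null_set_lborel) auto
    from AE_not_in[OF this] show ?thesis
      by (auto simp: AE_restrict_space_iff elim: eventually_mono)
  qed
  have "(LINT t|lebesgue_on {0..l}. (sine_bump a h t)\<^sup>2)
      = (LINT t|lebesgue_on {0..l}. indicator {a..a + h} t * (sin (pi * (t - a) / h))\<^sup>2)"
    using h by (intro Bochner_Integration.integral_cong)
      (auto simp: sine_bump_def indicator_def not_less order_le_less)
  also have "\<dots> = h / 2"
    using integral_sin_square(1)[OF h] sub by (simp add: integral_lebesgue_on_indicator)
  finally show "(LINT t|lebesgue_on {0..l}. (sine_bump a h t)\<^sup>2) = h / 2" .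
  have "(LINT t|lebesgue_on {0..l}. (sine_bump_deriv a h t)\<^sup>2)
      = (LINT t|lebesgue_on {0..l}. indicator {a..a + h} t * ((pi / h)\<^sup>2 * (cos (pi * (t - a) / h))\<^sup>2))"
  proof (rule integral_cong_AE)
    show "(\<lambda>t. (sine_bump_deriv a h t)\<^sup>2) \<in> borel_measurable (lebesgue_on {0..l})"
      using sine_bump_deriv_L2[of a h 0 l] by (auto simp: L2_space_def)
    show "(\<lambda>t. indicator {a..a + h} t * ((pi / h)\<^sup>2 * (cos (pi * (t - a) / h))\<^sup>2))
        \<in> borel_measurable (lebesgue_on {0..l})"
      unfolding indicator_def by measurable
    show "AE t in lebesgue_on {0..l}. (sine_bump_deriv a h t)\<^sup>2
        = indicator {a..a + h} t * ((pi / h)\<^sup>2 * (cos (pi * (t - a) / h))\<^sup>2)"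
      using null by eventually_elim
        (auto simp: sine_bump_deriv_def indicator_def power_mult_distrib power_divide)
  qed
  also have "\<dots> = (pi / h)\<^sup>2 * (h / 2)"
    using integral_sin_square(2)[OF h] sub by (simp add: integral_lebesgue_on_indicator)
  finally show "(LINT t|lebesgue_on {0..l}. (sine_bump_deriv a h t)\<^sup>2) = (pi / h)\<^sup>2 * (h / 2)" .
qed

section \<open>Integrability of \<open>q\<close> and Hoelder's inequality\<close>

lemma finite_exponent_ge_1:
  assumes "1 \<le> p" "p \<noteq> \<infinity>"
  shows "1 \<le> enn2real p"
  using assms enn2real_mono[of 1 p] by (simp add: less_top)

lemma recip_exponent_nonneg: "0 \<le> recip_exponent p"
  by (simp add: recip_exponent_def)

lemma in_Lp_integrable:
  assumes q: "in_Lp G len p q" and p: "1 \<le> p" and e: "e \<in> arcs G"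
  shows "integrable (edge_measure len e) (q e)"
proof -
  have m: "q e \<in> borel_measurable (edge_measure len e)" using q e by (simp add: in_Lp_def)
  show ?thesis
  proof (cases "p = \<infinity>")
    case True
    then obtain C where "AE x in edge_measure len e. \<bar>q e x\<bar> \<le> C"
      using q e by (auto simp: in_Lp_def)
    then show ?thesis
      using m by (intro finite_measure.integrable_const_bound[OF finite_measure_lebesgue_on_Icc]) auto
  next
    case False
    define P where "P = enn2real p"
    have P: "1 \<le> P" unfolding P_def by (rule finite_exponent_ge_1[OF p False])
    have int: "integrable (edge_measure len e) (\<lambda>x. \<bar>q e x\<bar> powr P)"
      using q e False by (simp add: in_Lp_def P_def)
    \<comment> \<open>The constant 1 is integrable because an edge has finite length; this replaces
      an inclusion of Lp spaces.\<close>
    have le: "\<bar>s\<bar> \<le> 1 + \<bar>s\<bar> powr P" for s :: real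
    proof (cases "\<bar>s\<bar> \<le> 1")
      case False
      then have "\<bar>s\<bar> powr 1 \<le> \<bar>s\<bar> powr P" using P by (intro powr_mono) auto
      then show ?thesis using False by simp
    qed (simp add: add_increasing2)
    show ?thesis
    proof (rule Bochner_Integration.integrable_bound[OF _ m])
      show "integrable (edge_measure len e) (\<lambda>x. 1 + \<bar>q e x\<bar> powr P)"
        using int finite_measure.integrable_const[OF finite_measure_lebesgue_on_Icc] by auto
      show "AE x in edge_measure len e. norm (q e x) \<le> norm (1 + \<bar>q e x\<bar> powr P)"
        using le by (intro AE_I2) (auto simp: abs_of_nonneg)
    qed
  qed
qed

text \<open>A greatest-lower-bound argument for the essential supremum in \<open>Lp_norm\<close>
  requires this set of bounds to be nonempty.\<close>

lemma Lp_norm_infinity: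
  assumes "in_Lp G len \<infinity> q"
  shows "{C. 0 \<le> C \<and> (\<forall>e\<in>arcs G. AE x in edge_measure len e. \<bar>max (q e x) 0\<bar> \<le> C)} \<noteq> {}"
proof -
  obtain C where C: "\<forall>e\<in>arcs G. AE x in edge_measure len e. \<bar>q e x\<bar> \<le> C"
    using assms by (auto simp: in_Lp_def)
  have "AE x in edge_measure len e. \<bar>max (q e x) 0\<bar> \<le> max C 0" if "e \<in> arcs G" for e
    using C[THEN bspec, OF that] by eventually_elim auto
  then show ?thesis by (intro ex_in_conv[THEN iffD1] exI[of _ "max C 0"]) auto
qed

lemma Lp_norm_nonneg:
  assumes "in_Lp G len p q"
  shows "0 \<le> Lp_norm G len p (\<lambda>e x. max (q e x) 0)"
proof (cases "p = \<infinity>")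
  case True
  then show ?thesis
    using Lp_norm_infinity[of G len q] assms unfolding Lp_norm_def by (auto intro!: cInf_greatest)
qed (simp add: Lp_norm_def)

text \<open>Weighted arithmetic-geometric mean of \<open>s powr (1 - P) * t powr P\<close> and
  \<open>s\<close>, with equality at \<open>t = s\<close>. Integrated against a weight and with a
  suitable \<open>s\<close> it yields Hoelder's inequality for all finite exponents at once,
  including \<open>P = 1\<close>, whose dual exponent is infinite.\<close>

lemma Young_scaled:
  fixes t s P :: real
  assumes "1 \<le> P" "0 \<le> t" "0 < s"
  shows "t \<le> 1 / P * s powr (1 - P) * t powr P + (1 - 1 / P) * s"
proof (cases "t = 0")
  case True
  then show ?thesis using assms by simp
next
  case False
  have "(s powr (1 - P) * t powr P) powr (1 / P) * s powr (1 - 1 / P)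
      \<le> 1 / P * (s powr (1 - P) * t powr P) + (1 - 1 / P) * s"
    using assms False by (intro Youngs_inequality_0) auto
  moreover have "(s powr (1 - P) * t powr P) powr (1 / P) * s powr (1 - 1 / P) = t"
  proof -
    have "(s powr (1 - P) * t powr P) powr (1 / P) = s powr ((1 - P) * (1 / P)) * t powr (P * (1 / P))"
      using assms by (simp add: powr_mult powr_powr)
    moreover have "(1 - P) * (1 / P) + (1 - 1 / P) = 0" using assms by (simp add: field_simps)
    then have "s powr ((1 - P) * (1 / P)) * s powr (1 - 1 / P) = 1"
      using assms by (simp only: powr_add[symmetric]) simp
    ultimately show ?thesis using assms False by (simp add: mult_ac)
  qed
  ultimately show ?thesis by (simp add: mult_ac)
qed

text \<open>Hoelder's inequality, with the dual norm of $g$ bounded through its supremum and its integral.\<close>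

lemma (in metric_graph) weighted_potential_le:
  assumes q: "in_Lp G len p q" and p: "1 \<le> p" and e: "e \<in> arcs G" and m: "0 < m"
    and g: "continuous_on {0..len e} g" "\<And>t. 0 \<le> g t" "\<And>t. g t \<le> 1"
    and gm: "(LINT t|edge_measure len e. g t) = m"
  shows "(LINT t|edge_measure len e. g t * q e t)
    \<le> m * ((1 / m) powr recip_exponent p * Lp_norm G len p (\<lambda>e x. max (q e x) 0))"
proof -
  let ?M = "edge_measure len e"
  have q_int: "integrable ?M (q e)" by (rule in_Lp_integrable[OF q p e])
  have gq: "integrable ?M (\<lambda>t. g t * q e t)" by (rule integrable_mult_continuous[OF g(1) q_int])
  have g_int: "integrable ?M g" by (rule continuous_imp_integrable_real[OF g(1)])
  have [measurable]: "q e \<in> borel_measurable ?M" "g \<in> borel_measurable ?M" using q_int g_int by auto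
  show ?thesis
  proof (cases "p = \<infinity>")
    case True
    \<comment> \<open>The weighted mean of \<open>q\<close> lies below every essential bound of its
      positive part, hence below their infimum.\<close>
    have "(LINT t|?M. g t * q e t) / m
      \<le> Inf {C. 0 \<le> C \<and> (\<forall>e\<in>arcs G. AE x in edge_measure len e. \<bar>max (q e x) 0\<bar> \<le> C)}"
    proof (rule cInf_greatest)
      show "{C. 0 \<le> C \<and> (\<forall>e\<in>arcs G. AE x in edge_measure len e. \<bar>max (q e x) 0\<bar> \<le> C)} \<noteq> {}"
        using Lp_norm_infinity q True by blast
      fix C assume "C \<in> {C. 0 \<le> C \<and> (\<forall>e\<in>arcs G. AE x in edge_measure len e. \<bar>max (q e x) 0\<bar> \<le> C)}"
      then have C: "AE t in ?M. \<bar>max (q e t) 0\<bar> \<le> C" using e by blast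
      have "(LINT t|?M. g t * q e t) \<le> (LINT t|?M. g t * C)"
      proof (rule integral_mono_AE[OF gq])
        show "integrable ?M (\<lambda>t. g t * C)" using g_int by simp
        show "AE t in ?M. g t * q e t \<le> g t * C"
          using C by eventually_elim (auto intro!: mult_left_mono g)
      qed
      then show "(LINT t|?M. g t * q e t) / m \<le> C"
        using m gm by (simp add: field_simps)
    qed
    then show ?thesis using True m by (simp add: Lp_norm_def recip_exponent_def field_simps)
  next
    case False
    define P where "P = enn2real p"
    have P: "1 \<le> P" unfolding P_def by (rule finite_exponent_ge_1[OF p False])
    have int_P: "integrable (edge_measure len e') (\<lambda>x. \<bar>max (q e' x) 0\<bar> powr P)" if e': "e' \<in> arcs G" for e'
    proof (rule Bochner_Integration.integrable_bound)
      show "integrable (edge_measure len e') (\<lambda>x. \<bar>q e' x\<bar> powr P)"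
        using q e' False by (simp add: in_Lp_def P_def)
      have [measurable]: "q e' \<in> borel_measurable (edge_measure len e')" using q e' by (simp add: in_Lp_def)
      show "(\<lambda>x. \<bar>max (q e' x) 0\<bar> powr P) \<in> borel_measurable (edge_measure len e')" by measurable
      show "AE x in edge_measure len e'. norm (\<bar>max (q e' x) 0\<bar> powr P) \<le> norm (\<bar>q e' x\<bar> powr P)"
        using P by (intro AE_I2) (auto intro!: powr_mono2)
    qed
    define S where "S = (\<Sum>e\<in>arcs G. LINT x|edge_measure len e. \<bar>max (q e x) 0\<bar> powr P)"
    have S0: "0 \<le> S" unfolding S_def by (intro sum_nonneg) auto
    have eS: "(LINT t|?M. \<bar>max (q e t) 0\<bar> powr P) \<le> S"
      unfolding S_def by (rule member_le_sum[OF e]) auto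
    \<comment> \<open>The value of \<open>s\<close> balancing the two terms of Young's inequality
      after integration: \<open>s0 powr P * m = S\<close>.\<close>
    define s0 where "s0 = (1 / m) powr (1 / P) * S powr (1 / P)"
    have s0: "0 \<le> s0" "s0 powr P * m = S"
      using P S0 m by (auto simp: s0_def powr_mult powr_powr)
    \<comment> \<open>The margin \<epsilon> makes \<open>s\<close> positive even when the positive
      part of \<open>q\<close> vanishes and \<open>s0 = 0\<close>.\<close>
    have "(LINT t|?M. g t * q e t) \<le> m * s0 + \<epsilon>" if \<epsilon>: "\<epsilon> > 0" for \<epsilon>
    proof -
      define s where "s = s0 + \<epsilon> / m"
      have s: "0 < s" "S \<le> s powr P * m"
      proof -
        show "0 < s" using s0 \<epsilon> m by (simp add: s_def add_nonneg_pos)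
        have "s0 powr P * m \<le> s powr P * m"
          using s0 \<epsilon> m P by (intro mult_right_mono powr_mono2) (auto simp: s_def)
        then show "S \<le> s powr P * m" using s0 by simp
      qed
      have gP: "integrable ?M (\<lambda>t. g t * \<bar>max (q e t) 0\<bar> powr P)"
        by (rule integrable_mult_continuous[OF g(1) int_P[OF e]])
      have "(LINT t|?M. g t * q e t)
          \<le> (LINT t|?M. 1 / P * s powr (1 - P) * (g t * \<bar>max (q e t) 0\<bar> powr P) + (1 - 1 / P) * s * g t)"
      proof (rule integral_mono[OF gq])
        show "integrable ?M (\<lambda>t. 1 / P * s powr (1 - P) * (g t * \<bar>max (q e t) 0\<bar> powr P) + (1 - 1 / P) * s * g t)"
          using gP g_int by auto
        fix t
        have "g t * q e t \<le> g t * (1 / P * s powr (1 - P) * \<bar>max (q e t) 0\<bar> powr P + (1 - 1 / P) * s)"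
          using Young_scaled[OF P, of "\<bar>max (q e t) 0\<bar>" s] s(1)
          by (intro mult_left_mono g) auto
        then show "g t * q e t
            \<le> 1 / P * s powr (1 - P) * (g t * \<bar>max (q e t) 0\<bar> powr P) + (1 - 1 / P) * s * g t"
          by (simp add: algebra_simps)
      qed
      also have "\<dots> = 1 / P * s powr (1 - P) * (LINT t|?M. g t * \<bar>max (q e t) 0\<bar> powr P) + (1 - 1 / P) * s * m"
        using gP g_int gm by (subst Bochner_Integration.integral_add) auto
      also have "\<dots> \<le> 1 / P * s powr (1 - P) * (s powr P * m) + (1 - 1 / P) * s * m"
      proof (intro add_right_mono mult_left_mono)
        have "(LINT t|?M. g t * \<bar>max (q e t) 0\<bar> powr P) \<le> (LINT t|?M. \<bar>max (q e t) 0\<bar> powr P)"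
          using gP int_P[OF e] g by (intro integral_mono) (auto intro!: mult_left_le_one_le)
        then show "(LINT t|?M. g t * \<bar>max (q e t) 0\<bar> powr P) \<le> s powr P * m" using eS s by linarith
      qed (use P in simp)
      also have "1 / P * s powr (1 - P) * (s powr P * m) = 1 / P * s * m"
      proof -
        have "s powr (1 - P) * s powr P = s" using s by (simp add: powr_add[symmetric])
        then show ?thesis by (simp add: mult.assoc[symmetric])
      qed
      also have "1 / P * s * m + (1 - 1 / P) * s * m = s * m" by (simp add: algebra_simps)
      also have "\<dots> = m * s0 + \<epsilon>" using m by (simp add: s_def algebra_simps)
      finally show ?thesis .
    qed
    then have "(LINT t|?M. g t * q e t) \<le> m * s0" by (rule field_le_epsilon)
    then show ?thesis using False by (simp add: s0_def S_def P_def Lp_norm_def recip_exponent_def)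
  qed
qed

lemma (in sym_form) square_sum_orthogonal:
  assumes u: "\<And>i. i \<in> I \<Longrightarrow> u i \<in> D" and I: "finite I"
    and orth: "\<And>i j. i \<in> I \<Longrightarrow> j \<in> I \<Longrightarrow> i \<noteq> j \<Longrightarrow> c (u i) (u j) = 0"
  shows "c (\<Sum>i\<in>I. r i *\<^sub>R u i) (\<Sum>i\<in>I. r i *\<^sub>R u i) = (\<Sum>i\<in>I. (r i)\<^sup>2 * c (u i) (u i))"
proof -
  let ?s = "\<Sum>i\<in>I. r i *\<^sub>R u i"
  have s: "?s \<in> D" using u by (intro D_sum D_scale) auto
  have "c (u i) ?s = r i * c (u i) (u i)" if i: "i \<in> I" for i
  proof -
    have "c (u i) ?s = c ?s (u i)" using s u[OF i] by (simp add: sym)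
    also have "\<dots> = (\<Sum>j\<in>I. r j * c (u j) (u i))" using u i by (intro sum_left) auto
    also have "\<dots> = (\<Sum>j\<in>I. if j = i then r i * c (u i) (u i) else 0)"
      using orth i by (intro sum.cong) auto
    finally show ?thesis using i I by simp
  qed
  then show ?thesis
    using sum_left[of I u ?s r] u s by (simp add: power2_eq_square mult.assoc)
qed

section \<open>The bound from bumps on disjoint intervals, and the packing of intervals\<close>

context schroedinger_graph
begin

text \<open>The bumps vanish at all vertices, so they are admissible for every choice of couplings
  and contribute no vertex terms. Disjoint supports make mass and form diagonal on their span, so a
  quotient bound for the single bumps passes to all combinations.\<close>

lemma eigenvalue_le_disjoint_intervals:
  assumes k: "1 \<le> k" and h: "0 < h" and p: "1 \<le> p" "in_Lp G len p q"
    and E: "\<And>i. i < k \<Longrightarrow> E i \<in> arcs G" "\<And>i. i < k \<Longrightarrow> 0 \<le> a i" "\<And>i. i < k \<Longrightarrow> a i + h \<le> len (E i)"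
    and disj: "\<And>i j. i < k \<Longrightarrow> j < k \<Longrightarrow> i \<noteq> j \<Longrightarrow> E i = E j \<Longrightarrow> a i + h \<le> a j \<or> a j + h \<le> a i"
  shows "eigenvalue G len q \<alpha> k
    \<le> (2 / h) powr recip_exponent p * Lp_norm G len p (\<lambda>e x. max (q e x) 0) + (pi / h)\<^sup>2"
proof -
  define M where "M = (2 / h) powr recip_exponent p * Lp_norm G len p (\<lambda>e x. max (q e x) 0)"
  define F :: "nat \<Rightarrow> 'e sobolev" where
    "F i = ((\<lambda>e. if e = E i then sine_bump (a i) h else 0),
            (\<lambda>e. if e = E i then sine_bump_deriv (a i) h else 0))" for i
  have vv: "vertex_values G len (fst (F i)) (\<lambda>_. 0)" if "i < k" for i
    using E[OF that] by (auto simp: vertex_values_def F_def sine_bump_def)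
  have F: "F i \<in> form_domain" if "i < k" for i
    unfolding F_def
    by (rule form_domainI[OF _ _ vv[OF that, unfolded F_def fst_conv]])
      (auto simp: sine_bump_deriv_L2 sine_bump_weak_deriv h weak_deriv_zero L2.D_zero)
  have Fv: "vertex_value (fst (F i)) v = 0" if "i < k" "v \<in> verts G" for i v
    using vertex_values_unique[OF vv that(2)] that by simp
  have prod: "fst (F i) e t * fst (F j) e t = 0" "snd (F i) e t * snd (F j) e t = 0"
    if "i < k" "j < k" "i \<noteq> j" for i j e t
    using disj[OF that] sine_bump_disjoint[of "a i" h "a j"] by (auto simp: F_def)
  have orth: "mass (F i) (F j) = 0" "form (F i) (F j) = 0" if "i < k" "j < k" "i \<noteq> j" for i j
    unfolding mass_def form_def kinetic_def potential_def prod[OF that]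
    using Fv[OF that(1)] by simp_all
  have single: "(\<Sum>e\<in>arcs G. if e = E i then x else 0) = x" if "i < k" for i and x :: real
    using E(1)[OF that] by simp
  have mass_F: "mass (F i) (F i) = h / 2" if i: "i < k" for i
  proof -
    have "mass (F i) (F i) = (\<Sum>e\<in>arcs G. if e = E i then h / 2 else 0)"
      unfolding mass_def using integral_sine_bump_square(1)[OF h E(2,3)[OF i]]
      by (intro sum.cong) (auto simp: F_def power2_eq_square)
    then show ?thesis using single[OF i] by simp
  qed
  have kin_F: "kinetic (F i) (F i) = (pi / h)\<^sup>2 * (h / 2)" if i: "i < k" for i
  proof -
    have "kinetic (F i) (F i) = (\<Sum>e\<in>arcs G. if e = E i then (pi / h)\<^sup>2 * (h / 2) else 0)"
      unfolding kinetic_def using integral_sine_bump_square(2)[OF h E(2,3)[OF i]]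
      by (intro sum.cong) (auto simp: F_def power2_eq_square)
    then show ?thesis using single[OF i] by simp
  qed
  have pot_F: "potential (F i) (F i) \<le> M * (h / 2)" if i: "i < k" for i
  proof -
    have "potential (F i) (F i) = (\<Sum>e\<in>arcs G. if e = E i then
        (LINT t|edge_measure len (E i). (sine_bump (a i) h t)\<^sup>2 * q (E i) t) else 0)"
      unfolding potential_def
    proof (intro trans[OF arg_cong2[where f = "(+)", OF sum.cong[OF refl] sum.neutral] add_0_right] ballI)
      show "(LINT t|edge_measure len e. fst (F i) e t * fst (F i) e t * q e t) = (if e = E i then
        (LINT t|edge_measure len (E i). (sine_bump (a i) h t)\<^sup>2 * q (E i) t) else 0)" for e
        by (simp add: F_def power2_eq_square)
    qed (simp add: Fv[OF i])
    also have "\<dots> = (LINT t|edge_measure len (E i). (sine_bump (a i) h t)\<^sup>2 * q (E i) t)"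
      using single[OF i] by simp
    \<comment> \<open>The weight is the squared bump with integral \<open>m = h / 2\<close>; its
      reciprocal is the origin of the factor \<open>2 / h\<close>.\<close>
    also have "\<dots> \<le> h / 2 * ((1 / (h / 2)) powr recip_exponent p * Lp_norm G len p (\<lambda>e x. max (q e x) 0))"
      using h sine_bump_square_le integral_sine_bump_square(1)[OF h E(2,3)[OF i]]
      by (intro weighted_potential_le p E(1)[OF i] continuous_intros sine_bump_continuous) auto
    finally show ?thesis by (simp add: M_def mult.commute)
  qed
  have form_F: "form (F i) (F i) \<le> (M + (pi / h)\<^sup>2) * (h / 2)" if i: "i < k" for i
    using kin_F[OF i] pot_F[OF i] by (simp add: form_def distrib_right)
  have mass_sum: "mass (\<Sum>i<k. c i *\<^sub>R F i) (\<Sum>i<k. c i *\<^sub>R F i) = (\<Sum>i<k. (c i)\<^sup>2 * (h / 2))" for c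
    using F orth(1) by (subst mass.square_sum_orthogonal) (auto simp: mass_F intro!: sum.cong)
  have form_sum: "form (\<Sum>i<k. c i *\<^sub>R F i) (\<Sum>i<k. c i *\<^sub>R F i) = (\<Sum>i<k. (c i)\<^sup>2 * form (F i) (F i))" for c
    using F orth by (subst form.square_sum_orthogonal) auto
  have "eigenvalue G len q \<alpha> k \<le> M + (pi / h)\<^sup>2"
  proof (rule eigenvalue_le[OF k F])
    fix c :: "nat \<Rightarrow> real"
    show "mass (\<Sum>i<k. c i *\<^sub>R F i) (\<Sum>i<k. c i *\<^sub>R F i) > 0" if nz: "\<exists>i<k. c i \<noteq> 0"
    proof -
      obtain i where "i < k" "c i \<noteq> 0" using nz by blast
      then show ?thesis unfolding mass_sum using h by (intro sum_pos2[of _ i]) auto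
    qed
    have "(\<Sum>i<k. (c i)\<^sup>2 * form (F i) (F i)) \<le> (\<Sum>i<k. (c i)\<^sup>2 * ((M + (pi / h)\<^sup>2) * (h / 2)))"
      using form_F by (intro sum_mono mult_left_mono) auto
    then show "form (\<Sum>i<k. c i *\<^sub>R F i) (\<Sum>i<k. c i *\<^sub>R F i)
        \<le> (M + (pi / h)\<^sup>2) * mass (\<Sum>i<k. c i *\<^sub>R F i) (\<Sum>i<k. c i *\<^sub>R F i)"
      unfolding mass_sum form_sum by (simp add: sum_distrib_left mult_ac)
  qed
  then show ?thesis by (simp add: M_def)
qed

end

lemma (in metric_graph) disjoint_intervals_exist:
  assumes k: "1 \<le> k" and h: "h = total_length G len / (real k - 1 + real (card (arcs G)))"
  obtains E :: "nat \<Rightarrow> 'e" and a :: "nat \<Rightarrow> real"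
  where "\<And>i. i < k \<Longrightarrow> E i \<in> arcs G" "\<And>i. i < k \<Longrightarrow> 0 \<le> a i" "\<And>i. i < k \<Longrightarrow> a i + h \<le> len (E i)"
    "\<And>i j. i < k \<Longrightarrow> j < k \<Longrightarrow> i \<noteq> j \<Longrightarrow> E i = E j \<Longrightarrow> a i + h \<le> a j \<or> a j + h \<le> a i"
proof -
  have cardE: "1 \<le> card (arcs G)" using arcs_nonempty by (simp add: Suc_le_eq card_gt_0_iff)
  note L = total_length_pos
  have h0: "0 < h" using L k cardE by (simp add: h)
  have Lh: "total_length G len / h = real k - 1 + real (card (arcs G))"
    using L k cardE by (simp add: h)
  define n where "n e = nat \<lfloor>len e / h\<rfloor>" for e
  have n: "len e / h - 1 < real (n e)" "real (n e) * h \<le> len e" if "e \<in> arcs G" for e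
  proof -
    have nonneg: "0 \<le> len e / h" using len_pos[OF that] h0 by simp
    then have eq: "real (n e) = of_int \<lfloor>len e / h\<rfloor>" by (simp add: n_def)
    show "len e / h - 1 < real (n e)" unfolding eq by linarith
    have "real (n e) \<le> len e / h" unfolding eq by linarith
    then show "real (n e) * h \<le> len e" using h0 by (simp add: pos_le_divide_eq)
  qed
  \<comment> \<open>The pair \<open>(e, j)\<close> stands for the interval of length
    \<open>h\<close> that starts at \<open>j * h\<close> on edge \<open>e\<close>.\<close>
  define I where "I = (SIGMA e:arcs G. {..<n e})"
  \<comment> \<open>The choice of \<open>h\<close> makes this sum exactly \<open>k - 1\<close>.
    Rounding down loses strictly less than 1 per edge, so the integer \<open>card I\<close> exceeds
    \<open>k - 1\<close> and is therefore at least \<open>k\<close>.\<close>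
  have "real k - 1 = (\<Sum>e\<in>arcs G. len e / h - 1)"
    using Lh by (simp add: total_length_def sum_subtractf sum_divide_distrib)
  also have "\<dots> < (\<Sum>e\<in>arcs G. real (n e))"
    using n arcs_nonempty by (intro sum_strict_mono) auto
  also have "\<dots> = real (card I)" by (simp add: I_def)
  finally have "k \<le> card I" by linarith
  then obtain g where g: "g ` {..<k} \<subseteq> I" "inj_on g {..<k}"
    using card_le_inj[of "{..<k}" I] by (auto simp: I_def)
  have gI: "fst (g i) \<in> arcs G" "snd (g i) < n (fst (g i))" if "i < k" for i
    using g(1) that by (auto simp: I_def)
  show thesis
  proof (rule that[of "\<lambda>i. fst (g i)" "\<lambda>i. real (snd (g i)) * h"])
    fix i assume i: "i < k"
    show "fst (g i) \<in> arcs G" by (rule gI[OF i])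
    show "0 \<le> real (snd (g i)) * h" using h0 by simp
    have "real (snd (g i)) * h + h = real (Suc (snd (g i))) * h" by (simp add: algebra_simps)
    also have "\<dots> \<le> real (n (fst (g i))) * h" using gI(2)[OF i] h0 by (intro mult_right_mono) auto
    also have "\<dots> \<le> len (fst (g i))" by (rule n(2)[OF gI(1)[OF i]])
    finally show "real (snd (g i)) * h + h \<le> len (fst (g i))" .
  next
    fix i j assume ij: "i < k" "j < k" "i \<noteq> j" "fst (g i) = fst (g j)"
    then have ne: "snd (g i) \<noteq> snd (g j)" using g(2) by (metis inj_onD lessThan_iff prod_eqI)
    have step: "real x * h + h \<le> real y * h" if "x < y" for x y :: nat
    proof -
      have "real (Suc x) * h \<le> real y * h" using that h0 by (intro mult_right_mono) auto
      then show ?thesis by (simp add: algebra_simps)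
    qed
    show "real (snd (g i)) * h + h \<le> real (snd (g j)) * h \<or> real (snd (g j)) * h + h \<le> real (snd (g i)) * h"
      using ne step by (metis linorder_neqE_nat)
  qed
qed

theorem theorem1p4:
  fixes G :: "('v, 'e) pre_digraph" and len :: "'e \<Rightarrow> real"
    and p :: ennreal and q :: "'e \<Rightarrow> real \<Rightarrow> real" and \<alpha> :: "'v \<Rightarrow> ereal" and k :: nat
  assumes "metric_graph G len"
    and "1 \<le> p"
    and "in_Lp G len p q"
    and "\<And>v. v \<in> verts G \<Longrightarrow> \<alpha> v \<noteq> -\<infinity>"
    and "1 \<le> k"
  shows "eigenvalue G len q \<alpha> k
           \<le> (2 * real k / min_length G len) powr recip_exponent p
                * Lp_norm G len p (\<lambda>e x. max (q e x) 0)
             + pi\<^sup>2 / (total_length G len)\<^sup>2 * (real k - 1 + real (card (arcs G)))\<^sup>2"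
proof -
  interpret metric_graph G len by fact
  interpret schroedinger_graph G len q \<alpha>
    by unfold_locales (use assms in_Lp_integrable in auto)
  define m where "m = real k - 1 + real (card (arcs G))"
  define h where "h = total_length G len / m"
  have cardE: "1 \<le> card (arcs G)" using arcs_nonempty by (simp add: Suc_le_eq card_gt_0_iff)
  have m: "0 < m" using cardE \<open>1 \<le> k\<close> by (simp add: m_def)
  have h: "0 < h" using m total_length_pos by (simp add: h_def)
  obtain E a where E: "\<And>i. i < k \<Longrightarrow> E i \<in> arcs G" "\<And>i. i < k \<Longrightarrow> 0 \<le> a i"
    "\<And>i. i < k \<Longrightarrow> a i + h \<le> len (E i)"
    "\<And>i j. i < k \<Longrightarrow> j < k \<Longrightarrow> i \<noteq> j \<Longrightarrow> E i = E j \<Longrightarrow> a i + h \<le> a j \<or> a j + h \<le> a i"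
    by (rule disjoint_intervals_exist[OF \<open>1 \<le> k\<close> h_def[unfolded m_def]]) blast
  have "eigenvalue G len q \<alpha> k
      \<le> (2 / h) powr recip_exponent p * Lp_norm G len p (\<lambda>e x. max (q e x) 0) + (pi / h)\<^sup>2"
    by (rule eigenvalue_le_disjoint_intervals[OF \<open>1 \<le> k\<close> h \<open>1 \<le> p\<close> \<open>in_Lp G len p q\<close> E])
  also have "(2 / h) powr recip_exponent p * Lp_norm G len p (\<lambda>e x. max (q e x) 0)
      \<le> (2 * real k / min_length G len) powr recip_exponent p * Lp_norm G len p (\<lambda>e x. max (q e x) 0)"
  proof (intro mult_right_mono powr_mono2 recip_exponent_nonneg Lp_norm_nonneg assms)
    \<comment> \<open>From \<open>(k - 1) * (card (arcs G) - 1) \<ge> 0\<close> comes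
      \<open>m \<le> k * card (arcs G)\<close>, and all edges together have length at least
      \<open>card (arcs G) * min_length G len\<close>. Hence
      \<open>1 / h \<le> k / min_length G len\<close>.\<close>
    have "m * min_length G len \<le> real k * real (card (arcs G)) * min_length G len"
    proof (rule mult_right_mono)
      have "0 \<le> (real k - 1) * (real (card (arcs G)) - 1)"
        using cardE \<open>1 \<le> k\<close> by (intro mult_nonneg_nonneg) auto
      then show "m \<le> real k * real (card (arcs G))" by (simp add: m_def algebra_simps)
    qed (use min_length_pos in simp)
    also have "real (card (arcs G)) * min_length G len \<le> total_length G len"
      unfolding total_length_def using min_length_le by (intro sum_bounded_below[THEN order_trans[rotated]]) auto
    then have "real k * real (card (arcs G)) * min_length G len \<le> real k * total_length G len"
      by (simp add: mult.assoc mult_left_mono)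
    finally have "m * min_length G len \<le> real k * total_length G len" .
    then show "2 / h \<le> 2 * real k / min_length G len"
      using m min_length_pos total_length_pos by (simp add: h_def divide_simps mult_ac)
    show "0 \<le> 2 / h" using h by simp
  qed
  also have "(pi / h)\<^sup>2 = pi\<^sup>2 / (total_length G len)\<^sup>2 * m\<^sup>2"
    by (simp add: h_def power_divide power_mult_distrib)
  finally show ?thesis by (simp add: m_def)
qed

end
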